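(* Let $\mathbb{F}$ be an algebraically closed field of characteristic $0$, $n\ge2$, and $\lambda\in\mathbb{F}$ with $\lambda\neq0$. Every finite dimensional uniserial representation $T:\mathfrak{g}_{n,\lambda}\to\mathfrak{gl}(U)$ satisfying $\ker(T)\cap V=0$ is isomorphic to one and only one normalized representation $R_{\vec d,\alpha,S}$ with $\alpha\in\mathbb{F}$ and $\vec d=(d_1,\dots,d_{\ell+1})$ (for some $\ell\ge1$) satisfying $d_1+\cdots+d_{\ell+1}=\dim U$ and $$\max\{d_i+d_{i+1}:1\le i\le\ell\}=n+1.$$
   Context: Let $V$ be an $\mathbb{F}$-vector space of dimension $n\ge2$ with basis $v_0,\dots,v_{n-1}$ and $\mathcal{L}(V)$ the free Lie algebra on $V$. Let $x$ be the derivation of $\mathcal{L}(V)$ extending the linear map of $V$ given by $x v_j=\lambda v_j+v_{j+1}$ for $0\le j<n-1$ and $xv_{n-1}=\lambda v_{n-1}$ (a single Jordan block). Set $\mathfrak{g}_{n,\lambda}=\langle x\rangle\ltimes\mathcal{L}(V)$. A finite dimensional representation is uniserial if its submodules are totally ordered by inclusion. Let $\vec d=(d_1,\dots,d_{\ell+1})$, $\ell\ge1$, be positive integers, $d=d_1+\cdots+d_{\ell+1}$, with matrices in $\mathfrak{gl}(d)=\mathfrak{gl}(d,\mathbb{F})$ partitioned into blocks according to $\vec d$. Let $S=(S(1),\dots,S(\ell))$ with $S(i)\in M_{d_i\times d_{i+1}}(\mathbb{F})$ and $S(i)_{d_i,1}\neq0$. $J^p(\beta)$ is the upper triangular Jordan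 block of size $p$ and eigenvalue $\beta$. $D(\alpha,\lambda)=J^{d_1}(\alpha)\oplus J^{d_2}(\alpha-\lambda)\oplus\cdots\oplus J^{d_{\ell+1}}(\alpha-\ell\lambda)$, and $E(S)\in\mathfrak{gl}(d)$ has $(i,i+1)$ block $S(i)$ and all other blocks $0$. If $\max\{d_i+d_{i+1}:1\le i\le\ell\}\le n+1$, the representation $R_{\vec d,\alpha,S}:\mathfrak{g}_{n,\lambda}\to\mathfrak{gl}(d)$ is determined by $R_{\vec d,\alpha,S}(x)=D(\alpha,\lambda)$ and $R_{\vec d,\alpha,S}(v_j)=(\mathrm{ad}_{\mathfrak{gl}(d)}D(\alpha,\lambda)-\lambda)^j(E(S))$, $0\le j\le n-1$. $R_{\vec d,\alpha,S}$ is called normalized if $S$ is normalized, i.e.: (i) $S(i)_{d_i,1}=1$ for $1\le i\le \ell$; (ii) $S(i)_{d_i,j}=S(i+1)_{d_{i+1}+1-j,1}$ for $1\le j\le d_{i+1}$ and $1\le i\le \ell-1$; (iii) $S(1)_{j,1}=0$ for $1\le j<d_1$, and $S(\ell)_{d_{\ell},j}=0$ for $1<j\le d_{\ell+1}$. *)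

theory Defs
  imports "Jordan_Normal_Form.Jordan_Normal_Form" "Jordan_Normal_Form.VS_Connect"
begin

section \<open>Lie algebras\<close>

text \<open>Lie algebras over the field given by the type \<open>'k\<close>. The ring fields \<open>mult\<close> and \<open>one\<close>
  of the module record carry no meaning for modules (as in \<open>module_vec\<close>).\<close>

record ('k, 'g) lie = "('k, 'g) module" +
  bracket :: "'g \<Rightarrow> 'g \<Rightarrow> 'g"

locale lie_algebra = vectorspace "class_ring :: 'k :: field ring" L
  for L :: "('k :: field, 'g) lie" (structure) +
  assumes bracket_closed [simp, intro]:
      "a \<in> carrier L \<Longrightarrow> b \<in> carrier L \<Longrightarrow> bracket L a b \<in> carrier L"
    and bracket_add_left:
      "a \<in> carrier L \<Longrightarrow> b \<in> carrier L \<Longrightarrow> c \<in> carrier L \<Longrightarrow>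
        bracket L (a \<oplus> b) c = bracket L a c \<oplus> bracket L b c"
    and bracket_add_right:
      "a \<in> carrier L \<Longrightarrow> b \<in> carrier L \<Longrightarrow> c \<in> carrier L \<Longrightarrow>
        bracket L a (b \<oplus> c) = bracket L a b \<oplus> bracket L a c"
    and bracket_smult_left:
      "a \<in> carrier L \<Longrightarrow> b \<in> carrier L \<Longrightarrow> bracket L (k \<odot> a) b = k \<odot> bracket L a b"
    and bracket_smult_right:
      "a \<in> carrier L \<Longrightarrow> b \<in> carrier L \<Longrightarrow> bracket L a (k \<odot> b) = k \<odot> bracket L a b"
    and bracket_self: "a \<in> carrier L \<Longrightarrow> bracket L a a = \<zero>"
    and jacobi:
      "a \<in> carrier L \<Longrightarrow> b \<in> carrier L \<Longrightarrow> c \<in> carrier L \<Longrightarrow>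
        bracket L a (bracket L b c) \<oplus> bracket L b (bracket L c a)
          \<oplus> bracket L c (bracket L a b) = \<zero>"

definition lie_hom :: "('k, 'g) lie \<Rightarrow> ('k, 'h) lie \<Rightarrow> ('g \<Rightarrow> 'h) set" where
  "lie_hom L M = {f \<in> carrier L \<rightarrow> carrier M.
     (\<forall>a\<in>carrier L. \<forall>b\<in>carrier L. f (a \<oplus>\<^bsub>L\<^esub> b) = f a \<oplus>\<^bsub>M\<^esub> f b) \<and>
     (\<forall>k. \<forall>a\<in>carrier L. f (k \<odot>\<^bsub>L\<^esub> a) = k \<odot>\<^bsub>M\<^esub> f a) \<and>
     (\<forall>a\<in>carrier L. \<forall>b\<in>carrier L. f (bracket L a b) = bracket M (f a) (f b))}"

definition lie_derivation :: "('k, 'g) lie \<Rightarrow> ('g \<Rightarrow> 'g) \<Rightarrow> bool" where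
  "lie_derivation L D \<longleftrightarrow> D \<in> carrier L \<rightarrow> carrier L \<and>
     (\<forall>a\<in>carrier L. \<forall>b\<in>carrier L. D (a \<oplus>\<^bsub>L\<^esub> b) = D a \<oplus>\<^bsub>L\<^esub> D b) \<and>
     (\<forall>k. \<forall>a\<in>carrier L. D (k \<odot>\<^bsub>L\<^esub> a) = k \<odot>\<^bsub>L\<^esub> D a) \<and>
     (\<forall>a\<in>carrier L. \<forall>b\<in>carrier L.
        D (bracket L a b) = bracket L (D a) b \<oplus>\<^bsub>L\<^esub> bracket L a (D b))"

text \<open>\<open>gl(U)\<close> for a vector space given by a type and its scalar multiplication, and \<open>gl(d)\<close>.\<close>

definition gl_space :: "('k :: field \<Rightarrow> 'u \<Rightarrow> 'u) \<Rightarrow> ('k, 'u :: ab_group_add \<Rightarrow> 'u) lie" where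
  "gl_space sU = \<lparr>carrier = {f. Vector_Spaces.linear sU sU f}, mult = undefined, one = undefined,
     zero = (\<lambda>u. 0), add = (\<lambda>f g u. f u + g u), smult = (\<lambda>k f u. sU k (f u)),
     bracket = (\<lambda>f g u. f (g u) - g (f u))\<rparr>"

definition gl_mat :: "nat \<Rightarrow> ('k :: field, 'k mat) lie" where
  "gl_mat d = \<lparr>carrier = carrier_mat d d, mult = undefined, one = undefined,
     zero = 0\<^sub>m d d, add = (+), smult = (\<cdot>\<^sub>m),
     bracket = (\<lambda>A B. A * B - B * A)\<rparr>"

text \<open>The semidirect product \<open>\<langle>x\<rangle> \<ltimes> L\<close>, where the basis element \<open>x\<close>, represented by \<open>(1, 0)\<close>,
  acts on \<open>L\<close> by the derivation \<open>D\<close>: the pair \<open>(a, y)\<close> stands for \<open>a x + y\<close>.\<close>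

definition semidirect :: "('k :: field, 'g) lie \<Rightarrow> ('g \<Rightarrow> 'g) \<Rightarrow> ('k, 'k \<times> 'g) lie" where
  "semidirect L D = \<lparr>carrier = UNIV \<times> carrier L, mult = undefined, one = undefined,
     zero = (0, \<zero>\<^bsub>L\<^esub>),
     add = (\<lambda>(a, y) (b, z). (a + b, y \<oplus>\<^bsub>L\<^esub> z)),
     smult = (\<lambda>k (a, y). (k * a, k \<odot>\<^bsub>L\<^esub> y)),
     bracket = (\<lambda>(a, y) (b, z).
       (0, (a \<odot>\<^bsub>L\<^esub> D z \<oplus>\<^bsub>L\<^esub> (- b) \<odot>\<^bsub>L\<^esub> D y) \<oplus>\<^bsub>L\<^esub> bracket L y z))\<rparr>"

section \<open>The free Lie algebra on a vector space\<close>

text \<open>The space \<open>V\<close> is a type with scalar multiplication \<open>s\<close>. The free Lie algebra on \<open>V\<close> is the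
  set of formal Lie expressions in elements of \<open>V\<close>, modulo the smallest congruence that forces the
  axioms of a Lie algebra and the linearity of the inclusion of \<open>V\<close>.\<close>

datatype ('k, 'v) lie_term =
    Gen 'v
  | Zero
  | Add "('k, 'v) lie_term" "('k, 'v) lie_term"
  | Smul 'k "('k, 'v) lie_term"
  | Brk "('k, 'v) lie_term" "('k, 'v) lie_term"

inductive lie_eq ::
  "('k :: field \<Rightarrow> 'v :: ab_group_add \<Rightarrow> 'v) \<Rightarrow> ('k, 'v) lie_term \<Rightarrow> ('k, 'v) lie_term \<Rightarrow> bool"
  for s where
  lie_refl: "lie_eq s a a"
| lie_sym: "lie_eq s a b \<Longrightarrow> lie_eq s b a"
| lie_trans: "lie_eq s a b \<Longrightarrow> lie_eq s b c \<Longrightarrow> lie_eq s a c"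
| cong_Add: "lie_eq s a a' \<Longrightarrow> lie_eq s b b' \<Longrightarrow> lie_eq s (Add a b) (Add a' b')"
| cong_Smul: "lie_eq s a a' \<Longrightarrow> lie_eq s (Smul k a) (Smul k a')"
| cong_Brk: "lie_eq s a a' \<Longrightarrow> lie_eq s b b' \<Longrightarrow> lie_eq s (Brk a b) (Brk a' b')"
| Add_assoc: "lie_eq s (Add (Add a b) c) (Add a (Add b c))"
| Add_comm: "lie_eq s (Add a b) (Add b a)"
| Add_Zero: "lie_eq s (Add Zero a) a"
| Add_inv: "lie_eq s (Add (Smul (- 1) a) a) Zero"
| Smul_one: "lie_eq s (Smul 1 a) a"
| Smul_Smul: "lie_eq s (Smul k (Smul l a)) (Smul (k * l) a)"
| Smul_add: "lie_eq s (Smul (k + l) a) (Add (Smul k a) (Smul l a))"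
| Smul_Add: "lie_eq s (Smul k (Add a b)) (Add (Smul k a) (Smul k b))"
| Brk_Add_left: "lie_eq s (Brk (Add a b) c) (Add (Brk a c) (Brk b c))"
| Brk_Add_right: "lie_eq s (Brk a (Add b c)) (Add (Brk a b) (Brk a c))"
| Brk_Smul_left: "lie_eq s (Brk (Smul k a) b) (Smul k (Brk a b))"
| Brk_Smul_right: "lie_eq s (Brk a (Smul k b)) (Smul k (Brk a b))"
| Brk_self: "lie_eq s (Brk a a) Zero"
| Jacobi: "lie_eq s (Add (Add (Brk a (Brk b c)) (Brk b (Brk c a))) (Brk c (Brk a b))) Zero"
| Gen_add: "lie_eq s (Gen (v + w)) (Add (Gen v) (Gen w))"
| Gen_scale: "lie_eq s (Gen (s k v)) (Smul k (Gen v))"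

definition lie_class ::
  "('k :: field \<Rightarrow> 'v :: ab_group_add \<Rightarrow> 'v) \<Rightarrow> ('k, 'v) lie_term \<Rightarrow> ('k, 'v) lie_term set" where
  "lie_class s t = {u. lie_eq s t u}"

definition free_lie ::
  "('k :: field \<Rightarrow> 'v :: ab_group_add \<Rightarrow> 'v) \<Rightarrow> ('k, ('k, 'v) lie_term set) lie" where
  "free_lie s = \<lparr>carrier = range (lie_class s), mult = undefined, one = undefined,
     zero = lie_class s Zero,
     add = (\<lambda>A B. \<Union>a\<in>A. \<Union>b\<in>B. lie_class s (Add a b)),
     smult = (\<lambda>k A. \<Union>a\<in>A. lie_class s (Smul k a)),
     bracket = (\<lambda>A B. \<Union>a\<in>A. \<Union>b\<in>B. lie_class s (Brk a b))\<rparr>"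

text \<open>The derivation of the free Lie algebra extending a linear endomorphism \<open>X\<close> of \<open>V\<close>.\<close>

primrec term_derivation :: "('v \<Rightarrow> 'v) \<Rightarrow> ('k, 'v) lie_term \<Rightarrow> ('k, 'v) lie_term" where
  "term_derivation X (Gen v) = Gen (X v)"
| "term_derivation X Zero = Zero"
| "term_derivation X (Add a b) = Add (term_derivation X a) (term_derivation X b)"
| "term_derivation X (Smul k a) = Smul k (term_derivation X a)"
| "term_derivation X (Brk a b) = Add (Brk (term_derivation X a) b) (Brk a (term_derivation X b))"

definition free_derivation ::
  "('k :: field \<Rightarrow> 'v :: ab_group_add \<Rightarrow> 'v) \<Rightarrow> ('v \<Rightarrow> 'v) \<Rightarrow>
     ('k, 'v) lie_term set \<Rightarrow> ('k, 'v) lie_term set" where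
  "free_derivation s X A = (\<Union>a\<in>A. lie_class s (term_derivation X a))"

lemma lie_class_eq_iff: "lie_class s a = lie_class s b \<longleftrightarrow> lie_eq s a b"
  unfolding lie_class_def by (auto intro: lie_eq.lie_refl lie_eq.lie_sym lie_eq.lie_trans)

lemma free_lie_simps:
  "carrier (free_lie s) = range (lie_class s)"
  "\<zero>\<^bsub>free_lie s\<^esub> = lie_class s Zero"
  "lie_class s a \<oplus>\<^bsub>free_lie s\<^esub> lie_class s b = lie_class s (Add a b)"
  "k \<odot>\<^bsub>free_lie s\<^esub> lie_class s a = lie_class s (Smul k a)"
  "bracket (free_lie s) (lie_class s a) (lie_class s b) = lie_class s (Brk a b)"
proof -
  have *: "(\<Union>a'\<in>lie_class s a. f a') = f a"
    if "\<And>a'. lie_eq s a a' \<Longrightarrow> f a' = f a" for f :: "('a, 'b) lie_term \<Rightarrow> ('a, 'b) lie_term set" and a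
    using that lie_eq.lie_refl[of s a] unfolding lie_class_def by blast
  show "carrier (free_lie s) = range (lie_class s)" "\<zero>\<^bsub>free_lie s\<^esub> = lie_class s Zero"
    by (simp_all add: free_lie_def)
  show "k \<odot>\<^bsub>free_lie s\<^esub> lie_class s a = lie_class s (Smul k a)"
    unfolding free_lie_def
    by simp (rule *, simp add: lie_class_eq_iff lie_eq.cong_Smul lie_eq.lie_sym)
  have **: "(\<Union>a'\<in>lie_class s a. \<Union>b'\<in>lie_class s b. lie_class s (F a' b')) = lie_class s (F a b)"
    if F: "\<And>a a' b b'. lie_eq s a a' \<Longrightarrow> lie_eq s b b' \<Longrightarrow> lie_eq s (F a b) (F a' b')" for F
  proof -
    have 1: "(\<Union>b'\<in>lie_class s b. lie_class s (F a' b')) = lie_class s (F a' b)" for a'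
      by (rule *) (simp add: lie_class_eq_iff F lie_eq.lie_sym lie_eq.lie_refl)
    show ?thesis unfolding 1
      by (rule *) (simp add: lie_class_eq_iff F lie_eq.lie_sym lie_eq.lie_refl)
  qed
  show "lie_class s a \<oplus>\<^bsub>free_lie s\<^esub> lie_class s b = lie_class s (Add a b)"
    unfolding free_lie_def by (simp add: ** lie_eq.cong_Add)
  show "bracket (free_lie s) (lie_class s a) (lie_class s b) = lie_class s (Brk a b)"
    unfolding free_lie_def by (simp add: ** lie_eq.cong_Brk)
qed

lemma lie_algebra_free_lie: "lie_algebra (free_lie s)"
proof -
  let ?L = "free_lie s"
  note simps = rangeI free_lie_simps lie_class_eq_iff lie_eq.intros(7-)
  have ag: "abelian_group ?L"
  proof (rule abelian_groupI)
    fix a assume "a \<in> carrier ?L"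
    then obtain t where t: "a = lie_class s t" by (auto simp: free_lie_simps)
    have "lie_class s (Smul (- 1) t) \<in> carrier ?L"
      "lie_class s (Smul (- 1) t) \<oplus>\<^bsub>?L\<^esub> a = \<zero>\<^bsub>?L\<^esub>"
      by (simp_all add: t simps)
    then show "\<exists>b\<in>carrier ?L. b \<oplus>\<^bsub>?L\<^esub> a = \<zero>\<^bsub>?L\<^esub>" by blast
  qed (clarsimp simp: simps)+
  have m: "Module.module (class_ring :: 'a ring) ?L"
    by (rule Module.moduleI[OF class_cring.cring_axioms ag])
      (clarsimp simp: simps class_ring_simps lie_eq.intros(7-)[THEN lie_eq.lie_sym])+
  show ?thesis
    by (rule lie_algebra.intro[OF vectorspace.intro[OF m class_field] lie_algebra_axioms.intro])
      (clarsimp simp: simps)+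
qed

lemma lie_class_Gen_linear:
  "lie_class s (Gen (v + w)) = lie_class s (Gen v) \<oplus>\<^bsub>free_lie s\<^esub> lie_class s (Gen w)"
  "lie_class s (Gen (s k v)) = k \<odot>\<^bsub>free_lie s\<^esub> lie_class s (Gen v)"
  by (simp_all add: free_lie_simps lie_class_eq_iff lie_eq.intros(7-))

primrec lie_eval :: "('k, 'g) lie \<Rightarrow> ('v \<Rightarrow> 'g) \<Rightarrow> ('k, 'v) lie_term \<Rightarrow> 'g" where
  "lie_eval L f (Gen v) = f v"
| "lie_eval L f Zero = \<zero>\<^bsub>L\<^esub>"
| "lie_eval L f (Add a b) = lie_eval L f a \<oplus>\<^bsub>L\<^esub> lie_eval L f b"
| "lie_eval L f (Smul k a) = k \<odot>\<^bsub>L\<^esub> lie_eval L f a"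
| "lie_eval L f (Brk a b) = bracket L (lie_eval L f a) (lie_eval L f b)"

text \<open>The universal property of the free Lie algebra on \<open>V\<close>.\<close>

lemma (in lie_algebra) free_lie_extension:
  fixes s :: "'k \<Rightarrow> 'v :: ab_group_add \<Rightarrow> 'v"
  assumes f: "\<And>v. f v \<in> carrier L" "\<And>v w. f (v + w) = f v \<oplus> f w" "\<And>k v. f (s k v) = k \<odot> f v"
  shows "\<exists>h\<in>lie_hom (free_lie s) L. \<forall>v. h (lie_class s (Gen v)) = f v"
proof -
  note [simp] = class_ring_simps
  have cl [simp]: "lie_eval L f t \<in> carrier L" for t
    by (induction t) (simp_all add: f(1))
  have resp: "lie_eval L f a = lie_eval L f b" if "lie_eq s a b" for a b
    using that
  proof (induction rule: lie_eq.induct)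
    case (Add_inv a)
    have "\<zero> = (-1 + 1) \<odot> lie_eval L f a"
      using smult_l_null[of "lie_eval L f a"] by simp
    also have "\<dots> = (-1) \<odot> lie_eval L f a \<oplus> 1 \<odot> lie_eval L f a"
      using smult_l_distr[of "-1" 1 "lie_eval L f a"] by simp
    also have "1 \<odot> lie_eval L f a = lie_eval L f a"
      using smult_one[of "lie_eval L f a"] by simp
    finally show ?case by simp
  next
    case (Jacobi a b c)
    then show ?case using jacobi[of "lie_eval L f a" "lie_eval L f b" "lie_eval L f c"] by simp
  next
    case (Smul_one a)
    then show ?case using smult_one[of "lie_eval L f a"] by simp
  next
    case (Smul_Smul k l a)
    then show ?case using smult_assoc1[of k l "lie_eval L f a"] by simp
  next
    case (Smul_add k l a)
    then show ?case using smult_l_distr[of k l "lie_eval L f a"] by simp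
  qed (simp_all add: a_ac smult_r_distr bracket_add_left bracket_add_right bracket_smult_left
      bracket_smult_right bracket_self f)
  define h where "h A = lie_eval L f (SOME a. a \<in> A)" for A
  have h: "h (lie_class s a) = lie_eval L f a" for a
  proof -
    have "(SOME b. b \<in> lie_class s a) \<in> lie_class s a"
      by (rule someI[of _ a]) (simp add: lie_class_def lie_eq.lie_refl)
    then show ?thesis
      unfolding h_def by (metis resp lie_class_def mem_Collect_eq)
  qed
  have "h \<in> lie_hom (free_lie s) L"
    unfolding lie_hom_def by (auto simp: free_lie_simps h)
  moreover have "h (lie_class s (Gen v)) = f v" for v
    by (simp add: h)
  ultimately show ?thesis by blast
qed

lemma free_lie_hom_unique:
  assumes L: "lie_algebra L"
    and h: "h \<in> lie_hom (free_lie s) L" "h' \<in> lie_hom (free_lie s) L"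
    and eq: "\<And>v. h (lie_class s (Gen v)) = h' (lie_class s (Gen v))"
    and A: "A \<in> carrier (free_lie s)"
  shows "h A = h' A"
proof -
  interpret lie_algebra L by (rule L)
  have hom: "g (lie_class s a) \<in> carrier L"
    "g (lie_class s (Add a b)) = g (lie_class s a) \<oplus>\<^bsub>L\<^esub> g (lie_class s b)"
    "g (lie_class s (Smul k a)) = k \<odot>\<^bsub>L\<^esub> g (lie_class s a)"
    "g (lie_class s (Brk a b)) = bracket L (g (lie_class s a)) (g (lie_class s b))"
    if "g \<in> lie_hom (free_lie s) L" for g k a b
    using that by (auto simp: lie_hom_def free_lie_simps)
  have ZZ: "lie_class s Zero = lie_class s (Add Zero Zero)"
    by (simp add: lie_class_eq_iff lie_eq.intros(7-)[THEN lie_eq.lie_sym])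
  have Z: "g (lie_class s Zero) = \<zero>\<^bsub>L\<^esub>" if g: "g \<in> lie_hom (free_lie s) L" for g
  proof -
    have "g (lie_class s Zero) = g (lie_class s Zero) \<oplus>\<^bsub>L\<^esub> g (lie_class s Zero)"
      by (rule trans[OF arg_cong[OF ZZ, of g] hom(2)[OF g]])
    then show ?thesis using hom(1)[OF g, of Zero] add.r_cancel_one'[of "g (lie_class s Zero)"]
      by blast
  qed
  have "h (lie_class s t) = h' (lie_class s t)" for t
  proof (induction t)
    case Zero
    show ?case by (simp add: Z h)
  qed (simp_all add: eq hom h)
  then show ?thesis using A by (auto simp: free_lie_simps)
qed

lemma free_derivation_class:
  assumes X: "Vector_Spaces.linear s s X"
  shows "free_derivation s X (lie_class s t) = lie_class s (term_derivation X t)"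
proof -
  interpret X: Vector_Spaces.linear s s X by (rule X)
  interpret lie_algebra "free_lie s" by (rule lie_algebra_free_lie)
  let ?L = "free_lie s" and ?d = "term_derivation X" and ?c = "lie_class s"
  note [simp] = class_ring_simps
  have cl [simp]: "?c a \<in> carrier ?L" for a by (simp add: free_lie_simps)
  note S = free_lie_simps(2-5)[symmetric]
  have "?c (?d a) = ?c (?d b)" if "lie_eq s a b" for a b
    using that
  proof (induction rule: lie_eq.induct)
    case (Brk_self a)
    have "\<zero>\<^bsub>?L\<^esub> = bracket ?L (?c a \<oplus>\<^bsub>?L\<^esub> ?c (?d a)) (?c a \<oplus>\<^bsub>?L\<^esub> ?c (?d a))"
      by (simp add: bracket_self)
    also have "\<dots> = bracket ?L (?c (?d a)) (?c a) \<oplus>\<^bsub>?L\<^esub> bracket ?L (?c a) (?c (?d a))"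
      by (simp add: bracket_add_left bracket_add_right bracket_self[OF cl] a_ac)
    finally show ?case by (simp add: S)
  next
    case (Jacobi a b c)
    define J where "J p q r =
      bracket ?L (?c p) (bracket ?L (?c q) (?c r)) \<oplus>\<^bsub>?L\<^esub>
      bracket ?L (?c q) (bracket ?L (?c r) (?c p)) \<oplus>\<^bsub>?L\<^esub>
      bracket ?L (?c r) (bracket ?L (?c p) (?c q))" for p q r
    have "?c (?d (Add (Add (Brk a (Brk b c)) (Brk b (Brk c a))) (Brk c (Brk a b)))) =
        J (?d a) b c \<oplus>\<^bsub>?L\<^esub> J a (?d b) c \<oplus>\<^bsub>?L\<^esub> J a b (?d c)"
      unfolding J_def by (simp add: S bracket_add_right a_ac)
    moreover have "J p q r = \<zero>\<^bsub>?L\<^esub>" for p q r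
      unfolding J_def by (rule jacobi) simp_all
    ultimately show ?case by (simp add: S)
  next
    case (cong_Add a a' b b')
    then show ?case by (simp add: S)
  next
    case (cong_Smul a a' k)
    then show ?case by (simp add: S)
  next
    case (cong_Brk a a' b b')
    then have "?c a = ?c a'" "?c b = ?c b'" by (simp_all add: lie_class_eq_iff)
    with cong_Brk.IH show ?case by (simp add: S)
  next
    case (Gen_add v w)
    then show ?case by (simp add: X.add lie_class_eq_iff lie_eq.intros(7-))
  next
    case (Gen_scale k v)
    then show ?case by (simp add: X.scale lie_class_eq_iff lie_eq.intros(7-))
  next
    case (Add_inv a)
    then show ?case by (simp add: lie_class_eq_iff lie_eq.intros(7-))
  next
    case (Smul_one a)
    then show ?case by (simp add: lie_class_eq_iff lie_eq.intros(7-))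
  next
    case (Smul_Smul k l a)
    then show ?case by (simp add: lie_class_eq_iff lie_eq.intros(7-))
  next
    case (Smul_add k l a)
    then show ?case by (simp add: lie_class_eq_iff lie_eq.intros(7-))
  qed (simp_all add: S a_ac smult_r_distr bracket_add_left bracket_add_right bracket_smult_left
      bracket_smult_right)
  then have "?c (?d b) = ?c (?d t)" if "b \<in> ?c t" for b
    using that by (metis lie_class_def mem_Collect_eq)
  moreover have "t \<in> ?c t" by (simp add: lie_class_def lie_eq.lie_refl)
  ultimately show ?thesis unfolding free_derivation_def by blast
qed

lemma lie_derivation_free_derivation:
  assumes X: "Vector_Spaces.linear s s X"
  shows "lie_derivation (free_lie s) (free_derivation s X)"
    and "free_derivation s X (lie_class s (Gen v)) = lie_class s (Gen (X v))"
  unfolding lie_derivation_def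
  by (auto simp: free_lie_simps free_derivation_class[OF X])

text \<open>\<open>\<langle>x\<rangle> \<ltimes> \<L>(V)\<close>, with \<open>x\<close> acting on \<open>V\<close> by the linear map \<open>X\<close>, and its elements \<open>x\<close> and
  \<open>v \<in> V\<close>.\<close>

definition galg ::
  "('k :: field \<Rightarrow> 'v :: ab_group_add \<Rightarrow> 'v) \<Rightarrow> ('v \<Rightarrow> 'v) \<Rightarrow> ('k, 'k \<times> ('k, 'v) lie_term set) lie" where
  "galg s X = semidirect (free_lie s) (free_derivation s X)"

definition g_x ::
  "('k :: field \<Rightarrow> 'v :: ab_group_add \<Rightarrow> 'v) \<Rightarrow> 'k \<times> ('k, 'v) lie_term set" where
  "g_x s = (1, \<zero>\<^bsub>free_lie s\<^esub>)"

definition g_V ::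
  "('k :: field \<Rightarrow> 'v :: ab_group_add \<Rightarrow> 'v) \<Rightarrow> 'v \<Rightarrow> 'k \<times> ('k, 'v) lie_term set" where
  "g_V s v = (0, lie_class s (Gen v))"

section \<open>Representations\<close>

definition lie_representation ::
  "('k :: field, 'g) lie \<Rightarrow> ('k \<Rightarrow> 'u \<Rightarrow> 'u) \<Rightarrow> ('g \<Rightarrow> 'u :: ab_group_add \<Rightarrow> 'u) \<Rightarrow> bool" where
  "lie_representation L sU T \<longleftrightarrow> vector_space sU \<and> T \<in> lie_hom L (gl_space sU)"

definition finite_dim :: "('k :: field \<Rightarrow> 'u :: ab_group_add \<Rightarrow> 'u) \<Rightarrow> bool" where
  "finite_dim sU \<longleftrightarrow> (\<exists>B. finite B \<and> Modules.module.span sU B = UNIV)"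

definition rep_kernel :: "('k, 'g) lie \<Rightarrow> ('g \<Rightarrow> 'u :: ab_group_add \<Rightarrow> 'u) \<Rightarrow> 'g set" where
  "rep_kernel L T = {y \<in> carrier L. T y = (\<lambda>u. 0)}"

definition invariant_subspace ::
  "('k :: field, 'g) lie \<Rightarrow> ('k \<Rightarrow> 'u \<Rightarrow> 'u) \<Rightarrow> ('g \<Rightarrow> 'u :: ab_group_add \<Rightarrow> 'u) \<Rightarrow> 'u set \<Rightarrow> bool" where
  "invariant_subspace L sU T W \<longleftrightarrow>
     Modules.module.subspace sU W \<and> (\<forall>y\<in>carrier L. \<forall>w\<in>W. T y w \<in> W)"

definition uniserial ::
  "('k :: field, 'g) lie \<Rightarrow> ('k \<Rightarrow> 'u \<Rightarrow> 'u) \<Rightarrow> ('g \<Rightarrow> 'u :: ab_group_add \<Rightarrow> 'u) \<Rightarrow> bool" where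
  "uniserial L sU T \<longleftrightarrow>
     (\<forall>W W'. invariant_subspace L sU T W \<longrightarrow> invariant_subspace L sU T W' \<longrightarrow> W \<subseteq> W' \<or> W' \<subseteq> W)"

text \<open>Isomorphism of a representation on \<open>U\<close> with a matrix representation, the latter acting on
  column vectors.\<close>

definition isomorphic_to_matrix_rep ::
  "('k :: field, 'g) lie \<Rightarrow> ('k \<Rightarrow> 'u \<Rightarrow> 'u) \<Rightarrow> ('g \<Rightarrow> 'u :: ab_group_add \<Rightarrow> 'u) \<Rightarrow>
     nat \<Rightarrow> ('g \<Rightarrow> 'k mat) \<Rightarrow> bool" where
  "isomorphic_to_matrix_rep L sU T d R \<longleftrightarrow>
     (\<exists>f. bij_betw f UNIV (carrier_vec d) \<and>
       (\<forall>u w. f (u + w) = f u + f w) \<and> (\<forall>k u. f (sU k u) = k \<cdot>\<^sub>v f u) \<and>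
       (\<forall>y\<in>carrier L. \<forall>u. f (T y u) = R y *\<^sub>v f u))"

section \<open>The representations \<open>R\<close>\<close>

text \<open>All indices below start from \<open>0\<close>: the list \<open>ds\<close> of length \<open>\<ell> + 1\<close> has
  \<open>ds ! i = d_(i+1)\<close> and the list \<open>S\<close> of length \<open>\<ell>\<close> has \<open>S ! i = S(i+1)\<close>.\<close>

definition block_offset :: "nat list \<Rightarrow> nat \<Rightarrow> nat" where
  "block_offset ds i = sum_list (take i ds)"

definition D_mat :: "nat list \<Rightarrow> 'k :: field \<Rightarrow> 'k \<Rightarrow> 'k mat" where
  "D_mat ds \<alpha> lam = jordan_matrix (map (\<lambda>i. (ds ! i, \<alpha> - of_nat i * lam)) [0..<length ds])"

definition E_mat :: "nat list \<Rightarrow> 'k :: field mat list \<Rightarrow> 'k mat" where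
  "E_mat ds S = mat (sum_list ds) (sum_list ds) (\<lambda>(r, c).
     \<Sum>i<length S.
       if block_offset ds i \<le> r \<and> r < block_offset ds (i + 1) \<and>
          block_offset ds (i + 1) \<le> c \<and> c < block_offset ds (i + 2)
       then S ! i $$ (r - block_offset ds i, c - block_offset ds (i + 1)) else 0)"

definition block_data :: "nat list \<Rightarrow> 'k :: field mat list \<Rightarrow> bool" where
  "block_data ds S \<longleftrightarrow>
     length S \<ge> 1 \<and> length ds = length S + 1 \<and> (\<forall>d\<in>set ds. d > 0) \<and>
     (\<forall>i<length S. S ! i \<in> carrier_mat (ds ! i) (ds ! (i + 1)) \<and> S ! i $$ (ds ! i - 1, 0) \<noteq> 0)"

definition normalized :: "nat list \<Rightarrow> 'k :: field mat list \<Rightarrow> bool" where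
  "normalized ds S \<longleftrightarrow>
     (\<forall>i<length S. S ! i $$ (ds ! i - 1, 0) = 1) \<and>
     (\<forall>i. i + 1 < length S \<longrightarrow> (\<forall>j<ds ! (i + 1).
        S ! i $$ (ds ! i - 1, j) = S ! (i + 1) $$ (ds ! (i + 1) - 1 - j, 0))) \<and>
     (\<forall>j<ds ! 0 - 1. S ! 0 $$ (j, 0) = 0) \<and>
     (\<forall>j. 0 < j \<and> j < ds ! length S \<longrightarrow>
        S ! (length S - 1) $$ (ds ! (length S - 1) - 1, j) = 0)"

text \<open>\<open>R\<close> is the representation with the prescribed values at \<open>x\<close> and \<open>v\<^sub>0, \<dots>, v\<^sub>n\<^sub>-\<^sub>1\<close>. As \<open>x\<close> and
  the \<open>v\<^sub>j\<close> generate the Lie algebra, these values determine \<open>R\<close> on its carrier.\<close>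

definition is_R_rep ::
  "('k :: field \<Rightarrow> 'v :: ab_group_add \<Rightarrow> 'v) \<Rightarrow> ('v \<Rightarrow> 'v) \<Rightarrow> nat \<Rightarrow> (nat \<Rightarrow> 'v) \<Rightarrow> 'k \<Rightarrow>
     nat list \<Rightarrow> 'k \<Rightarrow> 'k mat list \<Rightarrow> ('k \<times> ('k, 'v) lie_term set \<Rightarrow> 'k mat) \<Rightarrow> bool" where
  "is_R_rep s X n v lam ds \<alpha> S R \<longleftrightarrow>
     R \<in> lie_hom (galg s X) (gl_mat (sum_list ds)) \<and>
     R (g_x s) = D_mat ds \<alpha> lam \<and>
     (\<forall>j<n. R (g_V s (v j)) =
        ((\<lambda>A. D_mat ds \<alpha> lam * A - A * D_mat ds \<alpha> lam - lam \<cdot>\<^sub>m A) ^^ j) (E_mat ds S))"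

end

(*
The representation is determined by A = T(x) and E = T(v_0); the image of v_j is (ad A - lam)^j E,
so V acts faithfully iff (ad A - lam)^(n-1) E is nonzero, while (ad A - lam)^n E = 0. The latter
equation forces E to map the generalized eigenspace of A for mu into the one for mu + lam. In
coordinates in which A is in Jordan form, every failure of the claimed shape (two Jordan blocks with
the same eigenvalue, eigenvalues that do not form a single string of step lam, a vanishing corner
entry S(i)_{d_i,1}) yields two incomparable submodules cut out by coordinate functionals. The
nilpotency index of ad A - lam on the blocks of E is computed from the corner entries and gives
max (d_i + d_(i+1)) = n + 1. What remains is the action of the centralizer of A, a product of groups
of units of truncated polynomial rings, on the last rows and first columns of the blocks S(i), read as
power series. Normalization amounts to prescribing squares in these rings, and a square root of a
unit is unique once its constant term is chosen.
*)

theory Submission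
  imports Defs "Jordan_Normal_Form.Jordan_Normal_Form_Existence"
    "HOL-Computational_Algebra.Formal_Power_Series"
begin

section \<open>Matrices of linear maps and Jordan normal forms\<close>

text \<open>Coordinates are treated as functionals on U: a submodule is given by a set of positions
  where coordinates vanish, and uniseriality is only ever applied to two submodules of this kind. An
  isomorphism with a matrix representation becomes a coordinate system on the fixed space U, so
  uniqueness compares two such systems for one pair of operators. The unit attached to a middle
  block multiplies the column series on one side of it and divides the row series on the other, so
  making these series equal prescribes its square. An end block meets one series only, and its unit
  is read off directly. The constant terms are fixed beforehand by the demand that all corners
  become 1; with this choice the prescribed squares have constant terms with known roots, so no root
  is extracted in the field. Characteristic 0 separates the weights, keeps binomial coefficients
  nonzero and makes 2 invertible; algebraic closure serves the Jordan form of T(x).\<close>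

lemma sum_delta_mult_lessThan:
  fixes g :: "nat \<Rightarrow> 'a :: semiring_0"
  shows "(\<Sum>j<d. g j * (if j = i then k else 0)) = (if i < d then g i * k else 0)"
    "(\<Sum>j<d. (if j = i then k else 0) * g j) = (if i < d then k * g i else 0)"
proof -
  have "(\<Sum>j<d. g j * (if j = i then k else 0)) = (\<Sum>j<d. if j = i then g i * k else 0)"
    "(\<Sum>j<d. (if j = i then k else 0) * g j) = (\<Sum>j<d. if j = i then k * g i else 0)"
    by (rule sum.cong; simp)+
  then show "(\<Sum>j<d. g j * (if j = i then k else 0)) = (if i < d then g i * k else 0)"
    "(\<Sum>j<d. (if j = i then k else 0) * g j) = (if i < d then k * g i else 0)"
    by (simp_all only: sum.delta finite_lessThan lessThan_iff)
qed

lemma mult_mat_vec_index_sum: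
  assumes "M \<in> carrier_mat m d" "w \<in> carrier_vec d" "r < m"
  shows "(M *\<^sub>v w) $ r = (\<Sum>c<d. M $$ (r, c) * w $ c)"
  using assms by (auto simp: scalar_prod_def atLeast0LessThan intro!: sum.cong)

lemma mult_mat_unit_vec_index:
  fixes M :: "'k :: comm_semiring_1 mat"
  assumes M: "M \<in> carrier_mat m d" and r: "r < m" and c: "c < d"
  shows "(M *\<^sub>v unit_vec d c) $ r = M $$ (r, c)"
proof -
  have "(M *\<^sub>v unit_vec d c) $ r = (\<Sum>j<d. M $$ (r, j) * (if j = c then 1 else 0))"
    unfolding mult_mat_vec_index_sum[OF M unit_vec_carrier r]
    by (rule sum.cong) (auto simp: unit_vec_def)
  then show ?thesis using c by (simp add: sum_delta_mult_lessThan)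
qed

lemma eq_mat_on_vecI:
  fixes M :: "'k :: comm_semiring_1 mat"
  assumes M: "M \<in> carrier_mat m d" "M' \<in> carrier_mat m d"
    and eq: "\<And>w. w \<in> carrier_vec d \<Longrightarrow> M *\<^sub>v w = M' *\<^sub>v w"
  shows "M = M'"
proof (rule eq_matI)
  fix r c assume "r < dim_row M'" "c < dim_col M'"
  then have rc: "r < m" "c < d" using M by auto
  show "M $$ (r, c) = M' $$ (r, c)"
    using arg_cong[OF eq[OF unit_vec_carrier[of d c]], of "\<lambda>w. w $ r"]
    unfolding mult_mat_unit_vec_index[OF M(1) rc] mult_mat_unit_vec_index[OF M(2) rc] .
qed (use M in auto)

lemma linear_map_carrier_vec_matrix:
  fixes h :: "'k :: comm_semiring_1 vec \<Rightarrow> 'k vec"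
  assumes h: "\<And>w. w \<in> carrier_vec d \<Longrightarrow> h w \<in> carrier_vec m"
    and h_add: "\<And>w w'. w \<in> carrier_vec d \<Longrightarrow> w' \<in> carrier_vec d \<Longrightarrow> h (w + w') = h w + h w'"
    and h_smult: "\<And>k w. w \<in> carrier_vec d \<Longrightarrow> h (k \<cdot>\<^sub>v w) = k \<cdot>\<^sub>v h w"
  obtains M where "M \<in> carrier_mat m d" "\<And>w. w \<in> carrier_vec d \<Longrightarrow> h w = M *\<^sub>v w"
proof
  define M where "M = mat m d (\<lambda>(r, c). h (unit_vec d c) $ r)"
  show M: "M \<in> carrier_mat m d" by (simp add: M_def)
  fix w :: "'k vec" assume w: "w \<in> carrier_vec d"
  \<comment> \<open>Induction on the number \<open>t\<close> of entries of \<open>w\<close> that are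
    kept, the others being replaced by 0.\<close>
  have "h (vec d (\<lambda>c. if c < t then w $ c else 0)) = vec m (\<lambda>r. \<Sum>c<t. M $$ (r, c) * w $ c)"
    if "t \<le> d" for t
    using that
  proof (induction t)
    case 0
    have "h (0 \<cdot>\<^sub>v w) = 0 \<cdot>\<^sub>v h w" by (rule h_smult[OF w])
    moreover have "0 \<cdot>\<^sub>v w = vec d (\<lambda>c. 0)" "0 \<cdot>\<^sub>v h w = vec m (\<lambda>r. 0)"
      using w h[OF w] by auto
    ultimately show ?case by simp
  next
    case (Suc t)
    have "vec d (\<lambda>c. if c < Suc t then w $ c else 0) =
        vec d (\<lambda>c. if c < t then w $ c else 0) + w $ t \<cdot>\<^sub>v unit_vec d t"
      using Suc.prems by (auto simp: less_Suc_eq)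
    then have "h (vec d (\<lambda>c. if c < Suc t then w $ c else 0)) =
        vec m (\<lambda>r. \<Sum>c<t. M $$ (r, c) * w $ c) + w $ t \<cdot>\<^sub>v h (unit_vec d t)"
      using Suc by (simp add: h_add h_smult)
    also have "\<dots> = vec m (\<lambda>r. \<Sum>c<Suc t. M $$ (r, c) * w $ c)"
      using Suc.prems h[of "unit_vec d t"] by (auto simp: M_def mult.commute)
    finally show ?case .
  qed
  from this[of d] have "h (vec d (\<lambda>c. if c < d then w $ c else 0)) =
      vec m (\<lambda>r. \<Sum>c<d. M $$ (r, c) * w $ c)" by simp
  also have "vec d (\<lambda>c. if c < d then w $ c else 0) = w" using w by auto
  also have "vec m (\<lambda>r. \<Sum>c<d. M $$ (r, c) * w $ c) = M *\<^sub>v w"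
    using M w by (auto simp: mult_mat_vec_index_sum[OF M w] simp del: index_mult_mat_vec)
  finally show "h w = M *\<^sub>v w" .
qed

section \<open>Triangular and Jordan form over an algebraically closed field\<close>

lemma invertible_matrix_with_first_column:
  fixes w :: "'k :: field vec"
  assumes w: "w \<in> carrier_vec (Suc m)" "w \<noteq> 0\<^sub>v (Suc m)"
  obtains W W' where "W \<in> carrier_mat (Suc m) (Suc m)" "W' \<in> carrier_mat (Suc m) (Suc m)"
    "W * W' = 1\<^sub>m (Suc m)" "W' * W = 1\<^sub>m (Suc m)" "W *\<^sub>v unit_vec (Suc m) 0 = w"
proof -
  let ?n = "Suc m"
  obtain k where k: "k < ?n" "w $ k \<noteq> 0"
    using w by (metis carrier_vecD eq_vecI index_zero_vec)
  \<comment> \<open>Behind \<open>w\<close> the columns run through all unit vectors except number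
    \<open>k\<close>: unit vector 0, displaced by \<open>w\<close>, takes the place in column
    \<open>k\<close>. For \<open>k = 0\<close> nothing has to be moved.\<close>
  define W where "W = mat ?n ?n (\<lambda>(r, c). if c = 0 then w $ r else
    if r = (if c = k then 0 else c) then 1 else 0)"
  have W: "W \<in> carrier_mat ?n ?n" by (simp add: W_def)
  have "u = 0\<^sub>v ?n" if u: "u \<in> carrier_vec ?n" and 0: "W *\<^sub>v u = 0\<^sub>v ?n" for u
  proof -
    have row: "w $ r * u $ 0 +
        (\<Sum>c<m. (if r = (if Suc c = k then 0 else Suc c) then 1 else 0) * u $ Suc c) = 0"
      if r: "r < ?n" for r
    proof -
      have "(W *\<^sub>v u) $ r = w $ r * u $ 0 +
        (\<Sum>c<m. (if r = (if Suc c = k then 0 else Suc c) then 1 else 0) * u $ Suc c)"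
        unfolding mult_mat_vec_index_sum[OF W u r] sum.lessThan_Suc_shift
        by (rule arg_cong2[of _ _ _ _ "(+)"]) (use r in \<open>auto simp: W_def intro!: sum.cong\<close>)
      then show ?thesis using 0 r by simp
    qed
    \<comment> \<open>No column other than the first has an entry in row \<open>k\<close>, so this
      row alone gives \<open>u $ 0 = 0\<close>.\<close>
    have "(\<Sum>c<m. (if k = (if Suc c = k then 0 else Suc c) then 1 else 0) * u $ Suc c) = 0"
      by (rule sum.neutral) auto
    then have u0: "u $ 0 = 0" using row[OF k(1)] k(2) by simp
    have "u $ Suc c = 0" if c: "c < m" for c
    proof -
      let ?r = "if Suc c = k then 0 else Suc c"
      have "(\<Sum>c'<m. (if ?r = (if Suc c' = k then 0 else Suc c') then 1 else 0) * u $ Suc c') =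
          (\<Sum>c'<m. (if c' = c then 1 else 0) * u $ Suc c')"
        by (rule sum.cong) auto
      also have "\<dots> = u $ Suc c" using c by (simp add: sum_delta_mult_lessThan)
      finally show ?thesis using row[of ?r] u0 c by (simp split: if_splits)
    qed
    then show ?thesis using u u0 by (intro eq_vecI) (auto simp: less_Suc_eq_0_disj)
  qed
  then have "det W \<noteq> 0" using det_0_iff_vec_prod_zero_field[OF W] by blast
  then obtain W' where "W' \<in> carrier_mat ?n ?n" "W * W' = 1\<^sub>m ?n" "W' * W = 1\<^sub>m ?n"
    using det_non_zero_imp_unit[OF W] by (auto simp: Units_def ring_mat_def)
  moreover have "W *\<^sub>v unit_vec ?n 0 = w"
  proof (rule eq_vecI)
    fix r assume "r < dim_vec w"
    then have r: "r < ?n" using w by simp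
    show "(W *\<^sub>v unit_vec ?n 0) $ r = w $ r"
      unfolding mult_mat_unit_vec_index[OF W r zero_less_Suc] using r by (simp add: W_def)
  qed (use W w in auto)
  ultimately show ?thesis using that[OF W] by blast
qed

text \<open>An eigenvector, made the first basis vector, splits off one dimension; algebraic closure
  supplies its eigenvalue. The Jordan form is then derived from the triangular one.\<close>

lemma upper_triangular_similar_exists:
  fixes M :: "'k :: alg_closed_field mat"
  assumes "M \<in> carrier_mat m m"
  shows "\<exists>B. B \<in> carrier_mat m m \<and> upper_triangular B \<and> similar_mat M B"
  using assms
proof (induction m arbitrary: M)
  case 0
  then have "upper_triangular M" by auto
  then show ?case using 0 similar_mat_refl[OF 0] by auto
next
  case (Suc m)
  let ?n = "Suc m"
  have "degree (char_poly M) > 0" using degree_monic_char_poly[OF Suc.prems] by simp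
  then obtain e where "poly (char_poly M) e = 0" using alg_closed_imp_poly_has_root by blast
  then have "eigenvalue M e" using eigenvalue_root_char_poly[OF Suc.prems] by simp
  then obtain w where w: "w \<in> carrier_vec ?n" "w \<noteq> 0\<^sub>v ?n" "M *\<^sub>v w = e \<cdot>\<^sub>v w"
    using Suc.prems unfolding eigenvalue_def eigenvector_def by auto
  obtain W W' where W: "W \<in> carrier_mat ?n ?n" "W' \<in> carrier_mat ?n ?n"
      "W * W' = 1\<^sub>m ?n" "W' * W = 1\<^sub>m ?n" "W *\<^sub>v unit_vec ?n 0 = w"
    using invertible_matrix_with_first_column[OF w(1,2)] by blast
  define C where "C = W' * M * W"
  have C: "C \<in> carrier_mat ?n ?n" using W Suc.prems by (simp add: C_def)
  have "W * C * W' = (W * W') * M * (W * W')"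
    using W(1,2) Suc.prems unfolding C_def by (simp add: assoc_mult_mat[of _ ?n ?n _ ?n _ ?n])
  then have MC: "similar_mat M C"
    unfolding similar_mat_def using W Suc.prems C
    by (intro exI[of _ W] exI[of _ W'] similar_mat_witI[of _ _ ?n]) auto
  have C0: "C $$ (r, 0) = (if r = 0 then e else 0)" if r: "r < ?n" for r
  proof -
    have "C *\<^sub>v unit_vec ?n 0 = W' *\<^sub>v (M *\<^sub>v (W *\<^sub>v unit_vec ?n 0))"
      using W(1,2) Suc.prems unfolding C_def by (simp add: assoc_mult_mat_vec[of _ ?n ?n _ ?n])
    also have "\<dots> = e \<cdot>\<^sub>v (W' *\<^sub>v (W *\<^sub>v unit_vec ?n 0))"
      unfolding W(5) w(3) using W(2) w(1) by (simp add: mult_mat_vec)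
    also have "W' *\<^sub>v (W *\<^sub>v unit_vec ?n 0) = (W' * W) *\<^sub>v unit_vec ?n 0"
      using W(1,2) by (simp add: assoc_mult_mat_vec[of _ ?n ?n _ ?n])
    finally have "(C *\<^sub>v unit_vec ?n 0) $ r = (e \<cdot>\<^sub>v unit_vec ?n 0) $ r" using W(4) by simp
    then show ?thesis unfolding mult_mat_unit_vec_index[OF C r zero_less_Suc] using r by simp
  qed
  define A2 where "A2 = mat 1 m (\<lambda>(r, c). C $$ (0, Suc c))"
  define A3 where "A3 = mat m m (\<lambda>(r, c). C $$ (Suc r, Suc c))"
  define A1 where "A1 = mat 1 1 (\<lambda>(r, c). e)"
  have cs: "A1 \<in> carrier_mat 1 1" "A2 \<in> carrier_mat 1 m" "A3 \<in> carrier_mat m m"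
    by (auto simp: A1_def A2_def A3_def)
  have blk: "C = four_block_mat A1 A2 (0\<^sub>m m 1) A3"
    by (rule eq_matI) (use C C0 in \<open>auto simp: A1_def A2_def A3_def less_Suc_eq_0_disj\<close>)
  obtain B where B: "B \<in> carrier_mat m m" "upper_triangular B" "similar_mat A3 B"
    using Suc.IH[OF cs(3)] by blast
  \<comment> \<open>Conjugating the lower right block changes the rest of the first row to some
    \<open>B0\<close>, which does not affect triangularity.\<close>
  obtain B0 where B0: "B0 \<in> carrier_mat 1 m"
      "similar_mat C (four_block_mat A1 B0 (0\<^sub>m m 1) B)"
    using similar_mat_four_block_0_ex[OF similar_mat_refl[OF cs(1)] B(3) cs(2,1,3)] blk by auto
  have "upper_triangular (four_block_mat A1 B0 (0\<^sub>m m 1) B)"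
    by (rule upper_triangular_four_block[OF cs(1) B(1) _ B(2)]) (auto simp: A1_def)
  then show ?case using similar_mat_trans[OF MC B0(2)] four_block_carrier_mat[OF cs(1) B(1)]
    by (intro exI[of _ "four_block_mat A1 B0 (0\<^sub>m m 1) B"]) auto
qed

lemma jordan_nf_exists_alg_closed:
  fixes M :: "'k :: alg_closed_field mat"
  assumes "M \<in> carrier_mat m m"
  shows "\<exists>n_as. jordan_nf M n_as"
proof -
  obtain B where "B \<in> carrier_mat m m" "upper_triangular B" "similar_mat M B"
    using upper_triangular_similar_exists[OF assms] by blast
  then show ?thesis using triangular_to_jnf_vector[of B m] similar_mat_trans[of M B]
    unfolding jordan_nf_def by blast
qed

section \<open>Block indices\<close>

lemma block_offset_Cons_Suc [simp]: "block_offset (d # ds) (Suc i) = d + block_offset ds i"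
  by (simp add: block_offset_def)

lemma block_offset_0 [simp]: "block_offset ds 0 = 0"
  by (simp add: block_offset_def)

lemma block_offset_Suc:
  "i < length ds \<Longrightarrow> block_offset ds (Suc i) = block_offset ds i + ds ! i"
  by (simp add: block_offset_def take_Suc_conv_app_nth)

lemma block_offset_mono: "i \<le> j \<Longrightarrow> block_offset ds i \<le> block_offset ds j"
  unfolding block_offset_def by (metis add_diff_inverse_nat le_add1 not_less sum_list_append take_add)

lemma block_offset_length: "block_offset ds (length ds) = sum_list ds"
  by (simp add: block_offset_def)

lemma block_offset_less:
  assumes "i < length ds" "a < ds ! i"
  shows "block_offset ds i + a < sum_list ds"
  using block_offset_mono[of "Suc i" "length ds" ds] assms block_offset_Suc[of i ds]
  by (simp add: block_offset_length)

text \<open>The sums defining \<open>E_mat\<close> and \<open>block_vec\<close> select a block by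
  this double inequality; rewritten as an equation of indices, it collapses them to one
  term.\<close>

lemma block_offset_interval_iff:
  assumes "i < length ds" "j < length ds" "a < ds ! i"
  shows "block_offset ds j \<le> block_offset ds i + a \<and>
    block_offset ds i + a < block_offset ds (Suc j) \<longleftrightarrow> i = j"
proof -
  have "block_offset ds (Suc i) \<le> block_offset ds j" if "i < j"
    using that by (intro block_offset_mono) simp
  moreover have "block_offset ds (Suc j) \<le> block_offset ds i" if "j < i"
    using that by (intro block_offset_mono) simp
  ultimately show ?thesis using assms block_offset_Suc[of i ds] by (cases i j rule: linorder_cases) auto
qed

lemma block_offset_cases:
  assumes "r < sum_list ds"
  obtains i a where "i < length ds" "a < ds ! i" "r = block_offset ds i + a"
proof -
  have "\<exists>i a. i < length ds \<and> a < ds ! i \<and> r = block_offset ds i + a"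
    using assms
  proof (induction ds arbitrary: r)
    case (Cons d ds)
    show ?case
    proof (cases "r < d")
      case True
      then show ?thesis by (intro exI[of _ 0] exI[of _ r]) simp
    next
      case False
      then have "r - d < sum_list ds" using Cons.prems by simp
      then obtain i a where "i < length ds" "a < ds ! i" "r - d = block_offset ds i + a"
        using Cons.IH[of "r - d"] by blast
      with False show ?thesis by (intro exI[of _ "Suc i"] exI[of _ a]) simp
    qed
  qed simp
  with that show ?thesis by blast
qed

lemma sum_block_offset:
  fixes g :: "nat \<Rightarrow> 'a :: comm_monoid_add"
  shows "(\<Sum>r<sum_list ds. g r) = (\<Sum>i<length ds. \<Sum>a<ds ! i. g (block_offset ds i + a))"
proof (induction ds arbitrary: g)
  case (Cons d ds)
  have "(\<Sum>r<d + m. g r) = (\<Sum>r<d. g r) + (\<Sum>r<m. g (d + r))"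
    for d m by (induction m) (simp_all add: ac_simps)
  then show ?case by (simp add: Cons sum.lessThan_Suc_shift add.assoc del: sum.lessThan_Suc)
qed simp

lemma jordan_matrix_block_index:
  assumes "i < length n_as" "j < length n_as" "a < fst (n_as ! i)" "b < fst (n_as ! j)"
  shows "jordan_matrix n_as $$ (block_offset (map fst n_as) i + a, block_offset (map fst n_as) j + b) =
    (if i = j then if a = b then snd (n_as ! i) else if Suc a = b then 1 else 0 else 0)"
  using assms
proof (induction n_as arbitrary: i j)
  case (Cons p n_as)
  obtain m e where p: "p = (m, e)" by (cases p)
  have less: "block_offset (map fst n_as) i' + a' < sum_list (map fst n_as)"
    if "i' < length n_as" "a' < fst (n_as ! i')" for i' a'
    using block_offset_less[of i' "map fst n_as" a'] that by simp
  show ?case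
    by (cases i; cases j) (use Cons less in \<open>auto simp: p jordan_matrix_Cons add.assoc\<close>)
qed simp

section \<open>Coordinates adapted to a Jordan form\<close>

text \<open>A Jordan basis is recorded by its dual basis: \<open>x i a\<close> is the coordinate at position \<open>a\<close> of
  block \<open>i\<close>, extended by \<open>0\<close> to all pairs of indices. The last assumption says that the matrix of
  \<open>A\<close> is upper triangular Jordan.\<close>

locale jordan_coords = vector_space sU
  for sU :: "'k :: field \<Rightarrow> 'u :: ab_group_add \<Rightarrow> 'u" +
  fixes A :: "'u \<Rightarrow> 'u" and L :: nat and d :: "nat \<Rightarrow> nat" and \<beta> :: "nat \<Rightarrow> 'k"
    and x :: "nat \<Rightarrow> nat \<Rightarrow> 'u \<Rightarrow> 'k"
  assumes d_pos_iff: "0 < d i \<longleftrightarrow> i < L"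
    and x_add: "x i a (u + w) = x i a u + x i a w"
    and x_scale: "x i a (sU k u) = k * x i a u"
    and x_out: "d i \<le> a \<Longrightarrow> x i a u = 0"
    and x_inj: "(\<And>i a. x i a u = 0) \<Longrightarrow> u = 0"
    and x_surj: "\<exists>u. \<forall>i. \<forall>a<d i. x i a u = y i a"
    and x_A: "x i a (A u) = \<beta> i * x i a u + x i (Suc a) u"
begin

text \<open>Blocks beyond the last have size 0 and hence zero coordinates, so formulas mentioning
  block \<open>Suc i\<close> need no exception at the last block.\<close>

lemma d_eq_0_iff: "d i = 0 \<longleftrightarrow> L \<le> i"
  using d_pos_iff[of i] by auto

lemma x_zero [simp]: "x i a 0 = 0"
  using x_scale[of i a 0 0] by simp

lemma x_diff: "x i a (u - w) = x i a u - x i a w"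
  using x_add[of i a "u - w" w] by simp

lemma x_eqI: "(\<And>i a. x i a u = x i a w) \<Longrightarrow> u = w"
  using x_inj[of "u - w"] by (simp add: x_diff)

text \<open>The Jordan basis dual to the functionals. Coordinates inside the blocks determine a
  vector, since those outside vanish; so the choice is unique.\<close>

definition e :: "nat \<Rightarrow> nat \<Rightarrow> 'u" where
  "e j b = (SOME u. \<forall>i. \<forall>a<d i. x i a u = (if i = j \<and> a = b then 1 else 0))"

lemma x_e:
  assumes "b < d j"
  shows "x i a (e j b) = (if i = j \<and> a = b then 1 else 0)"
proof (cases "a < d i")
  case True
  then show ?thesis
    using someI_ex[OF x_surj[of "\<lambda>i a. if i = j \<and> a = b then 1 else 0"]] unfolding e_def by blast
next
  case False
  then show ?thesis using assms by (auto simp: x_out)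
qed

lemma A_e:
  assumes "b < d j"
  shows "A (e j b) = sU (\<beta> j) (e j b) + (if b = 0 then 0 else e j (b - 1))"
  by (rule x_eqI) (use assms in \<open>auto simp: x_A x_add x_scale x_e\<close>)

text \<open>Used with \<open>g\<close> of the form \<open>\<lambda>u. x i a (F u)\<close>, where it
  yields the matrix of a linear map \<open>F\<close> in Jordan coordinates.\<close>

lemma linear_functional_expand:
  assumes add: "\<And>u w. g (u + w) = g u + g w" and scale: "\<And>k u. g (sU k u) = k * g u"
  shows "g u = (\<Sum>j<L. \<Sum>b<d j. x j b u * g (e j b))"
proof -
  have g0: "g 0 = 0" using scale[of 0 0] by simp
  have g_sum: "g (sum f I) = (\<Sum>i\<in>I. g (f i))" if "finite I" for f and I :: "nat set"
    using that by induction (simp_all add: add g0)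
  have x_sum: "x i a (sum f I) = (\<Sum>j\<in>I. x i a (f j))" if "finite I" for i a f and I :: "nat set"
    using that by induction (simp_all add: x_add)
  have "u = (\<Sum>j<L. \<Sum>b<d j. sU (x j b u) (e j b))"
  proof (rule x_eqI)
    fix i a
    have "x i a (\<Sum>j<L. \<Sum>b<d j. sU (x j b u) (e j b)) =
        (\<Sum>j<L. \<Sum>b<d j. x j b u * x i a (e j b))"
      by (simp add: x_sum x_scale)
    also have "\<dots> = (\<Sum>j<L. \<Sum>b<d j. if b = a then if j = i then x i a u else 0 else 0)"
      by (intro sum.cong refl) (auto simp: x_e)
    also have "\<dots> = (\<Sum>j<L. if j = i then if a < d i then x i a u else 0 else 0)"
      by (intro sum.cong refl) auto
    also have "\<dots> = x i a u" using x_out[of i a u] d_eq_0_iff[of i] by auto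
    finally show "x i a u = x i a (\<Sum>j<L. \<Sum>b<d j. sU (x j b u) (e j b))" ..
  qed
  then have "g u = g (\<Sum>j<L. \<Sum>b<d j. sU (x j b u) (e j b))" by simp
  also have "\<dots> = (\<Sum>j<L. \<Sum>b<d j. x j b u * g (e j b))"
    by (simp add: g_sum scale)
  finally show ?thesis .
qed

end

section \<open>Uniseriality and the eigenvalues of A\<close>

definition uniserial_pair ::
  "('k :: field \<Rightarrow> 'u :: ab_group_add \<Rightarrow> 'u) \<Rightarrow> ('u \<Rightarrow> 'u) \<Rightarrow> ('u \<Rightarrow> 'u) \<Rightarrow> bool" where
  "uniserial_pair sU A E \<longleftrightarrow> (\<forall>W W'.
     Modules.module.subspace sU W \<longrightarrow> (\<forall>w\<in>W. A w \<in> W \<and> E w \<in> W) \<longrightarrow>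
     Modules.module.subspace sU W' \<longrightarrow> (\<forall>w\<in>W'. A w \<in> W' \<and> E w \<in> W') \<longrightarrow>
     W \<subseteq> W' \<or> W' \<subseteq> W)"

text \<open>\<open>Es j\<close> plays the role of \<open>(ad A - lam)\<^sup>j E\<close>, and hence of the image of \<open>v\<^sub>j\<close>.\<close>

locale ad_chain = vector_space sU
  for sU :: "'k :: field_char_0 \<Rightarrow> 'u :: ab_group_add \<Rightarrow> 'u" +
  fixes A :: "'u \<Rightarrow> 'u" and Es :: "nat \<Rightarrow> 'u \<Rightarrow> 'u" and lam :: 'k and n :: nat
  assumes lam_nz: "lam \<noteq> 0"
    and Es_add: "Es j (u + w) = Es j u + Es j w"
    and Es_scale: "Es j (sU k u) = sU k (Es j u)"
    and Es_Suc: "Es (Suc j) u = A (Es j u) - Es j (A u) - sU lam (Es j u)"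
    and Es_n: "n \<le> j \<Longrightarrow> Es j u = 0"

locale jordan_ad_chain = jordan_coords sU A L d \<beta> x + ad_chain sU A Es lam n
  for sU :: "'k :: field_char_0 \<Rightarrow> 'u :: ab_group_add \<Rightarrow> 'u" and A L d \<beta> x Es lam n
begin

lemma Es_zero [simp]: "Es j 0 = 0"
  using Es_add[of j 0 0] by simp

text \<open>The operator \<open>ad A - lam\<close> acts on the part of weight \<open>\<mu>\<close> of \<open>gl(U)\<close> as the sum of
  \<open>\<mu> - lam\<close> and a nilpotent operator, so nilpotency on \<open>E\<close> forces \<open>\<mu> = lam\<close>.\<close>

lemma Es_weight:
  assumes "\<beta> i \<noteq> \<beta> l + lam" "b < d l"
  shows "x i a (Es j (e l b)) = 0"
  using assms(2)
\<comment> \<open>The three entries to which the commutation rule refers are \<open>Suc j\<close>,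
  \<open>Suc a\<close> and \<open>b - 1\<close>; each lowers this measure.\<close>
proof (induction "(n - j) + b + (d i - a)" arbitrary: a j b rule: less_induct)
  case less
  show ?case
  proof (cases "n \<le> j \<or> d i \<le> a")
    case True
    then show ?thesis by (auto simp: Es_n x_out)
  next
    case False
    have "x i a (Es (Suc j) (e l b)) = 0" "x i (Suc a) (Es j (e l b)) = 0"
      using False less.prems by (auto intro!: less.hyps)
    moreover have "x i a (Es j (if b = 0 then 0 else e l (b - 1))) = 0"
      using less.prems by (auto intro!: less.hyps)
    ultimately have "(\<beta> i - \<beta> l - lam) * x i a (Es j (e l b)) = 0"
      unfolding Es_Suc x_diff x_A A_e[OF less.prems] Es_add Es_scale x_add x_scale
      by (simp add: algebra_simps)
    moreover have "\<beta> i - \<beta> l - lam \<noteq> 0" using assms(1) by (simp add: diff_diff_eq)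
    ultimately show ?thesis by simp
  qed
qed

text \<open>Block \<open>i\<close> of \<open>Es j u\<close> is fed only by blocks of weight
  \<open>\<beta> i - lam\<close>. For sets made of whole blocks, invariance thus becomes a condition
  on weights.\<close>

lemma x_Es_eq_0:
  assumes "\<And>l b. \<beta> i = \<beta> l + lam \<Longrightarrow> x l b u = 0"
  shows "x i a (Es j u) = 0"
proof -
  have "x i a (Es j u) = (\<Sum>l<L. \<Sum>b<d l. x l b u * x i a (Es j (e l b)))"
    by (rule linear_functional_expand) (simp_all add: Es_add Es_scale x_add x_scale)
  also have "\<dots> = 0"
  proof (intro sum.neutral ballI)
    fix l b assume "b \<in> {..<d l}"
    then show "x l b u * x i a (Es j (e l b)) = 0"
      using assms[of l b] Es_weight[of i l b a j] by (cases "\<beta> i = \<beta> l + lam") auto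
  qed
  finally show ?thesis .
qed

text \<open>\<open>Z\<close> is the set of positions required to be zero. Closure under
  \<open>Suc\<close> gives invariance under A, which adds to each coordinate a multiple of itself
  and the next one; the second clause is invariance under E.\<close>

definition coord_invariant :: "(nat \<Rightarrow> nat \<Rightarrow> bool) \<Rightarrow> bool" where
  "coord_invariant Z \<longleftrightarrow> (\<forall>i a. Z i a \<longrightarrow> Z i (Suc a)) \<and>
     (\<forall>u i a. (\<forall>j b. Z j b \<longrightarrow> x j b u = 0) \<longrightarrow> Z i a \<longrightarrow> x i a (Es 0 u) = 0)"

text \<open>A basis vector at a position in one set but not in the other lies in exactly one of the
  two subspaces. Two such positions, one each way, contradict uniseriality.\<close>

lemma coord_invariant_comparable:
  assumes uni: "uniserial_pair sU A (Es 0)"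
    and Z: "coord_invariant Z" "coord_invariant Z'"
    and w: "b < d j" "Z j b" "\<not> Z' j b"
    and w': "b' < d j'" "Z' j' b'" "\<not> Z j' b'"
  shows False
proof -
  define W where "W Z = {u. \<forall>i a. Z i a \<longrightarrow> x i a u = 0}" for Z
  have sub: "subspace (W Z)" for Z
    unfolding W_def by (rule subspaceI) (auto simp: x_add x_scale)
  have inv: "\<forall>w\<in>W Z. A w \<in> W Z \<and> Es 0 w \<in> W Z" if "coord_invariant Z" for Z
    using that unfolding W_def coord_invariant_def by (auto simp: x_A)
  have "W Z \<subseteq> W Z' \<or> W Z' \<subseteq> W Z"
    using uni sub inv Z unfolding uniserial_pair_def by blast
  moreover have "e j b \<in> W Z'" "e j b \<notin> W Z" "e j' b' \<in> W Z" "e j' b' \<notin> W Z'"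
    using w w' unfolding W_def by (auto simp: x_e)
  ultimately show False by blast
qed

lemma inj_on_weights:
  assumes uni: "uniserial_pair sU A (Es 0)"
  shows "inj_on \<beta> {..<L}"
proof (rule inj_onI, rule ccontr)
  fix i j assume ij: "i \<in> {..<L}" "j \<in> {..<L}" "\<beta> i = \<beta> j" "i \<noteq> j"
  \<comment> \<open>The subspace keeps block \<open>i\<close> and all blocks of weight
    \<open>\<beta> i + k lam\<close> with \<open>k \<ge> 1\<close>, as E raises weights by
    \<open>lam\<close>. In characteristic 0 the weight \<open>\<beta> i\<close> is not among these,
    so a second block of this weight is required to be zero.\<close>
  define Z where "Z i l (a :: nat) \<longleftrightarrow> l \<noteq> i \<and> (\<forall>k. \<beta> l \<noteq> \<beta> i + of_nat (Suc k) * lam)"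
    for i l a
  have inv: "coord_invariant (Z i)" for i
    unfolding coord_invariant_def
  proof (intro conjI allI impI)
    fix u l a assume u: "\<forall>m b. Z i m b \<longrightarrow> x m b u = 0" and l: "Z i l a"
    show "x l a (Es 0 u) = 0"
    proof (rule x_Es_eq_0)
      fix m b assume m: "\<beta> l = \<beta> m + lam"
      have "m \<noteq> i" using l m unfolding Z_def by (auto dest: spec[of _ 0])
      moreover have "\<beta> m \<noteq> \<beta> i + of_nat (Suc k) * lam" for k
      proof
        assume "\<beta> m = \<beta> i + of_nat (Suc k) * lam"
        then have "\<beta> l = \<beta> i + of_nat (Suc (Suc k)) * lam" using m by (simp add: algebra_simps)
        then show False using l unfolding Z_def by blast
      qed
      ultimately show "x m b u = 0" using u unfolding Z_def by blast
    qed
  qed (auto simp: Z_def)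
  have Z: "\<not> Z i i 0" "Z i j 0" "\<not> Z j j 0" "Z j i 0"
    using ij lam_nz unfolding Z_def by (auto simp del: of_nat_Suc)
  show False
    by (rule coord_invariant_comparable[OF uni inv[of i] inv[of j] _ Z(2,3) _ Z(4,1)])
      (use ij d_pos_iff in auto)
qed

text \<open>E cannot cross a gap in a string of weights, so two blocks that do not reach each other
  through existing weights give incomparable submodules. This leaves one string without gaps; it is
  numbered downwards from its top because E leads from block \<open>Suc i\<close> to block
  \<open>i\<close>.\<close>

lemma weights_string:
  assumes uni: "uniserial_pair sU A (Es 0)" and "0 < L"
  obtains \<alpha> \<sigma> where "bij_betw \<sigma> {..<L} {..<L}" "\<And>i. i < L \<Longrightarrow> \<beta> (\<sigma> i) = \<alpha> - of_nat i * lam"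
proof -
  \<comment> \<open>All \<open>k\<close> steps upwards from block \<open>i\<close> meet an existing
    weight.\<close>
  define chain where "chain i k \<longleftrightarrow> (\<forall>j\<le>k. \<exists>m<L. \<beta> m = \<beta> i + of_nat j * lam)" for i k
  have chain_0: "chain i 0" if "i < L" for i
    using that unfolding chain_def by force
  \<comment> \<open>The existing blocks not reached from \<open>i\<close>. Indices from
    \<open>L\<close> on are left out: \<open>\<beta>\<close> is arbitrary there and the coordinates
    vanish anyway.\<close>
  define Z where "Z i l (a :: nat) \<longleftrightarrow> l < L \<and> \<not> (\<exists>k. \<beta> l = \<beta> i + of_nat k * lam \<and> chain i k)"
    for i l a
  have inv: "coord_invariant (Z i)" for i
    unfolding coord_invariant_def
  proof (intro conjI allI impI)
    fix u l a assume u: "\<forall>m b. Z i m b \<longrightarrow> x m b u = 0" and l: "Z i l a"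
    show "x l a (Es 0 u) = 0"
    proof (rule x_Es_eq_0)
      fix m b assume m: "\<beta> l = \<beta> m + lam"
      have "\<not> (\<beta> m = \<beta> i + of_nat k * lam \<and> chain i k)" for k
      proof
        assume k: "\<beta> m = \<beta> i + of_nat k * lam \<and> chain i k"
        then have "\<beta> l = \<beta> i + of_nat (Suc k) * lam" using m by (simp add: algebra_simps)
        moreover from this have "chain i (Suc k)"
          using k l unfolding chain_def Z_def by (metis le_Suc_eq)
        ultimately show False using l unfolding Z_def by blast
      qed
      then show "x m b u = 0" using u d_eq_0_iff[of m] x_out[of m b u] unfolding Z_def
        by (cases "m < L") auto
    qed
  qed (auto simp: Z_def)
  have comparable: "(\<exists>k. \<beta> j = \<beta> i + of_nat k * lam \<and> chain i k) \<or>
      (\<exists>k. \<beta> i = \<beta> j + of_nat k * lam \<and> chain j k)" if ij: "i < L" "j < L" for i j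
  proof (rule ccontr)
    assume "\<not> ?thesis"
    then have Z: "Z i j 0" "Z j i 0" using ij unfolding Z_def by auto
    have Z': "\<not> Z i i 0" if "i < L" for i
      using chain_0[OF that] unfolding Z_def by (auto intro!: exI[of _ "0 :: nat"])
    show False
      by (rule coord_invariant_comparable[OF uni inv[of i] inv[of j] _ Z(1) Z' _ Z(2) Z'])
        (use ij d_pos_iff in auto)
  qed
  have "\<exists>t :: int. \<beta> j = \<beta> 0 + of_int t * lam" if "j < L" for j
    using comparable[OF \<open>0 < L\<close> that]
  proof (elim disjE exE conjE)
    fix k assume "\<beta> j = \<beta> 0 + of_nat k * lam"
    then show ?thesis by (intro exI[of _ "int k"]) simp
  next
    fix k assume "\<beta> 0 = \<beta> j + of_nat k * lam"
    then show ?thesis by (intro exI[of _ "- int k"]) simp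
  qed
  then obtain t :: "nat \<Rightarrow> int" where t: "\<beta> j = \<beta> 0 + of_int (t j) * lam" if "j < L" for j
    by metis
  have t_eq: "\<beta> j = \<beta> i + of_int c * lam \<longleftrightarrow> t j = t i + c" if "i < L" "j < L" for i j c
  proof -
    have "\<beta> j = \<beta> i + of_int c * lam \<longleftrightarrow> of_int (t j) * lam = of_int (t i + c) * lam"
      using t[OF that(1)] t[OF that(2)] by (simp add: algebra_simps)
    then show ?thesis using lam_nz by (simp del: of_int_add)
  qed
  have t_eq_nat: "\<beta> j = \<beta> i + of_nat c * lam \<longleftrightarrow> t j = t i + int c" if "i < L" "j < L" for i j c
    using t_eq[OF that, of "int c"] by simp
  obtain i1 where "i1 < L" "t i1 = Max (t ` {..<L})"
    using Max_in[of "t ` {..<L}"] \<open>0 < L\<close> by fastforce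
  then have i1: "i1 < L" "\<And>j. j < L \<Longrightarrow> t j \<le> t i1" by simp_all
  have inj_t: "inj_on t {..<L}"
    using inj_on_weights[OF uni] t unfolding inj_on_def by (metis lessThan_iff)
  \<comment> \<open>From \<open>j\<close> the top weight is reached without a gap, so every weight
    in between occurs.\<close>
  have step: "\<exists>m<L. t m = t i1 - int k" if j: "j < L" "t j \<le> t i1 - int k" for j k
  proof -
    have "\<exists>k'. \<beta> i1 = \<beta> j + of_nat k' * lam \<and> chain j k'"
      using comparable[OF j(1) i1(1)] i1(2)[OF j(1)] i1(1) j(1) chain_0
      by (auto simp: t_eq_nat)
    then obtain k' where k': "t i1 = t j + int k'" "chain j k'"
      using t_eq_nat[OF j(1) i1(1)] by blast
    then have "k' - k \<le> k'" "int (k' - k) = int k' - int k" using j(2) by auto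
    then obtain m where "m < L" "\<beta> m = \<beta> j + of_nat (k' - k) * lam"
      using k'(2) unfolding chain_def by blast
    then show ?thesis using k' j t_eq_nat[of j m "k' - k"] \<open>int (k' - k) = _\<close> by auto
  qed
  have image_t: "t ` {..<L} = (\<lambda>k. t i1 - int k) ` {..<L}"
  proof -
    \<comment> \<open>Depths below the top weight. A downward closed set of naturals with
      \<open>L\<close> elements is \<open>{..<L}\<close>.\<close>
    define K where "K = {k. \<exists>m<L. t m = t i1 - int k}"
    have down: "k \<in> K" if "k' \<in> K" "k \<le> k'" for k k'
      using that step unfolding K_def by force
    have tK: "t ` {..<L} = (\<lambda>k. t i1 - int k) ` K"
    proof (intro equalityI subsetI)
      fix c assume "c \<in> t ` {..<L}"
      then obtain m where "m < L" "c = t m" by auto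
      moreover from this have "t m = t i1 - int (nat (t i1 - t m))" using i1(2)[of m] by simp
      ultimately show "c \<in> (\<lambda>k. t i1 - int k) ` K" unfolding K_def by blast
    next
      fix c assume "c \<in> (\<lambda>k. t i1 - int k) ` K"
      then obtain k m where "c = t i1 - int k" "m < L" "t m = t i1 - int k" unfolding K_def by blast
      then show "c \<in> t ` {..<L}" by (metis imageI lessThan_iff)
    qed
    have inj: "inj_on (\<lambda>k. t i1 - int k) S" for S by (auto simp: inj_on_def)
    have finK: "finite K" using finite_imageD[OF _ inj, of K] tK[symmetric] by simp
    have cardK: "card K = L"
      using card_image[OF inj, of K] card_image[OF inj_t] tK by simp
    have "K \<subseteq> {..<L}"
    proof
      fix k assume "k \<in> K"
      then have "{..k} \<subseteq> K" using down by auto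
      then have "card {..k} \<le> card K" by (rule card_mono[OF finK])
      then show "k \<in> {..<L}" using cardK by simp
    qed
    then have "K = {..<L}" using cardK by (simp add: card_subset_eq)
    then show ?thesis using tK by simp
  qed
  have "\<exists>m<L. t m = t i1 - int i" if "i < L" for i
  proof -
    have "t i1 - int i \<in> t ` {..<L}" unfolding image_t using that by simp
    then show ?thesis by (metis imageE lessThan_iff)
  qed
  then obtain \<sigma> where \<sigma>: "\<And>i. i < L \<Longrightarrow> \<sigma> i < L" "\<And>i. i < L \<Longrightarrow> t (\<sigma> i) = t i1 - int i"
    by metis
  have "inj_on \<sigma> {..<L}"
  proof (rule inj_onI)
    fix i j assume "i \<in> {..<L}" "j \<in> {..<L}" "\<sigma> i = \<sigma> j"
    then have "t i1 - int i = t i1 - int j" using \<sigma>(2) by (metis lessThan_iff)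
    then show "i = j" by simp
  qed
  then have "bij_betw \<sigma> {..<L} {..<L}"
    using endo_inj_surj[of "{..<L}" \<sigma>] \<sigma>(1) unfolding bij_betw_def by blast
  moreover have "\<beta> (\<sigma> i) = \<beta> i1 - of_nat i * lam" if "i < L" for i
    using t_eq[OF i1(1) \<sigma>(1)[OF that], of "- int i"] \<sigma>(2)[OF that] by simp
  ultimately show ?thesis using that by blast
qed

end

section \<open>Block coordinates\<close>

text \<open>Here \<open>S i a c\<close> is the paper's entry \<open>S(i+1)\<^bsub>a+1,c+1\<^esub>\<close>.\<close>

locale block_coords = jordan_coords sU A L d "\<lambda>i. \<alpha> - of_nat i * lam" x
  for sU :: "'k :: field_char_0 \<Rightarrow> 'u :: ab_group_add \<Rightarrow> 'u" and A L d \<alpha> lam x +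
  fixes E :: "'u \<Rightarrow> 'u" and S :: "nat \<Rightarrow> nat \<Rightarrow> nat \<Rightarrow> 'k"
  assumes lam_nonzero: "lam \<noteq> 0"
    and x_E: "a < d i \<Longrightarrow> x i a (E u) = (\<Sum>c<d (Suc i). S i a c * x (Suc i) c u)"
begin

lemma weight_inject: "\<alpha> - of_nat i * lam = \<alpha> - of_nat j * lam \<longleftrightarrow> i = j"
  using lam_nonzero by simp

lemma x_E_e:
  assumes "a < d i" "b < d (Suc i)"
  shows "x i a (E (e (Suc i) b)) = S i a b"
proof -
  have "x i a (E (e (Suc i) b)) = (\<Sum>c<d (Suc i). if c = b then S i a b else 0)"
    unfolding x_E[OF assms(1)] by (intro sum.cong refl) (use assms in \<open>auto simp: x_e\<close>)
  then show ?thesis using assms by simp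
qed

end

locale block_ad_chain = block_coords sU A L d \<alpha> lam x "Es 0" S + ad_chain sU A Es lam n
  for sU :: "'k :: field_char_0 \<Rightarrow> 'u :: ab_group_add \<Rightarrow> 'u" and A L d \<alpha> x Es lam n S
begin

sublocale jordan_ad_chain sU A L d "\<lambda>i. \<alpha> - of_nat i * lam" x Es lam n ..

lemma corner_nonzero:
  assumes uni: "uniserial_pair sU A (Es 0)" and i: "Suc i < L"
  shows "S i (d i - 1) 0 \<noteq> 0"
proof
  assume S0: "S i (d i - 1) 0 = 0"
  have d: "0 < d i" "0 < d (Suc i)" using i d_pos_iff by auto
  define P where "P j (a :: nat) \<longleftrightarrow> Suc i \<le> j" for j a
  \<comment> \<open>Killed are the last coordinate of block \<open>i\<close>, all but the first of
    block \<open>Suc i\<close>, and everything later. The only entry of E that could leave this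
    subspace is the corner, assumed 0. Basis vector \<open>(Suc i, 0)\<close> lies here but not in
    the subspace of \<open>P\<close>; for \<open>(i, d i - 1)\<close> it is the reverse.\<close>
  define Q where "Q j a \<longleftrightarrow> Suc i < j \<or> (j = Suc i \<and> 0 < a) \<or> (j = i \<and> d i - 1 \<le> a)" for j a
  have "coord_invariant P"
    unfolding coord_invariant_def
  proof (intro conjI allI impI)
    fix u j a assume u: "\<forall>l b. P l b \<longrightarrow> x l b u = 0" and j: "P j a"
    show "x j a (Es 0 u) = 0"
      by (cases "a < d j") (use u j in \<open>auto simp: P_def x_E x_out intro!: sum.neutral\<close>)
  qed (auto simp: P_def)
  moreover have "coord_invariant Q"
    unfolding coord_invariant_def
  proof (intro conjI allI impI)
    fix u j a assume u: "\<forall>l b. Q l b \<longrightarrow> x l b u = 0" and j: "Q j a"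
    show "x j a (Es 0 u) = 0"
    proof (cases "a < d j")
      case True
      have "S j a c * x (Suc j) c u = 0" for c
      proof (cases "j = i")
        case True
        then have "a = d i - 1" using j \<open>a < d j\<close> by (auto simp: Q_def)
        then show ?thesis using u S0 True by (cases c) (auto simp: Q_def)
      next
        case False
        then show ?thesis using u j by (auto simp: Q_def)
      qed
      then show ?thesis by (simp add: x_E[OF True])
    qed (simp add: x_out)
  qed (auto simp: Q_def)
  ultimately show False
    by (rule coord_invariant_comparable[OF uni, of P Q 0 "Suc i" "d i - 1" i])
      (use d in \<open>auto simp: P_def Q_def\<close>)
qed

section \<open>Nilpotency index and the sizes of adjacent blocks\<close>

primrec SD :: "nat \<Rightarrow> nat \<Rightarrow> nat \<Rightarrow> nat \<Rightarrow> 'k" where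
  "SD 0 i a c = (if a < d i \<and> c < d (Suc i) then S i a c else 0)"
| "SD (Suc j) i a c = SD j i (Suc a) c - (if c = 0 then 0 else SD j i a (c - 1))"

lemma SD_out: "d i \<le> a \<Longrightarrow> SD j i a c = 0"
  by (induction j arbitrary: a c) auto

text \<open>\<open>SD j i\<close> is the block in position \<open>(i, Suc i)\<close> of
  \<open>(ad A - lam)^j E\<close>: bracketing with the nilpotent part of A shifts rows up and
  subtracts a shift of columns to the right.\<close>

lemma x_Es: "x i a (Es j u) = (\<Sum>c<d (Suc i). SD j i a c * x (Suc i) c u)"
proof (induction j arbitrary: a u)
  case 0
  show ?case by (cases "a < d i") (auto simp: x_E x_out intro!: sum.cong)
next
  case (Suc j)
  let ?D = "d (Suc i)"
  have *: "(\<Sum>c<?D. SD j i a c * x (Suc i) (Suc c) u) =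
      (\<Sum>c<?D. (if c = 0 then 0 else SD j i a (c - 1)) * x (Suc i) c u)"
  proof (cases ?D)
    case (Suc D)
    have "(\<Sum>c<Suc D. SD j i a c * x (Suc i) (Suc c) u) = (\<Sum>c<D. SD j i a c * x (Suc i) (Suc c) u)"
      by (simp add: x_out Suc)
    then show ?thesis unfolding Suc by (simp only: sum.lessThan_Suc_shift) simp
  qed simp
  \<comment> \<open>Subtracting \<open>lam\<close> turns the eigenvalue of block \<open>i\<close>
    into that of block \<open>Suc i\<close>, so it cancels against the scalar part of
    \<open>A u\<close>.\<close>
  have "x i a (Es (Suc j) u) = x i (Suc a) (Es j u) - (x i a (Es j (A u)) - (\<alpha> - of_nat (Suc i) * lam) * x i a (Es j u))"
    unfolding Es_Suc x_diff x_A x_scale by (simp add: algebra_simps)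
  also have "x i a (Es j (A u)) - (\<alpha> - of_nat (Suc i) * lam) * x i a (Es j u) =
      (\<Sum>c<?D. SD j i a c * x (Suc i) (Suc c) u)"
    unfolding Suc x_A sum_distrib_left sum_subtractf[symmetric]
    by (intro sum.cong refl) (simp add: algebra_simps)
  finally show ?case
    unfolding * Suc by (simp add: sum_subtractf[symmetric] left_diff_distrib)
qed

text \<open>Each bracket moves an entry up one row or right one column, so the bound on
  \<open>a - c\<close>, initially \<open>d i - 1\<close> at the corner, drops by one every
  time.\<close>

lemma SD_support: "SD j i a c \<noteq> 0 \<Longrightarrow> j + a < d i + c"
proof (induction j arbitrary: a c)
  case (Suc j)
  then have "SD j i (Suc a) c \<noteq> 0 \<or> (c \<noteq> 0 \<and> SD j i a (c - 1) \<noteq> 0)" by (auto split: if_splits)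
  then show ?case using Suc.IH[of "Suc a" c] Suc.IH[of a "c - 1"] by auto
qed (auto split: if_splits)

text \<open>Characteristic zero enters the nilpotency index through this binomial coefficient.\<close>

lemma SD_extreme:
  assumes "j + a + 1 = d i + c" "c < d (Suc i)" "0 < d i"
  shows "SD j i a c = (-1) ^ c * of_nat (j choose c) * S i (d i - 1) 0"
  using assms
\<comment> \<open>On this extreme diagonal only the corner contributes. The coefficient counts
  lattice paths of \<open>j\<close> steps with \<open>c\<close> of them to the right, each of sign
  -1; the induction is Pascal's rule.\<close>
proof (induction j arbitrary: a c)
  case 0
  show ?case
  proof (cases "c = 0")
    case True
    then have "a = d i - 1" using 0 by simp
    then show ?thesis using True 0 by simp
  next
    case False
    then have "d i \<le> a" using 0 by simp
    then show ?thesis using SD_out[of i a 0 c] False by simp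
  qed
next
  case (Suc j)
  have 1: "SD j i (Suc a) c = (-1) ^ c * of_nat (j choose c) * S i (d i - 1) 0"
    by (rule Suc.IH[OF _ Suc.prems(2,3)]) (use Suc.prems(1) in simp)
  show ?case
  proof (cases c)
    case 0
    then show ?thesis using 1 by simp
  next
    case (Suc c')
    have "SD j i a c' = (-1) ^ c' * of_nat (j choose c') * S i (d i - 1) 0"
      by (rule Suc.IH[OF _ _ Suc.prems(3)]) (use Suc.prems(1,2) Suc in simp_all)
    with 1 have "SD (Suc j) i a c = (-1) ^ c * of_nat (j choose c) * S i (d i - 1) 0 -
        (-1) ^ c' * of_nat (j choose c') * S i (d i - 1) 0"
      using Suc by simp
    also have "\<dots> = (-1) ^ c * of_nat (Suc j choose c) * S i (d i - 1) 0"
      unfolding Suc by (simp add: distrib_left distrib_right left_diff_distrib)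
    finally show ?thesis .
  qed
qed

text \<open>The corner reaches the opposite corner of its block after
  \<open>d i + d (Suc i) - 2\<close> brackets, with a nonzero binomial coefficient; since
  \<open>Es\<close> vanishes from \<open>n\<close> on, this number is less than
  \<open>n\<close>.\<close>

lemma block_sum_le:
  assumes "Suc i < L" "S i (d i - 1) 0 \<noteq> 0"
  shows "d i + d (Suc i) \<le> n + 1"
proof (rule ccontr)
  assume "\<not> ?thesis"
  then have n: "n \<le> d i + d (Suc i) - 2" by simp
  have d: "0 < d i" "0 < d (Suc i)" using assms d_pos_iff by auto
  let ?j = "d i + d (Suc i) - 2" and ?c = "d (Suc i) - 1"
  have "SD ?j i 0 ?c = (-1) ^ ?c * of_nat (?j choose ?c) * S i (d i - 1) 0"
    by (rule SD_extreme) (use d in auto)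
  also have "\<dots> \<noteq> 0" using assms d by simp
  finally have "SD ?j i 0 ?c \<noteq> 0" .
  moreover have "x i 0 (Es ?j (e (Suc i) ?c)) =
      (\<Sum>c<d (Suc i). if c = ?c then SD ?j i 0 ?c else 0)"
    unfolding x_Es by (intro sum.cong refl) (use d in \<open>auto simp: x_e\<close>)
  then have "x i 0 (Es ?j (e (Suc i) ?c)) = SD ?j i 0 ?c" using d by simp
  ultimately show False using Es_n[OF n] by simp
qed

text \<open>A nonzero entry of \<open>Es (n - 1)\<close> in column
  \<open>c \<le> d (Suc i) - 1\<close> obeys the support bound, which leaves room only in a large
  enough pair of blocks.\<close>

lemma block_sum_ge:
  assumes "Es (n - 1) u \<noteq> 0"
  shows "\<exists>i. Suc i < L \<and> n + 1 \<le> d i + d (Suc i)"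
proof -
  obtain i a where ia: "x i a (Es (n - 1) u) \<noteq> 0" using x_inj assms by blast
  then obtain c where c: "c < d (Suc i)" "SD (n - 1) i a c \<noteq> 0"
    unfolding x_Es by (metis (no_types, lifting) lessThan_iff mult_zero_left sum.not_neutral_contains_not_neutral)
  have "Suc i < L" using c(1) d_pos_iff[of "Suc i"] by simp
  then show ?thesis using SD_support[OF c(2)] c(1) by (intro exI[of _ i]) auto
qed

end

unbundle fps_syntax
no_notation vec_index (infixl "$" 100)

section \<open>Uniqueness of normalized block coordinates\<close>

text \<open>The matrix of one system of Jordan coordinates with respect to another is block Toeplitz.\<close>

locale two_jordan_coords =
  c1: jordan_coords sU A L d \<beta> x + c2: jordan_coords sU A L' d' \<beta>' x'
  for sU :: "'k :: field \<Rightarrow> 'u :: ab_group_add \<Rightarrow> 'u" and A L d \<beta> x L' d' \<beta>' x'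
begin

lemma transition_rec:
  assumes "b < d j"
  shows "(\<beta>' i - \<beta> j) * x' i a (c1.e j b) + x' i (Suc a) (c1.e j b) =
    (if b = 0 then 0 else x' i a (c1.e j (b - 1)))"
proof -
  have "x' i a (A (c1.e j b)) = \<beta>' i * x' i a (c1.e j b) + x' i (Suc a) (c1.e j b)"
    by (rule c2.x_A)
  then show ?thesis unfolding c1.A_e[OF assms] by (auto simp: c2.x_add c2.x_scale algebra_simps)
qed

text \<open>For different weights the scalar in \<open>transition_rec\<close> is invertible, and the
  two remaining terms are zero by induction.\<close>

lemma transition_weight:
  assumes "b < d j" "\<beta>' i \<noteq> \<beta> j"
  shows "x' i a (c1.e j b) = 0"
  using assms(1)
proof (induction "b + (d' i - a)" arbitrary: a b rule: less_induct)
  case less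
  show ?case
  proof (cases "d' i \<le> a")
    case False
    then have "x' i (Suc a) (c1.e j b) = 0" using less.prems by (intro less.hyps) auto
    moreover have "b \<noteq> 0 \<Longrightarrow> x' i a (c1.e j (b - 1)) = 0" using less.prems by (intro less.hyps) auto
    ultimately show ?thesis using transition_rec[OF less.prems, of i a] assms(2)
      by (auto split: if_splits)
  qed (simp add: c2.x_out)
qed

lemma transition_toeplitz:
  assumes "b < d j" "\<beta>' i = \<beta> j"
  shows "x' i a (c1.e j b) = (if a \<le> b then x' i 0 (c1.e j (b - a)) else 0)"
  using assms(1)
proof (induction a arbitrary: b)
  case (Suc a)
  have "x' i (Suc a) (c1.e j b) = (if b = 0 then 0 else x' i a (c1.e j (b - 1)))"
    using transition_rec[OF Suc.prems, of i a] assms(2) by simp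
  then show ?case using Suc.IH[of "b - 1"] Suc.prems by auto
qed simp

text \<open>The nonzero vector \<open>e j 0\<close> can only have coordinates at position 0 of
  blocks with its weight. The Toeplitz pattern copies such a coordinate to position
  \<open>d j - 1\<close>, which must therefore exist there.\<close>

lemma transition_block:
  assumes "j < L"
  obtains i where "i < L'" "\<beta>' i = \<beta> j" "d j \<le> d' i"
proof -
  have dj: "0 < d j" using assms c1.d_pos_iff by simp
  then have "c1.e j 0 \<noteq> 0" using c1.x_e[OF dj, of j 0] by auto
  then obtain i a where ia: "x' i a (c1.e j 0) \<noteq> 0" using c2.x_inj by blast
  then have \<beta>: "\<beta>' i = \<beta> j" using transition_weight[OF dj] by blast
  have "x' i 0 (c1.e j 0) \<noteq> 0" using transition_toeplitz[OF dj \<beta>, of a] ia by (auto split: if_splits)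
  then have "x' i (d j - 1) (c1.e j (d j - 1)) \<noteq> 0"
    using transition_toeplitz[of "d j - 1" j i "d j - 1"] dj \<beta> by simp
  then have "d j - 1 < d' i" using c2.x_out not_less by blast
  then show ?thesis using that[of i] \<beta> c2.d_pos_iff[of i] dj by auto
qed

end

definition normalized_blocks :: "nat \<Rightarrow> (nat \<Rightarrow> nat) \<Rightarrow> (nat \<Rightarrow> nat \<Rightarrow> nat \<Rightarrow> 'k :: field) \<Rightarrow> bool" where
  "normalized_blocks L d S \<longleftrightarrow>
     (\<forall>i. Suc i < L \<longrightarrow> S i (d i - 1) 0 = 1) \<and>
     (\<forall>i. Suc (Suc i) < L \<longrightarrow> (\<forall>j<d (Suc i).
        S i (d i - 1) j = S (Suc i) (d (Suc i) - 1 - j) 0)) \<and>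
     (\<forall>j<d 0 - 1. S 0 j 0 = 0) \<and>
     (\<forall>j. 0 < j \<and> j < d (L - 1) \<longrightarrow> S (L - 2) (d (L - 2) - 1) j = 0)"

text \<open>The first column, read from the bottom, and the last row of a block. The centralizer of a
  Jordan block consists of polynomials in it, and it acts on these two series by multiplication
  modulo \<open>t\<close> to the size of the block.\<close>

definition col_fps :: "(nat \<Rightarrow> nat) \<Rightarrow> (nat \<Rightarrow> nat \<Rightarrow> nat \<Rightarrow> 'k :: field) \<Rightarrow> nat \<Rightarrow> 'k fps" where
  "col_fps d S i = Abs_fps (\<lambda>m. if m < d i then S i (d i - 1 - m) 0 else 0)"

definition row_fps :: "(nat \<Rightarrow> nat) \<Rightarrow> (nat \<Rightarrow> nat \<Rightarrow> nat \<Rightarrow> 'k :: field) \<Rightarrow> nat \<Rightarrow> 'k fps" where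
  "row_fps d S i = Abs_fps (\<lambda>m. if m < d (Suc i) then S i (d i - 1) m else 0)"

text \<open>Reading columns from the bottom turns the normalization into equations between series;
  in the matching condition both series are cut off at the size of the shared block.\<close>

lemma normalized_blocks_iff_fps:
  assumes L: "2 \<le> L" and d: "\<And>i. 0 < d i \<longleftrightarrow> i < L"
  shows "normalized_blocks L d S \<longleftrightarrow>
     (\<forall>i. Suc (Suc i) < L \<longrightarrow> row_fps d S i = col_fps d S (Suc i)) \<and>
     col_fps d S 0 = 1 \<and> row_fps d S (L - 2) = 1 \<and> (\<forall>i. Suc i < L \<longrightarrow> S i (d i - 1) 0 = 1)"
proof -
  have L': "Suc (L - 2) = L - 1" "L - 1 < L" "L - 2 < L" "Suc (L - 2) < L" using L by auto
  have d0: "0 < d 0" "0 < d (L - 1)" using d L by auto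
  have 1: "col_fps d S 0 = 1 \<longleftrightarrow> S 0 (d 0 - 1) 0 = 1 \<and> (\<forall>j<d 0 - 1. S 0 j 0 = 0)"
  proof -
    have "(\<forall>j<d 0 - 1. S 0 j 0 = 0) \<longleftrightarrow> (\<forall>m. 0 < m \<longrightarrow> m < d 0 \<longrightarrow> S 0 (d 0 - 1 - m) 0 = 0)"
    proof (intro iffI allI impI)
      fix j assume "\<forall>m. 0 < m \<longrightarrow> m < d 0 \<longrightarrow> S 0 (d 0 - 1 - m) 0 = 0" "j < d 0 - 1"
      then have "S 0 (d 0 - 1 - (d 0 - 1 - j)) 0 = 0" by (auto dest!: spec[of _ "d 0 - 1 - j"])
      then show "S 0 j 0 = 0" using \<open>j < d 0 - 1\<close> by simp
    qed auto
    then show ?thesis using d0 by (auto simp: col_fps_def fps_eq_iff)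
  qed
  have 2: "row_fps d S (L - 2) = 1 \<longleftrightarrow> S (L - 2) (d (L - 2) - 1) 0 = 1 \<and>
      (\<forall>j. 0 < j \<and> j < d (L - 1) \<longrightarrow> S (L - 2) (d (L - 2) - 1) j = 0)"
    using d0 by (auto simp: row_fps_def fps_eq_iff L')
  have 3: "row_fps d S i = col_fps d S (Suc i) \<longleftrightarrow>
      (\<forall>j<d (Suc i). S i (d i - 1) j = S (Suc i) (d (Suc i) - 1 - j) 0)" for i
    by (auto simp: row_fps_def col_fps_def fps_eq_iff)
  show ?thesis unfolding normalized_blocks_def 1 2 3 using L' L by auto
qed

lemma fps_mult_unit_cancel_below:
  fixes F G :: "'k :: field fps"
  assumes "\<And>m. m < d \<Longrightarrow> (F * G) $ m = 0" "G $ 0 \<noteq> 0" "m < d"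
  shows "F $ m = 0"
  using assms(3)
proof (induction m rule: less_induct)
  case (less m)
  have "(F * G) $ m = (\<Sum>i=0..m. F $ i * G $ (m - i))" by (rule fps_mult_nth)
  also have "\<dots> = (\<Sum>i=0..m. if i = m then F $ m * G $ 0 else 0)"
    by (intro sum.cong refl) (use less in auto)
  finally show ?case using assms(1)[OF less.prems] assms(2) by simp
qed

locale two_block_coords =
  b1: block_coords sU A L d \<alpha> lam x E S + b2: block_coords sU A L' d' \<alpha>' lam x' E S'
  for sU :: "'k :: field_char_0 \<Rightarrow> 'u :: ab_group_add \<Rightarrow> 'u" and A L d \<alpha> lam x E S L' d' \<alpha>' x' S'
begin

sublocale t: two_jordan_coords sU A L d "\<lambda>i. \<alpha> - of_nat i * lam" x L' d'
  "\<lambda>i. \<alpha>' - of_nat i * lam" x' ..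

sublocale t': two_jordan_coords sU A L' d' "\<lambda>i. \<alpha>' - of_nat i * lam" x' L d
  "\<lambda>i. \<alpha> - of_nat i * lam" x ..

text \<open>The top block of each system has its weight in the other, at or below the top. In
  characteristic 0 this forces equal tops; then \<open>transition_block\<close>, used both ways,
  gives equal sizes.\<close>

lemma same_shape:
  assumes "0 < L" "0 < L'"
  shows "\<alpha> = \<alpha>'" "L = L'" "d = d'"
proof -
  obtain i j where "\<alpha>' - of_nat i * lam = \<alpha> - of_nat 0 * lam" "\<alpha> - of_nat j * lam = \<alpha>' - of_nat 0 * lam"
    using t.transition_block[OF assms(1)] t'.transition_block[OF assms(2)] by metis
  then have ij: "\<alpha>' = \<alpha> + of_nat i * lam" "\<alpha> = \<alpha>' + of_nat j * lam"
    by (simp_all add: algebra_simps)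
  then have "of_nat (i + j) * lam = 0" by (simp add: algebra_simps)
  then have "i + j = 0" using b1.lam_nonzero by (simp del: of_nat_add)
  then show \<alpha>: "\<alpha> = \<alpha>'" using ij by simp
  have 1: "j < L' \<and> d j \<le> d' j" if "j < L" for j
    using t.transition_block[OF that] b1.weight_inject \<alpha> by metis
  have 2: "j < L \<and> d' j \<le> d j" if "j < L'" for j
    using t'.transition_block[OF that] b1.weight_inject \<alpha> by metis
  show "L = L'" using 1 2 by (metis linorder_neqE_nat less_irrefl)
  show "d = d'"
  proof
    fix j
    show "d j = d' j"
    proof (cases "j < L")
      case True
      then show ?thesis using 1 2 \<open>L = L'\<close> by (intro antisym) auto
    next
      case False
      then have "d j = 0" "d' j = 0" using b1.d_eq_0_iff b2.d_eq_0_iff \<open>L = L'\<close> by auto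
      then show ?thesis by simp
    qed
  qed
qed

end

section \<open>Two coordinate systems of the same shape\<close>

locale same_shape_coords =
  b1: block_coords sU A L d \<alpha> lam x E S + b2: block_coords sU A L d \<alpha> lam x' E S'
  for sU :: "'k :: field_char_0 \<Rightarrow> 'u :: ab_group_add \<Rightarrow> 'u" and A L d \<alpha> lam x E S x' S' +
  assumes L2: "2 \<le> L"
begin

sublocale t: two_jordan_coords sU A L d "\<lambda>i. \<alpha> - of_nat i * lam" x L d
  "\<lambda>i. \<alpha> - of_nat i * lam" x' ..

text \<open>First row of the Toeplitz block \<open>i\<close> of the transition matrix: the
  polynomial in the Jordan nilpotent by which this block acts.\<close>

definition p :: "nat \<Rightarrow> 'k fps" where
  "p i = Abs_fps (\<lambda>k. if k < d i then x' i 0 (b1.e i k) else 0)"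

lemma x'_e: "b < d j \<Longrightarrow> x' i a (b1.e j b) = (if i = j \<and> a \<le> b then p i $ (b - a) else 0)"
proof (cases "i = j")
  case True
  assume b: "b < d j"
  show ?thesis
    unfolding t.transition_toeplitz[OF b, of i a, OF arg_cong[OF True]]
    using True b less_imp_diff_less[OF b, of a] by (simp add: p_def)
next
  case False
  assume b: "b < d j"
  have "\<alpha> - of_nat i * lam \<noteq> \<alpha> - of_nat j * lam" using False b1.weight_inject by blast
  from t.transition_weight[OF b this] show ?thesis using False by simp
qed

lemma x'_x: "x' i a u = (\<Sum>b<d i. if a \<le> b then p i $ (b - a) * x i b u else 0)"
proof -
  have "x' i a u = (\<Sum>j<L. \<Sum>b<d j. x j b u * x' i a (b1.e j b))"
    by (rule b1.linear_functional_expand) (simp_all add: b2.x_add b2.x_scale)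
  also have "\<dots> = (\<Sum>j<L. if j = i then \<Sum>b<d i. if a \<le> b then p i $ (b - a) * x i b u else 0 else 0)"
    by (intro sum.cong refl) (auto simp: x'_e mult.commute intro!: sum.neutral sum.cong)
  also have "\<dots> = (\<Sum>b<d i. if a \<le> b then p i $ (b - a) * x i b u else 0)"
    using b1.d_eq_0_iff[of i] by auto
  finally show ?thesis .
qed

text \<open>Both sides express the new coordinates of E on an old basis vector: with Toeplitz
  matrices \<open>Q i\<close> built from \<open>p i\<close>, the new block times
  \<open>Q (Suc i)\<close> equals \<open>Q i\<close> times the old block.\<close>

lemma intertwine:
  assumes "a < d i" "b < d (Suc i)"
  shows "(\<Sum>c\<le>b. S' i a c * p (Suc i) $ (b - c)) = (\<Sum>b'<d i. if a \<le> b' then p i $ (b' - a) * S i b' b else 0)"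
proof -
  have "x' i a (E (b1.e (Suc i) b)) = (\<Sum>c<d (Suc i). if c \<in> {..b} then S' i a c * p (Suc i) $ (b - c) else 0)"
    unfolding b2.x_E[OF assms(1)] by (intro sum.cong refl) (use assms in \<open>auto simp: x'_e\<close>)
  also have "\<dots> = (\<Sum>c\<in>{..<d (Suc i)} \<inter> {..b}. S' i a c * p (Suc i) $ (b - c))"
    by (simp only: sum.inter_restrict[OF finite_lessThan])
  also have "{..<d (Suc i)} \<inter> {..b} = {..b}" using assms by auto
  finally have "x' i a (E (b1.e (Suc i) b)) = (\<Sum>c\<le>b. S' i a c * p (Suc i) $ (b - c))" .
  moreover have "x' i a (E (b1.e (Suc i) b)) =
      (\<Sum>b'<d i. if a \<le> b' then p i $ (b' - a) * S i b' b else 0)"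
    unfolding x'_x[of i a "E (b1.e (Suc i) b)"]
  proof (rule sum.cong[OF refl])
    fix b' assume "b' \<in> {..<d i}"
    then show "(if a \<le> b' then p i $ (b' - a) * x i b' (E (b1.e (Suc i) b)) else 0) =
        (if a \<le> b' then p i $ (b' - a) * S i b' b else 0)"
      using b1.x_E_e[of b' i b] assms(2) by simp
  qed
  ultimately show ?thesis by simp
qed

text \<open>Column 0 of the intertwining identity: an upper triangular Toeplitz matrix has only its
  constant term there. The last row is treated dually in \<open>row_relation\<close>.\<close>

lemma col_relation:
  assumes "Suc i < L" "m < d i"
  shows "p (Suc i) $ 0 * col_fps d S' i $ m = (p i * col_fps d S i) $ m"
proof -
  have d: "0 < d (Suc i)" "d i - 1 - m < d i" using assms b1.d_pos_iff by auto
  have "p (Suc i) $ 0 * col_fps d S' i $ m =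
      (\<Sum>b'<d i. if d i - 1 - m \<le> b' then p i $ (b' - (d i - 1 - m)) * S i b' 0 else 0)"
    using intertwine[OF d(2,1)] assms(2) by (simp add: col_fps_def mult.commute)
  also have "\<dots> = (\<Sum>b'\<in>{d i - 1 - m..<d i}. p i $ (b' - (d i - 1 - m)) * S i b' 0)"
    by (rule sum.mono_neutral_cong_right) auto
  also have "\<dots> = (\<Sum>t=0..m. p i $ t * S i (d i - 1 - (m - t)) 0)"
    by (rule sum.reindex_bij_witness[where
        i = "\<lambda>t. t + (d i - 1 - m)" and j = "\<lambda>b'. b' - (d i - 1 - m)"])
      (use assms(2) in \<open>auto intro!: arg_cong[where f = "\<lambda>b. S i b 0"]\<close>)
  also have "\<dots> = (p i * col_fps d S i) $ m"
    unfolding fps_mult_nth by (intro sum.cong refl) (use assms(2) in \<open>auto simp: col_fps_def\<close>)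
  finally show ?thesis .
qed

lemma row_relation:
  assumes "Suc i < L" "m < d (Suc i)"
  shows "(row_fps d S' i * p (Suc i)) $ m = p i $ 0 * row_fps d S i $ m"
proof -
  have d: "d i - 1 < d i" using assms b1.d_pos_iff[of i] by auto
  have "(row_fps d S' i * p (Suc i)) $ m = (\<Sum>c\<le>m. S' i (d i - 1) c * p (Suc i) $ (m - c))"
    unfolding fps_mult_nth atLeast0AtMost
    by (intro sum.cong refl) (use assms(2) in \<open>auto simp: row_fps_def\<close>)
  also have "\<dots> = (\<Sum>b'<d i. if b' = d i - 1 then p i $ 0 * S i (d i - 1) m else 0)"
    unfolding intertwine[OF d assms(2)] by (intro sum.cong refl) auto
  finally show ?thesis using d assms(2) by (simp add: row_fps_def)
qed

text \<open>Otherwise the last new coordinate of block \<open>i\<close> would be the zero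
  functional.\<close>

lemma p_0_nonzero: "i < L \<Longrightarrow> p i $ 0 \<noteq> 0"
proof
  assume i: "i < L" and 0: "p i $ 0 = 0"
  have di: "d i - 1 < d i" using i b1.d_pos_iff[of i] by simp
  have "x' i (d i - 1) u = 0" for u
    unfolding x'_x[of i "d i - 1"]
  proof (rule sum.neutral, rule ballI)
    fix b assume "b \<in> {..<d i}"
    then have "b - (d i - 1) = 0" by simp
    then show "(if d i - 1 \<le> b then p i $ (b - (d i - 1)) * x i b u else 0) = 0"
      using 0 by (simp only: mult_zero_left if_cancel)
  qed
  then show False using b2.x_e[OF di, of i "d i - 1"] by simp
qed

text \<open>The normalization on both sides forces every \<open>p i\<close> to be one common
  constant modulo the block size; intertwining by a nonzero scalar then leaves the blocks
  unchanged.\<close>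

lemma S_unique:
  assumes N: "normalized_blocks L d S" "normalized_blocks L d S'"
    and i: "Suc i < L" "a < d i" "b < d (Suc i)"
  shows "S i a b = S' i a b"
proof -
  note N' = N[unfolded normalized_blocks_iff_fps[OF L2 b1.d_pos_iff]]
  have fps0: "col_fps d S i $ 0 = 1" "col_fps d S' i $ 0 = 1" if "Suc i < L" for i
    using N' that b1.d_pos_iff[of i] by (auto simp: col_fps_def)
  \<comment> \<open>Corners equal to 1 on both sides make consecutive constant terms agree.\<close>
  have step: "p (Suc i) $ 0 = p i $ 0" if "Suc i < L" for i
    using col_relation[OF that, of 0] fps0[OF that] b1.d_pos_iff[of i] that by simp
  define q where "q = p 0 $ 0"
  have q: "p i $ 0 = q" if "i < L" for i
    using that by (induction i) (simp_all add: q_def step)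
  have q0: "q \<noteq> 0" using p_0_nonzero[of 0] L2 by (simp add: q_def)
  have p_const: "p i $ m = fps_const q $ m" if i: "i < L" and m: "m < d i" for i m
  proof -
    consider "i = 0" | i' where "i = Suc i'" "Suc i < L" | "i = L - 1" "0 < i"
      using i L2 by (cases i) (auto, linarith)
    then show ?thesis
    proof cases
      case 1
      then show ?thesis using col_relation[of 0 m] N' q[of 1] m L2 by (simp split: if_splits)
    next
      case 2
      let ?c = "col_fps d S i" and ?c' = "col_fps d S' i"
      \<comment> \<open>Matching rows and columns gives \<open>p c = q c'\<close> and
        \<open>p c' = q c\<close> modulo the block size. Their sum has the factor
        \<open>c + c'\<close>, a unit because its constant term is 2.\<close>
      have "((p i - fps_const q) * (?c + ?c')) $ k = 0" if k: "k < d i" for k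
      proof -
        have "q * ?c' $ k = (p i * ?c) $ k"
          using col_relation[OF 2(2) k] q[of "Suc i"] 2 by simp
        moreover have "(?c' * p i) $ k = q * ?c $ k"
          using row_relation[of i' k] q[of i'] 2 k N' by simp
        ultimately show ?thesis by (simp add: algebra_simps)
      qed
      moreover have "(?c + ?c') $ 0 \<noteq> 0" using fps0[OF 2(2)] by simp
      ultimately have "(p i - fps_const q) $ m = 0"
        using fps_mult_unit_cancel_below[of "d i"] m by blast
      then show ?thesis by simp
    next
      case 3
      then have "i = Suc (L - 2)" using L2 by simp
      then show ?thesis using row_relation[of "L - 2" m] N' q[of "L - 2"] m L2 3 by auto
    qed
  qed
  have "(\<Sum>c\<le>b. S' i a c * p (Suc i) $ (b - c)) = (\<Sum>c\<le>b. if c = b then S' i a b * q else 0)"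
    by (intro sum.cong refl) (use i p_const in auto)
  moreover have "(\<Sum>b'<d i. if a \<le> b' then p i $ (b' - a) * S i b' b else 0) =
      (\<Sum>b'<d i. if b' = a then q * S i a b else 0)"
    by (intro sum.cong refl) (use i p_const[of i] in auto)
  ultimately show ?thesis using intertwine[OF i(2,3)] q0 i by (simp add: mult.commute)
qed

end

section \<open>Existence of normalized block coordinates\<close>

text \<open>The constant term comes with its root \<open>q\<close>, so the formal radical extracts
  no root in the field.\<close>

lemma fps_sqrt_exists:
  fixes G :: "'k :: field_char_0 fps"
  assumes "G $ 0 = q * q" "q \<noteq> 0"
  obtains P where "P $ 0 = q" "P * P = G"
proof -
  define P where "P = fps_radical (\<lambda>_ _. q) (Suc (Suc 0)) G"
  have "P ^ Suc (Suc 0) = G"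
    unfolding P_def using power_radical[of G "\<lambda>_ _. q" "Suc 0"] assms by simp
  moreover have "P $ 0 = q" by (simp add: P_def)
  ultimately show ?thesis using that[of P] by simp
qed

text \<open>Regrouping by \<open>s + t\<close>, where terms from \<open>d\<close> on vanish with
  \<open>\<xi>\<close>. It serves both to compose two series in the shift and to move a series from
  a vector onto a matrix.\<close>

lemma sum_sum_shift:
  fixes f g \<xi> :: "nat \<Rightarrow> 'k :: comm_semiring_0"
  assumes "\<And>a. d \<le> a \<Longrightarrow> \<xi> a = 0"
  shows "(\<Sum>s<d. \<Sum>t<d. f s * g t * \<xi> (s + t)) = (\<Sum>m<d. (\<Sum>s\<le>m. f s * g (m - s)) * \<xi> m)"
proof -
  have zero: "f s * g t * \<xi> (s + t) = 0" if "\<not> s + t < d" for s t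
    using that assms by simp
  have "(\<Sum>s<d. \<Sum>t<d. f s * g t * \<xi> (s + t)) =
      (\<Sum>(s, t)\<in>{..<d} \<times> {..<d}. f s * g t * \<xi> (s + t))"
    by (simp add: sum.cartesian_product)
  also have "\<dots> = (\<Sum>(s, t)\<in>{(s, t). s + t < d}. f s * g t * \<xi> (s + t))"
    by (rule sum.mono_neutral_right) (auto, metis zero)
  also have "\<dots> = (\<Sum>m<d. \<Sum>s\<le>m. f s * g (m - s) * \<xi> (s + (m - s)))"
    by (rule sum.triangle_reindex)
  also have "\<dots> = (\<Sum>m<d. (\<Sum>s\<le>m. f s * g (m - s)) * \<xi> m)"
    by (intro sum.cong refl) (simp add: sum_distrib_right)
  finally show ?thesis .
qed

text \<open>The series \<open>F\<close> evaluated at the nilpotent shift. On sequences that vanish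
  from \<open>d\<close> on, this is the action of truncated power series.\<close>

definition fps_act :: "nat \<Rightarrow> 'k :: field fps \<Rightarrow> (nat \<Rightarrow> 'k) \<Rightarrow> nat \<Rightarrow> 'k" where
  "fps_act d F \<xi> a = (\<Sum>t<d. F $ t * \<xi> (a + t))"

lemma fps_act_out:
  assumes "\<And>a. d \<le> a \<Longrightarrow> \<xi> a = 0" "d \<le> a"
  shows "fps_act d F \<xi> a = 0"
  unfolding fps_act_def by (intro sum.neutral) (use assms in auto)

lemma fps_act_mult:
  assumes "\<And>a. d \<le> a \<Longrightarrow> \<xi> a = 0"
  shows "fps_act d F (fps_act d G \<xi>) a = fps_act d (F * G) \<xi> a"
proof -
  have "fps_act d F (fps_act d G \<xi>) a = (\<Sum>s<d. \<Sum>t<d. F $ s * G $ t * \<xi> (a + (s + t)))"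
    unfolding fps_act_def sum_distrib_left by (intro sum.cong refl) (simp add: add.assoc mult.assoc)
  also have "\<dots> = (\<Sum>m<d. (\<Sum>s\<le>m. F $ s * G $ (m - s)) * \<xi> (a + m))"
    by (rule sum_sum_shift) (simp add: assms)
  finally show ?thesis by (simp add: fps_act_def fps_mult_nth atLeast0AtMost)
qed

lemma fps_act_1:
  assumes "\<And>a. d \<le> a \<Longrightarrow> \<xi> a = 0"
  shows "fps_act d 1 \<xi> a = \<xi> a"
proof -
  have "fps_act d 1 \<xi> a = (\<Sum>t<d. if t = 0 then \<xi> a else 0)"
    unfolding fps_act_def by (intro sum.cong refl) auto
  then show ?thesis using assms[of a] by auto
qed

locale block_coords_change = block_coords sU A L d \<alpha> lam x E S
  for sU :: "'k :: field_char_0 \<Rightarrow> 'u :: ab_group_add \<Rightarrow> 'u" and A L d \<alpha> lam x E S +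
  fixes P :: "nat \<Rightarrow> 'k fps"
  assumes P0: "i < L \<Longrightarrow> P i $ 0 \<noteq> 0"
begin

definition new_x :: "nat \<Rightarrow> nat \<Rightarrow> 'u \<Rightarrow> 'k" where
  "new_x i a u = fps_act (d i) (P i) (\<lambda>b. x i b u) a"

definition S_ext :: "nat \<Rightarrow> nat \<Rightarrow> nat \<Rightarrow> 'k" where
  "S_ext i a c = (if a < d i \<and> c < d (Suc i) then S i a c else 0)"

text \<open>The block conjugated by the change of coordinates: \<open>P i\<close> acts on its rows,
  and the inverse of \<open>P (Suc i)\<close> on its columns by convolution.\<close>

definition new_S :: "nat \<Rightarrow> nat \<Rightarrow> nat \<Rightarrow> 'k" where
  "new_S i a m = (\<Sum>c\<le>m. fps_act (d i) (P i) (\<lambda>b. S_ext i b c) a * inverse (P (Suc i)) $ (m - c))"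

lemma inverse_P: "i < L \<Longrightarrow> inverse (P i) * P i = 1" "i < L \<Longrightarrow> P i * inverse (P i) = 1"
  using P0 inverse_mult_eq_1 inverse_mult_eq_1' by blast+

lemma x_new_x: "x i a u = fps_act (d i) (inverse (P i)) (\<lambda>b. new_x i b u) a"
proof (cases "i < L")
  case True
  have "fps_act (d i) (inverse (P i)) (\<lambda>b. new_x i b u) a =
      fps_act (d i) (inverse (P i)) (fps_act (d i) (P i) (\<lambda>b. x i b u)) a"
    by (simp add: new_x_def[abs_def])
  also have "\<dots> = x i a u"
    using True by (simp add: fps_act_mult fps_act_1 inverse_P x_out)
  finally show ?thesis ..
next
  case False
  then show ?thesis using d_eq_0_iff[of i] by (simp add: x_out fps_act_def)
qed

lemma new_coords: "block_coords sU A L d \<alpha> lam new_x E new_S"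
proof unfold_locales
  show "new_x i a (u + w) = new_x i a u + new_x i a w" for i a u w
    by (simp add: new_x_def fps_act_def x_add sum.distrib algebra_simps)
  show "new_x i a (sU k u) = k * new_x i a u" for i a k u
    by (simp add: new_x_def fps_act_def x_scale sum_distrib_left algebra_simps)
  show out: "new_x i a u = 0" if "d i \<le> a" for i a u
    unfolding new_x_def by (rule fps_act_out) (use that in \<open>auto simp: x_out\<close>)
  show "u = 0" if "\<And>i a. new_x i a u = 0" for u
    using that by (intro x_inj) (simp add: x_new_x fps_act_def)
  show "new_x i a (A u) = (\<alpha> - of_nat i * lam) * new_x i a u + new_x i (Suc a) u" for i a u
    unfolding new_x_def fps_act_def x_A
    by (simp add: sum.distrib sum_distrib_left distrib_left mult.left_commute[of _ "\<alpha> - _"])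
  show "\<exists>u. \<forall>i. \<forall>a<d i. new_x i a u = y i a" for y
  proof -
    define \<xi> where "\<xi> i a = (if a < d i then y i a else 0)" for i a
    obtain u where u: "\<forall>i. \<forall>a<d i. x i a u = fps_act (d i) (inverse (P i)) (\<xi> i) a"
      using x_surj[of "\<lambda>i. fps_act (d i) (inverse (P i)) (\<xi> i)"] by blast
    have xu: "(\<lambda>a. x i a u) = fps_act (d i) (inverse (P i)) (\<xi> i)" for i
    proof
      fix a
      show "x i a u = fps_act (d i) (inverse (P i)) (\<xi> i) a"
        using u fps_act_out[of "d i" "\<xi> i" a "inverse (P i)"]
        by (cases "a < d i") (auto simp: x_out \<xi>_def)
    qed
    have "new_x i a u = y i a" if a: "a < d i" for i a
    proof -
      have "i < L" using a d_pos_iff[of i] by auto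
      then have "new_x i a u = \<xi> i a"
        by (simp add: new_x_def xu fps_act_mult fps_act_1 inverse_P \<xi>_def)
      then show ?thesis using a by (simp add: \<xi>_def)
    qed
    then show ?thesis by blast
  qed
  show "new_x i a (E u) = (\<Sum>c<d (Suc i). new_S i a c * new_x (Suc i) c u)" if "a < d i" for i a u
  proof -
    let ?d' = "d (Suc i)" and ?f = "\<lambda>c. fps_act (d i) (P i) (\<lambda>b. S_ext i b c) a"
    have "x i b (E u) = (\<Sum>c<?d'. S_ext i b c * x (Suc i) c u)" for b
      by (cases "b < d i") (simp_all add: x_E x_out S_ext_def)
    then have "new_x i a (E u) = (\<Sum>t<d i. \<Sum>c<?d'. P i $ t * S_ext i (a + t) c * x (Suc i) c u)"
      by (simp add: new_x_def fps_act_def sum_distrib_left mult.assoc)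
    also have "\<dots> = (\<Sum>c<?d'. ?f c * x (Suc i) c u)"
      by (subst sum.swap) (simp add: fps_act_def sum_distrib_right)
    also have "\<dots> = (\<Sum>c<?d'. \<Sum>s<?d'. ?f c * inverse (P (Suc i)) $ s * new_x (Suc i) (c + s) u)"
      unfolding x_new_x[of "Suc i"] fps_act_def[of ?d'] by (simp add: sum_distrib_left mult.assoc)
    \<comment> \<open>The inverse series passes from the coordinates to the columns of the
      block.\<close>
    also have "\<dots> = (\<Sum>m<?d'. new_S i a m * new_x (Suc i) m u)"
      unfolding new_S_def by (rule sum_sum_shift) (rule out)
    finally show ?thesis .
  qed
qed (fact d_pos_iff lam_nonzero)+

text \<open>In column 0 the convolution has a single term, so \<open>P (Suc i)\<close> enters
  through its constant term alone; likewise \<open>P i\<close> in the last row.\<close>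

lemma col_new_S:
  assumes "Suc i < L" "m < d i"
  shows "col_fps d new_S i $ m = (P i * col_fps d S i) $ m / P (Suc i) $ 0"
proof -
  have d: "0 < d (Suc i)" using assms d_pos_iff by auto
  have "fps_act (d i) (P i) (\<lambda>b. S_ext i b 0) (d i - 1 - m) =
      (\<Sum>t=0..m. P i $ t * S i (d i - 1 - (m - t)) 0)"
    unfolding fps_act_def
    by (rule sum.mono_neutral_cong_right) (use assms d in \<open>auto simp: S_ext_def\<close>)
  also have "\<dots> = (P i * col_fps d S i) $ m"
    unfolding fps_mult_nth by (intro sum.cong refl) (use assms(2) in \<open>auto simp: col_fps_def\<close>)
  finally show ?thesis using assms by (simp add: col_fps_def[of d new_S] new_S_def divide_inverse)
qed

lemma row_new_S:
  assumes "Suc i < L" "m < d (Suc i)"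
  shows "row_fps d new_S i $ m = P i $ 0 * (row_fps d S i * inverse (P (Suc i))) $ m"
proof -
  have d: "0 < d i" using assms d_pos_iff by auto
  have f: "fps_act (d i) (P i) (\<lambda>b. S_ext i b c) (d i - 1) = P i $ 0 * row_fps d S i $ c" for c
  proof -
    have "fps_act (d i) (P i) (\<lambda>b. S_ext i b c) (d i - 1) =
        (\<Sum>t<d i. if t = 0 then P i $ 0 * row_fps d S i $ c else 0)"
      unfolding fps_act_def by (intro sum.cong refl) (use d in \<open>auto simp: S_ext_def row_fps_def\<close>)
    then show ?thesis using d by simp
  qed
  show ?thesis
    using assms(2) unfolding row_fps_def[of d new_S] new_S_def fps_mult_nth atLeast0AtMost f
    by (simp add: sum_distrib_left mult.assoc)
qed

end

context block_coords
begin

text \<open>With \<open>c\<^sub>i\<close>, \<open>r\<^sub>i\<close> the column and row series and \<open>q\<^sub>i\<close> the constant term of \<open>P\<^sub>i\<close>, the change of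
  coordinates replaces \<open>c\<^sub>i\<close> by \<open>c\<^sub>i P\<^sub>i / q\<^sub>i\<^sub>+\<^sub>1\<close> and \<open>r\<^sub>i\<close> by \<open>q\<^sub>i r\<^sub>i / P\<^sub>i\<^sub>+\<^sub>1\<close>. The condition
  \<open>r\<^sub>i\<^sub>-\<^sub>1 = c\<^sub>i\<close> on the new series then prescribes \<open>P\<^sub>i\<^sup>2\<close>.\<close>

lemma normalized_exists:
  assumes corner: "\<And>i. Suc i < L \<Longrightarrow> S i (d i - 1) 0 \<noteq> 0" and L: "2 \<le> L"
  shows "\<exists>x' S'. block_coords sU A L d \<alpha> lam x' E S' \<and> normalized_blocks L d S'"
proof -
  let ?c = "col_fps d S" and ?r = "row_fps d S"
  \<comment> \<open>The new corner is \<open>q i\<close> times the old one, divided by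
    \<open>q (Suc i)\<close>; this recursion makes it 1.\<close>
  define q where "q = rec_nat 1 (\<lambda>i t. t * S i (d i - 1) 0)"
  have q_Suc: "q (Suc i) = q i * S i (d i - 1) 0" for i by (simp add: q_def)
  have q0: "q i \<noteq> 0" if "i < L" for i
    using that
  proof (induction i)
    case (Suc i)
    then show ?case using corner[of i] by (simp add: q_Suc)
  qed (simp add: q_def)
  have fps0: "?c i $ 0 = S i (d i - 1) 0" "?r i $ 0 = S i (d i - 1) 0" if "Suc i < L" for i
    using that d_pos_iff[of i] d_pos_iff[of "Suc i"] by (auto simp: col_fps_def row_fps_def)
  have mid: "\<exists>P. P $ 0 = q (Suc i) \<and> P * P * ?c (Suc i) = fps_const (q i * q (Suc (Suc i))) * ?r i"
    if i: "Suc (Suc i) < L" for i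
  proof -
    have c: "?c (Suc i) $ 0 \<noteq> 0" using fps0[of "Suc i"] corner[of "Suc i"] i by simp
    \<comment> \<open>The recursion for \<open>q\<close>, applied to both corners, makes the
      constant term of the prescribed square equal to the square of
      \<open>q (Suc i)\<close>.\<close>
    have "(fps_const (q i * q (Suc (Suc i))) * ?r i * inverse (?c (Suc i))) $ 0 = q (Suc i) * q (Suc i)"
      using c fps0[of i] fps0[of "Suc i"] i by (simp add: q_Suc)
    moreover have "q (Suc i) \<noteq> 0" using q0 i by simp
    ultimately obtain P where P: "P $ 0 = q (Suc i)"
        "P * P = fps_const (q i * q (Suc (Suc i))) * ?r i * inverse (?c (Suc i))"
      by (rule fps_sqrt_exists)
    have "P * P * ?c (Suc i) = fps_const (q i * q (Suc (Suc i))) * ?r i * (inverse (?c (Suc i)) * ?c (Suc i))"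
      unfolding P(2) by (simp add: mult.assoc)
    then show ?thesis using P(1) inverse_mult_eq_1[OF c] by auto
  qed
  then obtain Q where Q: "\<And>i. Suc (Suc i) < L \<Longrightarrow> Q (Suc i) $ 0 = q (Suc i)"
      "\<And>i. Suc (Suc i) < L \<Longrightarrow>
        Q (Suc i) * Q (Suc i) * ?c (Suc i) = fps_const (q i * q (Suc (Suc i))) * ?r i"
  proof -
    define Q where "Q j = (SOME P. P $ 0 = q j \<and>
      P * P * ?c j = fps_const (q (j - 1) * q (Suc j)) * ?r (j - 1))" for j
    have "Q (Suc i) $ 0 = q (Suc i) \<and>
        Q (Suc i) * Q (Suc i) * ?c (Suc i) = fps_const (q i * q (Suc (Suc i))) * ?r i"
      if "Suc (Suc i) < L" for i
      using someI_ex[OF mid[OF that]] by (simp add: Q_def)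
    then show ?thesis using that[of Q] by blast
  qed
  \<comment> \<open>The end blocks occur in one condition each: dividing by the first column series
    and by the last row series makes these equal to 1. The factors of \<open>q\<close> adjust the
    constant terms.\<close>
  define P where "P j = (if j = 0 then fps_const (q 1) * inverse (?c 0)
    else if j = L - 1 then fps_const (q (L - 2)) * ?r (L - 2) else Q j)" for j
  have L': "Suc (L - 2) = L - 1" "Suc 0 < L" "L - 1 \<noteq> 0" "Suc (L - 2) < L" using L by auto
  have PQ: "P (Suc i) = Q (Suc i)" if "Suc (Suc i) < L" for i
    using that by (auto simp: P_def)
  have P0: "P i $ 0 = q i" if i: "i < L" for i
  proof -
    consider "i = 0" | i' where "i = Suc i'" "Suc (Suc i') < L" | "i = L - 1" "0 < i"
      using i by (cases i) (auto, linarith)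
    then show ?thesis
    proof cases
      case 1
      then show ?thesis using fps0[OF L'(2)] corner[OF L'(2)] by (simp add: P_def q_def)
    next
      case 2
      then show ?thesis using Q(1) PQ by simp
    next
      case 3
      then show ?thesis using fps0[OF L'(4)] q_Suc[of "L - 2"] L' L by (simp add: P_def)
    qed
  qed
  interpret ch: block_coords_change sU A L d \<alpha> lam x E S P
    by unfold_locales (simp add: P0 q0)
  have "normalized_blocks L d ch.new_S"
    unfolding normalized_blocks_iff_fps[OF L d_pos_iff]
  proof (intro conjI allI impI)
    fix i assume i: "Suc i < L"
    have "0 < d i" using i d_pos_iff[of i] by simp
    then have "ch.new_S i (d i - 1) 0 = col_fps d ch.new_S i $ 0" by (simp add: col_fps_def)
    also have "\<dots> = 1"
      using ch.col_new_S[OF i \<open>0 < d i\<close>] fps0[OF i] P0[of i] P0[of "Suc i"] q0[OF i] i by (simp add: q_Suc)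
    finally show "ch.new_S i (d i - 1) 0 = 1" .
  next
    show "col_fps d ch.new_S 0 = 1"
    proof (rule fps_ext)
      fix m
      have "P 0 * ?c 0 = fps_const (q 1)"
        using inverse_mult_eq_1[of "?c 0"] fps0[OF L'(2)] corner[OF L'(2)] by (simp add: P_def mult.assoc)
      then have "col_fps d ch.new_S 0 $ m = 1 $ m" if "m < d 0"
        using ch.col_new_S[OF L'(2) that] P0[OF L'(2)] q0[OF L'(2)] by simp
      moreover have "0 < d 0" using d_pos_iff L' by simp
      ultimately show "col_fps d ch.new_S 0 $ m = 1 $ m" by (cases "m < d 0") (simp_all add: col_fps_def)
    qed
  next
    show "row_fps d ch.new_S (L - 2) = 1"
    proof (rule fps_ext)
      fix m
      have r0: "?r (L - 2) $ 0 \<noteq> 0" using fps0[OF L'(4)] corner[OF L'(4)] by simp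
      have q2: "q (L - 2) \<noteq> 0" using q0 L by simp
      have "?r (L - 2) * inverse (P (Suc (L - 2))) = fps_const (inverse (q (L - 2)))"
        using inverse_mult_eq_1'[OF r0] L'(1,3)
        by (simp add: P_def fps_inverse_mult fps_const_inverse q2 mult.left_commute)
      then have "row_fps d ch.new_S (L - 2) $ m = 1 $ m" if "m < d (L - 1)"
        using ch.row_new_S[OF L'(4), of m] that L'(1) P0[of "L - 2"] q2 L by simp
      moreover have "0 < d (L - 1)" using d_pos_iff L' by simp
      ultimately show "row_fps d ch.new_S (L - 2) $ m = 1 $ m"
        by (cases "m < d (L - 1)") (simp_all add: row_fps_def L'(1))
    qed
  next
    fix i assume i: "Suc (Suc i) < L"
    show "row_fps d ch.new_S i = col_fps d ch.new_S (Suc i)"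
    proof (rule fps_ext)
      fix m
      show "row_fps d ch.new_S i $ m = col_fps d ch.new_S (Suc i) $ m"
      proof (cases "m < d (Suc i)")
        case True
        have qs: "q i \<noteq> 0" "q (Suc (Suc i)) \<noteq> 0" using q0 i by simp_all
        \<comment> \<open>Dividing the prescribed square by one factor \<open>P (Suc i)\<close>
          leaves the new row series on one side and the new column series on the other, up to
          constants.\<close>
        have "fps_const (q i * q (Suc (Suc i))) * (?r i * inverse (P (Suc i))) =
            P (Suc i) * ?c (Suc i) * (P (Suc i) * inverse (P (Suc i)))"
          using Q(2)[OF i] PQ[OF i] by (simp add: algebra_simps)
        also have "P (Suc i) * inverse (P (Suc i)) = 1" using ch.inverse_P(2) i by simp
        finally have "fps_const (q i * q (Suc (Suc i))) * (?r i * inverse (P (Suc i))) =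
            P (Suc i) * ?c (Suc i)" by simp
        then have "q i * q (Suc (Suc i)) * (?r i * inverse (P (Suc i))) $ m = (P (Suc i) * ?c (Suc i)) $ m"
          by (metis fps_mult_left_const_nth)
        moreover have "row_fps d ch.new_S i $ m = q i * (?r i * inverse (P (Suc i))) $ m"
          using ch.row_new_S[of i m] True i P0[of i] by simp
        moreover have "col_fps d ch.new_S (Suc i) $ m = (P (Suc i) * ?c (Suc i)) $ m / q (Suc (Suc i))"
          using ch.col_new_S[OF i True] i P0[of "Suc (Suc i)"] by simp
        ultimately show ?thesis using qs by (metis mult.assoc mult.commute nonzero_mult_div_cancel_right)
      qed (simp add: row_fps_def col_fps_def)
    qed
  qed
  then show ?thesis using ch.new_coords by blast
qed

end

section \<open>Block coordinates of a uniserial pair\<close>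

text \<open>With the blocks reordered along the string of weights, \<open>Es_weight\<close> leaves E
  only the blocks from \<open>Suc i\<close> to \<open>i\<close>, so \<open>S\<close> can be read off
  on basis vectors.\<close>

lemma (in jordan_ad_chain) block_ad_chain_exists:
  assumes uni: "uniserial_pair sU A (Es 0)" and "0 < L"
  shows "\<exists>d' \<alpha> x' S. block_ad_chain sU A L d' \<alpha> x' Es lam n S \<and> (\<Sum>i<L. d' i) = (\<Sum>i<L. d i)"
proof -
  obtain \<alpha> \<sigma> where \<sigma>: "bij_betw \<sigma> {..<L} {..<L}" "\<And>i. i < L \<Longrightarrow> \<beta> (\<sigma> i) = \<alpha> - of_nat i * lam"
    using weights_string[OF assms] by blast
  have \<sigma>_less: "\<sigma> i < L" if "i < L" for i using bij_betwE[OF \<sigma>(1)] that by blast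
  define d' where "d' i = (if i < L then d (\<sigma> i) else 0)" for i
  define x' where "x' i a = (if i < L then x (\<sigma> i) a else (\<lambda>u. 0))" for i a
  interpret j: jordan_coords sU A L d' "\<lambda>i. \<alpha> - of_nat i * lam" x'
  proof unfold_locales
    show "0 < d' i \<longleftrightarrow> i < L" for i using d_pos_iff \<sigma>_less by (simp add: d'_def)
    show "x' i a (u + w) = x' i a u + x' i a w" for i a u w by (simp add: x'_def x_add)
    show "x' i a (sU k u) = k * x' i a u" for i a k u by (simp add: x'_def x_scale)
    show "x' i a u = 0" if "d' i \<le> a" for i a u
      using that by (simp add: x'_def d'_def x_out split: if_splits)
    show "x' i a (A u) = (\<alpha> - of_nat i * lam) * x' i a u + x' i (Suc a) u" for i a u
      by (simp add: x'_def x_A \<sigma>(2))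
    show "u = 0" if 0: "\<And>i a. x' i a u = 0" for u
    proof (rule x_inj)
      fix i a
      show "x i a u = 0"
      proof (cases "i < L")
        case True
        then obtain k where "k < L" "i = \<sigma> k" using \<sigma>(1) unfolding bij_betw_def by (metis imageE lessThan_iff)
        then show ?thesis using 0[of k a] by (simp add: x'_def)
      next
        case False
        then show ?thesis using d_eq_0_iff[of i] by (simp add: x_out)
      qed
    qed
    show "\<exists>u. \<forall>i. \<forall>a<d' i. x' i a u = y i a" for y
    proof -
      obtain u where "\<forall>i. \<forall>a<d i. x i a u = y (inv_into {..<L} \<sigma> i) a"
        using x_surj[of "\<lambda>i. y (inv_into {..<L} \<sigma> i)"] by blast
      then have "x' i a u = y i a" if "a < d' i" for i a
        using that \<sigma>(1) by (auto simp: x'_def d'_def bij_betw_def split: if_splits)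
      then show ?thesis by blast
    qed
  qed
  interpret ja: jordan_ad_chain sU A L d' "\<lambda>i. \<alpha> - of_nat i * lam" x' Es lam n ..
  have "block_coords sU A L d' \<alpha> lam x' (Es 0) (\<lambda>i a c. x' i a (Es 0 (j.e (Suc i) c)))"
  proof unfold_locales
    fix i a u assume "a < d' i"
    have "x' i a (Es 0 u) = (\<Sum>l<L. \<Sum>b<d' l. x' l b u * x' i a (Es 0 (j.e l b)))"
      by (rule j.linear_functional_expand) (simp_all add: Es_add Es_scale j.x_add j.x_scale)
    also have "\<dots> = (\<Sum>l<L. if l = Suc i then
        \<Sum>b<d' (Suc i). x' i a (Es 0 (j.e (Suc i) b)) * x' (Suc i) b u else 0)"
    proof (rule sum.cong[OF refl])
      fix l
      have "x' i a (Es 0 (j.e l b)) = 0" if "l \<noteq> Suc i" "b < d' l" for b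
      proof (rule ja.Es_weight[OF _ that(2)])
        \<comment> \<open>Along the string, a weight difference of \<open>lam\<close> determines the
          neighbouring index because characteristic 0 makes multiples of \<open>lam\<close>
          distinct.\<close>
        show "\<alpha> - of_nat i * lam \<noteq> \<alpha> - of_nat l * lam + lam"
        proof
          assume "\<alpha> - of_nat i * lam = \<alpha> - of_nat l * lam + lam"
          then have "of_nat l * lam = of_nat (Suc i) * lam" by (simp add: algebra_simps)
          then show False using that(1) lam_nz by (simp del: of_nat_Suc)
        qed
      qed
      then show "(\<Sum>b<d' l. x' l b u * x' i a (Es 0 (j.e l b))) = (if l = Suc i then
        \<Sum>b<d' (Suc i). x' i a (Es 0 (j.e (Suc i) b)) * x' (Suc i) b u else 0)"
        by (auto simp: mult.commute)
    qed
    also have "\<dots> = (\<Sum>b<d' (Suc i). x' i a (Es 0 (j.e (Suc i) b)) * x' (Suc i) b u)"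
      using j.d_eq_0_iff[of "Suc i"] by auto
    finally show "x' i a (Es 0 u) = (\<Sum>c<d' (Suc i). x' i a (Es 0 (j.e (Suc i) c)) * x' (Suc i) c u)" .
  qed (fact lam_nz)
  then interpret b: block_coords sU A L d' \<alpha> lam x' "Es 0" "\<lambda>i a c. x' i a (Es 0 (j.e (Suc i) c))" .
  have "block_ad_chain sU A L d' \<alpha> x' Es lam n (\<lambda>i a c. x' i a (Es 0 (j.e (Suc i) c)))" ..
  moreover have "(\<Sum>i<L. d' i) = (\<Sum>i<L. d i)"
    using sum.reindex_bij_betw[OF \<sigma>(1), of d] by (simp add: d'_def)
  ultimately show ?thesis by blast
qed

lemma (in jordan_ad_chain) normalized_block_coords_exist:
  assumes uni: "uniserial_pair sU A (Es 0)" and nz: "Es (n - 1) u \<noteq> 0"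
  shows "\<exists>d' \<alpha> x' S. block_coords sU A L d' \<alpha> lam x' (Es 0) S \<and> normalized_blocks L d' S \<and> 2 \<le> L \<and>
    (\<Sum>i<L. d' i) = (\<Sum>i<L. d i) \<and> (\<forall>i. Suc i < L \<longrightarrow> d' i + d' (Suc i) \<le> n + 1) \<and>
    (\<exists>i. Suc i < L \<and> d' i + d' (Suc i) = n + 1)"
proof -
  have "L \<noteq> 0"
  proof
    assume "L = 0"
    then have "Es (n - 1) u = 0" using d_eq_0_iff by (intro x_inj) (simp add: x_out)
    then show False using nz by simp
  qed
  then obtain d' \<alpha> x' S where b: "block_ad_chain sU A L d' \<alpha> x' Es lam n S"
      and sum: "(\<Sum>i<L. d' i) = (\<Sum>i<L. d i)"
    using block_ad_chain_exists[OF uni] by blast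
  interpret b: block_ad_chain sU A L d' \<alpha> x' Es lam n S by (rule b)
  obtain i where i: "Suc i < L" "n + 1 \<le> d' i + d' (Suc i)" using b.block_sum_ge[OF nz] by blast
  have le: "d' i + d' (Suc i) \<le> n + 1" if "Suc i < L" for i
    using b.block_sum_le[OF that b.corner_nonzero[OF uni that]] .
  obtain x'' S' where "block_coords sU A L d' \<alpha> lam x'' (Es 0) S'" "normalized_blocks L d' S'"
    using b.normalized_exists[OF b.corner_nonzero[OF uni]] i(1) by auto
  moreover have "\<forall>i. Suc i < L \<longrightarrow> d' i + d' (Suc i) \<le> n + 1" using le by blast
  moreover have "\<exists>i. Suc i < L \<and> d' i + d' (Suc i) = n + 1"
    using i le_antisym[OF le[OF i(1)] i(2)] by blast
  moreover have "2 \<le> L" using i(1) by simp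
  ultimately show ?thesis using sum by blast
qed

unbundle no fps_syntax
notation vec_index (infixl "$" 100)

section \<open>Coordinates as column vectors\<close>

text \<open>The part of \<open>isomorphic_to_matrix_rep\<close> that does not involve the action, so
  that one \<open>f\<close> serves all operators.\<close>

definition vec_iso :: "('k :: field \<Rightarrow> 'u :: ab_group_add \<Rightarrow> 'u) \<Rightarrow> nat \<Rightarrow> ('u \<Rightarrow> 'k vec) \<Rightarrow> bool" where
  "vec_iso sU d f \<longleftrightarrow> bij_betw f UNIV (carrier_vec d) \<and>
     (\<forall>u w. f (u + w) = f u + f w) \<and> (\<forall>k u. f (sU k u) = k \<cdot>\<^sub>v f u)"

lemma vec_isoD:
  assumes "vec_iso sU d f"
  shows "f u \<in> carrier_vec d" "f (u + w) = f u + f w" "f (sU k u) = k \<cdot>\<^sub>v f u"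
    "f u = f w \<longleftrightarrow> u = w" "z \<in> carrier_vec d \<Longrightarrow> \<exists>u. f u = z"
proof -
  have b: "bij_betw f UNIV (carrier_vec d)" using assms by (simp add: vec_iso_def)
  show "f u \<in> carrier_vec d" using b by (auto simp: bij_betw_def)
  show "f u = f w \<longleftrightarrow> u = w" using b by (auto simp: bij_betw_def inj_on_def)
  show "z \<in> carrier_vec d \<Longrightarrow> \<exists>u. f u = z" using b by (metis bij_betw_imp_surj_on imageE)
qed (use assms in \<open>auto simp: vec_iso_def\<close>)

lemma vec_iso_diff:
  assumes "vec_iso sU d f"
  shows "f (u - w) = f u - f w"
proof -
  note D = vec_isoD[OF assms]
  have eq: "f (u - w) + f w = f u" using D(2)[of "u - w" w] by simp
  have "f (u - w) = (f (u - w) + f w) - f w"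
    using D(1)[of "u - w"] D(1)[of w] by (intro eq_vecI) auto
  then show ?thesis using eq by simp
qed

lemma matrix_on_vec_iso_unique:
  fixes M :: "'k :: field mat"
  assumes f: "vec_iso sU d f" and M: "M \<in> carrier_mat m d" "M' \<in> carrier_mat m d"
    and eq: "\<And>u. M *\<^sub>v f u = M' *\<^sub>v f u"
  shows "M = M'"
  by (rule eq_mat_on_vecI[OF M]) (use vec_isoD(5)[OF f] eq in metis)

lemma matrix_of_linear:
  fixes sU :: "'k :: field \<Rightarrow> 'u :: ab_group_add \<Rightarrow> 'u"
  assumes f: "vec_iso sU d f"
    and F: "\<And>u w. F (u + w) = F u + F w" "\<And>k u. F (sU k u) = sU k (F u)"
  obtains M where "M \<in> carrier_mat d d" "\<And>u. f (F u) = M *\<^sub>v f u"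
proof -
  note D = vec_isoD[OF f]
  define g where "g = inv_into UNIV f"
  have g: "g (f u) = u" for u using D(4) unfolding g_def by (simp add: inj_def)
  have fg: "f (g w) = w" if "w \<in> carrier_vec d" for w using D(5)[OF that] g by metis
  obtain M where "M \<in> carrier_mat d d" "\<And>w. w \<in> carrier_vec d \<Longrightarrow> f (F (g w)) = M *\<^sub>v w"
  proof (rule linear_map_carrier_vec_matrix[of d "\<lambda>w. f (F (g w))" d])
    fix w w' :: "'k vec" assume w: "w \<in> carrier_vec d" "w' \<in> carrier_vec d"
    have "g (w + w') = g w + g w'"
      using w D(4)[of "g (w + w')" "g w + g w'"] by (simp add: D(2) fg)
    then show "f (F (g (w + w'))) = f (F (g w)) + f (F (g w'))" by (simp add: F D(2))
  next
    fix k and w :: "'k vec" assume w: "w \<in> carrier_vec d"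
    have "g (k \<cdot>\<^sub>v w) = sU k (g w)"
      using w D(4)[of "g (k \<cdot>\<^sub>v w)" "sU k (g w)"] by (simp add: D(3) fg)
    then show "f (F (g (k \<cdot>\<^sub>v w))) = k \<cdot>\<^sub>v f (F (g w))" by (simp add: F D(3))
  qed (use D(1) in auto)
  then show ?thesis using that[of M] g D(1) by metis
qed

lemma vec_iso_exists:
  fixes sU :: "'k :: field \<Rightarrow> 'u :: ab_group_add \<Rightarrow> 'u"
  assumes "vector_space sU" "finite_dim sU"
  obtains f where "vec_iso sU (vector_space.dim sU UNIV) f"
proof -
  interpret vector_space sU by (rule assms(1))
  obtain B where B: "independent B" "span B = UNIV" "card B = dim UNIV"
    using basis_exists[of UNIV] by (metis UNIV_I subsetI subset_antisym)
  obtain C where "finite C" "span C = UNIV" using assms(2) unfolding finite_dim_def by blast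
  then have "finite B" using independent_span_bound[OF \<open>finite C\<close> B(1)] by simp
  let ?d = "dim UNIV"
  obtain h where h: "bij_betw h {..<?d} B"
    using ex_bij_betw_nat_finite[OF \<open>finite B\<close>] B(3) by (auto simp: atLeast0LessThan)
  have hB: "h r \<in> B" if "r < ?d" for r using bij_betwE[OF h] that by blast
  define f where "f u = vec ?d (\<lambda>r. representation B u (h r))" for u
  have inv: "(\<Sum>r<?d. sU (f u $ r) (h r)) = u" for u
  proof -
    have "(\<Sum>r<?d. sU (f u $ r) (h r)) = (\<Sum>r<?d. sU (representation B u (h r)) (h r))"
      by (simp add: f_def)
    also have "\<dots> = (\<Sum>b\<in>B. sU (representation B u b) b)"
      by (rule sum.reindex_bij_betw[OF h])
    also have "\<dots> = u" by (rule sum_representation_eq) (use B \<open>finite B\<close> in auto)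
    finally show ?thesis .
  qed
  have "bij_betw f UNIV (carrier_vec ?d)"
  proof (rule bij_betwI)
    show "(\<lambda>w. \<Sum>r<?d. sU (w $ r) (h r)) \<in> carrier_vec ?d \<rightarrow> UNIV" by simp
    show "f \<in> UNIV \<rightarrow> carrier_vec ?d" by (simp add: f_def)
    show "(\<Sum>r<?d. sU (f u $ r) (h r)) = u" for u by (rule inv)
    show "f (\<Sum>r<?d. sU (w $ r) (h r)) = w" if "w \<in> carrier_vec ?d" for w
    proof (rule eq_vecI)
      fix r assume "r < dim_vec w"
      then have r: "r < ?d" using that by simp
      have "f (\<Sum>r<?d. sU (w $ r) (h r)) $ r = (\<Sum>r'<?d. w $ r' * representation B (h r') (h r))"
        using r B by (simp add: f_def representation_sum representation_scale)
      also have "\<dots> = (\<Sum>r'<?d. w $ r' * (if r' = r then 1 else 0))"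
        by (intro sum.cong refl)
          (use r h in \<open>auto simp: representation_basis[OF B(1) hB] bij_betw_def inj_on_def\<close>)
      finally show "f (\<Sum>r<?d. sU (w $ r) (h r)) $ r = w $ r"
        using r by (simp add: sum_delta_mult_lessThan)
    qed (use that in \<open>simp add: f_def\<close>)
  qed
  then have "vec_iso sU ?d f"
    using B unfolding vec_iso_def f_def
    by (auto simp: representation_add representation_scale)
  then show ?thesis by (rule that)
qed

lemma jordan_vec_iso_exists:
  fixes sU :: "'k :: alg_closed_field \<Rightarrow> 'u :: ab_group_add \<Rightarrow> 'u"
  assumes sp: "vector_space sU" "finite_dim sU"
    and F: "\<And>u w. F (u + w) = F u + F w" "\<And>k u. F (sU k u) = sU k (F u)"
  obtains n_as f where "0 \<notin> fst ` set n_as" "sum_list (map fst n_as) = vector_space.dim sU UNIV"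
    "vec_iso sU (sum_list (map fst n_as)) f" "\<And>u. f (F u) = jordan_matrix n_as *\<^sub>v f u"
proof -
  let ?d = "vector_space.dim sU UNIV"
  obtain f where f: "vec_iso sU ?d f" using vec_iso_exists[OF sp] .
  note D = vec_isoD[OF f]
  obtain M where M: "M \<in> carrier_mat ?d ?d" "\<And>u. f (F u) = M *\<^sub>v f u"
    using matrix_of_linear[OF f F] by blast
  obtain n_as where "jordan_nf M n_as" using jordan_nf_exists_alg_closed[OF M(1)] by blast
  then have 0: "0 \<notin> fst ` set n_as" and "similar_mat M (jordan_matrix n_as)"
    by (auto simp: jordan_nf_def)
  then obtain P Q where "similar_mat_wit M (jordan_matrix n_as) P Q" by (auto simp: similar_mat_def)
  from similar_mat_witD2[OF M(1) this]
  have PQ: "P * Q = 1\<^sub>m ?d" "Q * P = 1\<^sub>m ?d" "M = P * jordan_matrix n_as * Q"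
    "jordan_matrix n_as \<in> carrier_mat ?d ?d" "P \<in> carrier_mat ?d ?d" "Q \<in> carrier_mat ?d ?d"
    by auto
  have d: "sum_list (map fst n_as) = ?d" using PQ(4) by auto
  let ?g = "\<lambda>u. Q *\<^sub>v f u"
  have "bij_betw (\<lambda>w. Q *\<^sub>v w) (carrier_vec ?d) (carrier_vec ?d)"
    by (rule bij_betwI[where g = "\<lambda>w. P *\<^sub>v w"])
      (use PQ in \<open>auto simp flip: assoc_mult_mat_vec\<close>)
  then have "bij_betw ?g UNIV (carrier_vec ?d)"
    using bij_betw_trans[of f UNIV "carrier_vec ?d" "\<lambda>w. Q *\<^sub>v w"] f by (simp add: vec_iso_def o_def)
  then have g: "vec_iso sU ?d ?g"
    unfolding vec_iso_def using PQ(6) D(1)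
    by (auto simp: D(2,3) mult_add_distrib_mat_vec[OF PQ(6)] mult_mat_vec[OF PQ(6)])
  have "?g (F u) = jordan_matrix n_as *\<^sub>v ?g u" for u
  proof -
    have "?g (F u) = Q *\<^sub>v (P *\<^sub>v (jordan_matrix n_as *\<^sub>v (Q *\<^sub>v f u)))"
      unfolding M(2) PQ(3) using PQ(4-6) D(1)[of u]
      by (simp add: assoc_mult_mat_vec[of _ ?d ?d _ ?d])
    also have "\<dots> = (Q * P) *\<^sub>v (jordan_matrix n_as *\<^sub>v (Q *\<^sub>v f u))"
      using PQ(4-6) D(1)[of u] by (simp add: assoc_mult_mat_vec[of _ ?d ?d _ ?d])
    finally show ?thesis using PQ(2,4,6) D(1)[of u] by simp
  qed
  then show ?thesis using that[OF 0 d, of ?g] g d by simp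
qed

definition block_size :: "nat list \<Rightarrow> nat \<Rightarrow> nat" where
  "block_size ds i = (if i < length ds then ds ! i else 0)"

text \<open>The sum has at most one nonzero term, from the block containing
  \<open>r\<close>.\<close>

definition block_vec :: "nat list \<Rightarrow> (nat \<Rightarrow> nat \<Rightarrow> 'k :: comm_monoid_add) \<Rightarrow> 'k vec" where
  "block_vec ds y = vec (sum_list ds) (\<lambda>r. \<Sum>i<length ds.
     if block_offset ds i \<le> r \<and> r < block_offset ds (Suc i) then y i (r - block_offset ds i) else 0)"

lemma block_vec_carrier [simp]: "block_vec ds y \<in> carrier_vec (sum_list ds)"
  by (simp add: block_vec_def)

lemma block_vec_index:
  assumes "i < length ds" "a < ds ! i"
  shows "block_vec ds y $ (block_offset ds i + a) = y i a"
proof -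
  have "block_vec ds y $ (block_offset ds i + a) = (\<Sum>j<length ds.
      if block_offset ds j \<le> block_offset ds i + a \<and> block_offset ds i + a < block_offset ds (Suc j)
      then y j (block_offset ds i + a - block_offset ds j) else 0)"
    using block_offset_less[OF assms] unfolding block_vec_def by (rule index_vec)
  also have "\<dots> = (\<Sum>j<length ds. if j = i then y i a else 0)"
    by (rule sum.cong) (use block_offset_interval_iff[OF assms(1) _ assms(2)] in auto)
  finally have "block_vec ds y $ (block_offset ds i + a) = (\<Sum>j<length ds. if j = i then y i a else 0)" .
  then show ?thesis using assms by simp
qed

lemma eq_block_vecI:
  assumes "w \<in> carrier_vec (sum_list ds)" "w' \<in> carrier_vec (sum_list ds)"
    and "\<And>i a. i < length ds \<Longrightarrow> a < ds ! i \<Longrightarrow> w $ (block_offset ds i + a) = w' $ (block_offset ds i + a)"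
  shows "w = w'"
proof (rule eq_vecI)
  fix r assume "r < dim_vec w'"
  then have "r < sum_list ds" using assms by simp
  then show "w $ r = w' $ r" by (rule block_offset_cases) (use assms(3) in blast)
qed (use assms in auto)

lemma mult_jordan_matrix_index:
  fixes w :: "'k :: comm_semiring_1 vec"
  assumes w: "w \<in> carrier_vec (sum_list (map fst n_as))"
    and i: "i < length n_as" "a < fst (n_as ! i)"
  shows "(jordan_matrix n_as *\<^sub>v w) $ (block_offset (map fst n_as) i + a) =
    snd (n_as ! i) * w $ (block_offset (map fst n_as) i + a) +
    (if Suc a < fst (n_as ! i) then w $ (block_offset (map fst n_as) i + Suc a) else 0)"
proof -
  let ?o = "block_offset (map fst n_as)"
  have "(jordan_matrix n_as *\<^sub>v w) $ (?o i + a) =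
      (\<Sum>j<length n_as. \<Sum>b<fst (n_as ! j). jordan_matrix n_as $$ (?o i + a, ?o j + b) * w $ (?o j + b))"
    using mult_mat_vec_index_sum[OF jordan_matrix_carrier w block_offset_less[of i "map fst n_as" a]] i
    by (simp add: sum_block_offset)
  also have "\<dots> = (\<Sum>j<length n_as. if j = i then \<Sum>b<fst (n_as ! i).
      (if a = b then snd (n_as ! i) else if Suc a = b then 1 else 0) * w $ (?o i + b) else 0)"
    by (intro sum.cong refl) (use i in \<open>auto simp: jordan_matrix_block_index intro!: sum.neutral sum.cong\<close>)
  also have "\<dots> = (\<Sum>b<fst (n_as ! i).
      (if a = b then snd (n_as ! i) else if Suc a = b then 1 else 0) * w $ (?o i + b))"
    using i by simp
  also have "\<dots> = (\<Sum>b<fst (n_as ! i). (if b = a then snd (n_as ! i) * w $ (?o i + a) else 0) +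
      (if b = Suc a then w $ (?o i + Suc a) else 0))"
    by (rule sum.cong) auto
  also have "\<dots> = snd (n_as ! i) * w $ (?o i + a) +
      (if Suc a < fst (n_as ! i) then w $ (?o i + Suc a) else 0)"
    using i by (simp add: sum.distrib)
  finally show ?thesis .
qed

lemma D_mat_dims:
  "D_mat ds \<alpha> lam \<in> carrier_mat (sum_list ds) (sum_list ds)"
  using jordan_matrix_carrier[of "map (\<lambda>i. (ds ! i, \<alpha> - of_nat i * lam)) [0..<length ds]"]
  by (simp add: D_mat_def o_def map_nth)

lemma mult_D_mat_index:
  assumes "w \<in> carrier_vec (sum_list ds)" "i < length ds" "a < ds ! i"
  shows "(D_mat ds \<alpha> lam *\<^sub>v w) $ (block_offset ds i + a) =
    (\<alpha> - of_nat i * lam) * w $ (block_offset ds i + a) +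
    (if Suc a < ds ! i then w $ (block_offset ds i + Suc a) else 0)"
  using mult_jordan_matrix_index[of w "map (\<lambda>i. (ds ! i, \<alpha> - of_nat i * lam)) [0..<length ds]" i a] assms
  by (simp add: D_mat_def o_def map_nth)

text \<open>\<open>block_size\<close> makes the sum empty at the last block, where
  \<open>S ! i\<close> is out of range.\<close>

lemma mult_E_mat_index:
  fixes w :: "'k :: field vec"
  assumes len: "length ds = Suc (length S)" and w: "w \<in> carrier_vec (sum_list ds)"
    and i: "i < length ds" "a < ds ! i"
  shows "(E_mat ds S *\<^sub>v w) $ (block_offset ds i + a) =
    (\<Sum>c<block_size ds (Suc i). S ! i $$ (a, c) * w $ (block_offset ds (Suc i) + c))"
proof -
  let ?o = "block_offset ds"
  have E: "E_mat ds S \<in> carrier_mat (sum_list ds) (sum_list ds)" by (simp add: E_mat_def)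
  have entry: "E_mat ds S $$ (?o i + a, ?o j + b) = (if j = Suc i then S ! i $$ (a, b) else 0)"
    if j: "j < length ds" "b < ds ! j" for j b
  proof -
    have "E_mat ds S $$ (?o i + a, ?o j + b) =
        (\<Sum>i'<length S. if i' = i then if j = Suc i then S ! i $$ (a, b) else 0 else 0)"
    proof -
      have "E_mat ds S $$ (?o i + a, ?o j + b) = (\<Sum>i'<length S.
         if (?o i' \<le> ?o i + a \<and> ?o i + a < ?o (Suc i')) \<and>
            (?o (Suc i') \<le> ?o j + b \<and> ?o j + b < ?o (Suc (Suc i')))
         then S ! i' $$ (?o i + a - ?o i', ?o j + b - ?o (Suc i')) else 0)"
        using block_offset_less i j by (simp add: E_mat_def conj_assoc cong: if_cong)
      also have "\<dots> = (\<Sum>i'<length S. if i' = i then if j = Suc i then S ! i $$ (a, b) else 0 else 0)"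
      proof (rule sum.cong[OF refl])
        fix i' assume i': "i' \<in> {..<length S}"
        have "(?o i' \<le> ?o i + a \<and> ?o i + a < ?o (Suc i')) = (i = i')"
          "(?o (Suc i') \<le> ?o j + b \<and> ?o j + b < ?o (Suc (Suc i'))) = (j = Suc i')"
          using i' len i j by (auto simp: block_offset_interval_iff)
        then show "(if (?o i' \<le> ?o i + a \<and> ?o i + a < ?o (Suc i')) \<and>
            (?o (Suc i') \<le> ?o j + b \<and> ?o j + b < ?o (Suc (Suc i')))
         then S ! i' $$ (?o i + a - ?o i', ?o j + b - ?o (Suc i')) else 0) =
         (if i' = i then if j = Suc i then S ! i $$ (a, b) else 0 else 0)"
          by auto
      qed
      finally show ?thesis .
    qed
    then show ?thesis using j len by auto
  qed
  have "(E_mat ds S *\<^sub>v w) $ (?o i + a) =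
      (\<Sum>j<length ds. \<Sum>b<ds ! j. E_mat ds S $$ (?o i + a, ?o j + b) * w $ (?o j + b))"
    unfolding mult_mat_vec_index_sum[OF E w block_offset_less[OF i]] by (rule sum_block_offset)
  also have "\<dots> = (\<Sum>j<length ds. if j = Suc i then
      \<Sum>b<block_size ds (Suc i). S ! i $$ (a, b) * w $ (?o (Suc i) + b) else 0)"
    by (intro sum.cong refl) (auto simp: entry block_size_def intro!: sum.neutral sum.cong)
  also have "\<dots> = (\<Sum>c<block_size ds (Suc i). S ! i $$ (a, c) * w $ (?o (Suc i) + c))"
    by (simp add: block_size_def)
  finally show ?thesis .
qed

definition vec_coord :: "nat list \<Rightarrow> ('u \<Rightarrow> 'k :: zero vec) \<Rightarrow> nat \<Rightarrow> nat \<Rightarrow> 'u \<Rightarrow> 'k" where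
  "vec_coord ds f i a u = (if a < block_size ds i then f u $ (block_offset ds i + a) else 0)"

lemma jordan_coords_vec_coord:
  fixes sU :: "'k :: field \<Rightarrow> 'u :: ab_group_add \<Rightarrow> 'u"
  assumes sp: "vector_space sU" and pos: "0 \<notin> set ds" and f: "vec_iso sU (sum_list ds) f"
    and A: "\<And>u i a. i < length ds \<Longrightarrow> a < ds ! i \<Longrightarrow> f (A u) $ (block_offset ds i + a) =
      \<beta> i * f u $ (block_offset ds i + a) +
      (if Suc a < ds ! i then f u $ (block_offset ds i + Suc a) else 0)"
  shows "jordan_coords sU A (length ds) (block_size ds) \<beta> (vec_coord ds f)"
proof -
  interpret vector_space sU by (rule sp)
  note D = vec_isoD[OF f]
  have less: "block_offset ds i + a < sum_list ds" if "a < block_size ds i" for i a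
    using that block_offset_less[of i ds a] by (auto simp: block_size_def split: if_splits)
  have dims: "dim_vec (f u) = sum_list ds" for u using D(1)[of u] by simp
  show ?thesis
  proof
    show "0 < block_size ds i \<longleftrightarrow> i < length ds" for i
      using pos by (auto simp: block_size_def in_set_conv_nth)
    show "vec_coord ds f i a (u + w) = vec_coord ds f i a u + vec_coord ds f i a w" for i a u w
      using less[of a i] by (simp add: vec_coord_def D(2) dims)
    show "vec_coord ds f i a (sU k u) = k * vec_coord ds f i a u" for i a k u
      using less[of a i] by (simp add: vec_coord_def D(3) dims)
    show "vec_coord ds f i a u = 0" if "block_size ds i \<le> a" for i a u
      using that by (simp add: vec_coord_def)
    show "vec_coord ds f i a (A u) = \<beta> i * vec_coord ds f i a u + vec_coord ds f i (Suc a) u" for i a u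
      using A[of i a u] by (auto simp: vec_coord_def block_size_def)
    show "u = 0" if 0: "\<And>i a. vec_coord ds f i a u = 0" for u
    proof -
      have "f u = f 0"
      proof (rule eq_block_vecI[OF D(1) D(1)])
        fix i a assume ia: "i < length ds" "a < ds ! i"
        have "f (sU 0 0) = 0 \<cdot>\<^sub>v f 0" by (rule D(3))
        then have "f 0 = 0 \<cdot>\<^sub>v f 0" by simp
        then have "f 0 $ (block_offset ds i + a) = 0"
          using block_offset_less[OF ia] dims[of 0] by (metis index_smult_vec(1) mult_zero_left)
        then show "f u $ (block_offset ds i + a) = f 0 $ (block_offset ds i + a)"
          using 0[of i a] ia by (simp add: vec_coord_def block_size_def)
      qed
      then show ?thesis using D(4) by simp
    qed
    show "\<exists>u. \<forall>i. \<forall>a<block_size ds i. vec_coord ds f i a u = y i a" for y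
    proof -
      obtain u where "f u = block_vec ds y" using D(5)[OF block_vec_carrier] by blast
      then show ?thesis
        by (intro exI[of _ u]) (auto simp: vec_coord_def block_vec_index block_size_def split: if_splits)
    qed
  qed
qed

lemma block_coords_vec_coord:
  fixes sU :: "'k :: field_char_0 \<Rightarrow> 'u :: ab_group_add \<Rightarrow> 'u"
  assumes sp: "vector_space sU" and lam: "lam \<noteq> 0" and S: "block_data ds S"
    and f: "vec_iso sU (sum_list ds) f"
    and A: "\<And>u. f (A u) = D_mat ds \<alpha> lam *\<^sub>v f u" and E: "\<And>u. f (E u) = E_mat ds S *\<^sub>v f u"
  shows "block_coords sU A (length ds) (block_size ds) \<alpha> lam (vec_coord ds f) E (\<lambda>i a c. S ! i $$ (a, c))"
proof -
  note D = vec_isoD[OF f]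
  have pos: "0 \<notin> set ds" and len: "length ds = Suc (length S)" using S by (auto simp: block_data_def)
  interpret jordan_coords sU A "length ds" "block_size ds" "\<lambda>i. \<alpha> - of_nat i * lam" "vec_coord ds f"
    by (rule jordan_coords_vec_coord[OF sp pos f]) (simp add: A mult_D_mat_index[OF D(1)])
  show ?thesis
  proof
    show "vec_coord ds f i a (E u) =
        (\<Sum>c<block_size ds (Suc i). S ! i $$ (a, c) * vec_coord ds f (Suc i) c u)"
      if a: "a < block_size ds i" for i a u
    proof -
      have i: "i < length ds" "a < ds ! i" using a by (auto simp: block_size_def split: if_splits)
      show ?thesis
        using a unfolding vec_coord_def E mult_E_mat_index[OF len D(1) i] by (auto intro!: sum.cong)
    qed
  qed (fact lam)
qed

text \<open>Converse of \<open>block_coords_vec_coord\<close>: listing coordinates block after block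
  realizes A and E by the prescribed matrices.\<close>

lemma vec_iso_block_vec:
  fixes sU :: "'k :: field_char_0 \<Rightarrow> 'u :: ab_group_add \<Rightarrow> 'u"
  assumes b: "block_coords sU A (length ds) (block_size ds) \<alpha> lam x E (\<lambda>i a c. S ! i $$ (a, c))"
    and S: "block_data ds S"
  defines "f \<equiv> \<lambda>u. block_vec ds (\<lambda>i a. x i a u)"
  shows "vec_iso sU (sum_list ds) f" "f (A u) = D_mat ds \<alpha> lam *\<^sub>v f u"
    "f (E u) = E_mat ds S *\<^sub>v f u"
proof -
  interpret block_coords sU A "length ds" "block_size ds" \<alpha> lam x E "\<lambda>i a c. S ! i $$ (a, c)"
    by (rule b)
  have len: "length ds = Suc (length S)" using S by (auto simp: block_data_def)
  have car: "f u \<in> carrier_vec (sum_list ds)" for u by (simp add: f_def)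
  have dims: "dim_vec (f u) = sum_list ds" for u by (simp add: f_def block_vec_def)
  have ix: "f u $ (block_offset ds i + a) = x i a u" if "i < length ds" "a < ds ! i" for i a u
    using that by (simp add: f_def block_vec_index)
  have less: "block_offset ds i + a < sum_list ds" if "i < length ds" "a < ds ! i" for i a
    by (rule block_offset_less[OF that])
  have "bij_betw f UNIV (carrier_vec (sum_list ds))"
    unfolding bij_betw_def
  proof
    show "inj f"
    proof (rule injI, rule x_eqI)
      fix u w i a assume eq: "f u = f w"
      show "x i a u = x i a w"
      proof (cases "a < block_size ds i")
        case True
        then show ?thesis using ix[of i a u] ix[of i a w] eq by (auto simp: block_size_def split: if_splits)
      qed (simp add: x_out)
    qed
    show "range f = carrier_vec (sum_list ds)"
    proof (intro equalityI subsetI)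
      fix w :: "'k vec" assume w: "w \<in> carrier_vec (sum_list ds)"
      obtain u where u: "\<forall>i. \<forall>a<block_size ds i. x i a u = w $ (block_offset ds i + a)"
        using x_surj[of "\<lambda>i a. w $ (block_offset ds i + a)"] by blast
      have "f u = w"
        by (rule eq_block_vecI[OF car w]) (use u in \<open>simp add: ix block_size_def\<close>)
      then show "w \<in> range f" by blast
    qed (use car in auto)
  qed
  moreover have "f (u + w) = f u + f w" for u w
    by (rule eq_block_vecI[of _ ds]) (use car in \<open>simp_all add: ix x_add dims less\<close>)
  moreover have "f (sU k u) = k \<cdot>\<^sub>v f u" for k u
    by (rule eq_block_vecI[of _ ds]) (use car in \<open>simp_all add: ix x_scale dims less\<close>)
  ultimately show "vec_iso sU (sum_list ds) f" by (simp add: vec_iso_def)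
  show "f (A u) = D_mat ds \<alpha> lam *\<^sub>v f u"
  proof (rule eq_block_vecI[OF car mult_mat_vec_carrier[OF D_mat_dims car]])
    fix i a assume i: "i < length ds" "a < ds ! i"
    show "f (A u) $ (block_offset ds i + a) = (D_mat ds \<alpha> lam *\<^sub>v f u) $ (block_offset ds i + a)"
      using i x_out[of i "Suc a" u] ix[of i "Suc a" u] by (simp add: mult_D_mat_index[OF car i] ix x_A block_size_def)
  qed
  have E: "E_mat ds S \<in> carrier_mat (sum_list ds) (sum_list ds)" by (simp add: E_mat_def)
  show "f (E u) = E_mat ds S *\<^sub>v f u"
  proof (rule eq_block_vecI[OF car mult_mat_vec_carrier[OF E car]])
    fix i a assume i: "i < length ds" "a < ds ! i"
    have "f (E u) $ (block_offset ds i + a) = (\<Sum>c<block_size ds (Suc i). S ! i $$ (a, c) * x (Suc i) c u)"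
      using i x_E[of a i u] by (simp add: ix block_size_def)
    also have "\<dots> = (E_mat ds S *\<^sub>v f u) $ (block_offset ds i + a)"
      unfolding mult_E_mat_index[OF len car i] by (intro sum.cong refl) (auto simp: ix block_size_def split: if_splits)
    finally show "f (E u) $ (block_offset ds i + a) = (E_mat ds S *\<^sub>v f u) $ (block_offset ds i + a)" .
  qed
qed

lemma normalized_iff_normalized_blocks:
  assumes "block_data ds S"
  shows "normalized ds S \<longleftrightarrow> normalized_blocks (length ds) (block_size ds) (\<lambda>i a c. S ! i $$ (a, c))"
proof -
  have len: "length ds = Suc (length S)" "0 < length S" using assms by (auto simp: block_data_def)
  then show ?thesis
    unfolding normalized_def normalized_blocks_def block_size_def
    by (simp add: numeral_2_eq_2)
qed

section \<open>Representations of the semidirect product\<close>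

text \<open>The degree one component, used to see that \<open>V\<close> embeds into the free Lie algebra.\<close>

primrec lie_term_linear :: "('k \<Rightarrow> 'v \<Rightarrow> 'v) \<Rightarrow> ('k, 'v) lie_term \<Rightarrow> 'v :: ab_group_add" where
  "lie_term_linear s (Gen v) = v"
| "lie_term_linear s Zero = 0"
| "lie_term_linear s (Add a b) = lie_term_linear s a + lie_term_linear s b"
| "lie_term_linear s (Smul k a) = s k (lie_term_linear s a)"
| "lie_term_linear s (Brk a b) = 0"

lemma lie_class_Gen_eq_Zero_iff:
  assumes "vector_space s"
  shows "lie_class s (Gen v) = lie_class s Zero \<longleftrightarrow> v = 0"
proof -
  interpret vector_space s by (rule assms)
  \<comment> \<open>With all brackets sent to 0, V is an abelian Lie algebra, in which every rule of
    the congruence holds.\<close>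
  have "lie_term_linear s a = lie_term_linear s b" if "lie_eq s a b" for a b
    using that
    by (induction rule: lie_eq.induct)
      (simp_all add: algebra_simps scale_left_distrib scale_right_distrib)
  then have "v = 0" if "lie_eq s (Gen v) Zero" using that by fastforce
  moreover have "lie_eq s (Gen 0) Zero"
  proof -
    interpret L: lie_algebra "free_lie s" by (rule lie_algebra_free_lie)
    have "lie_class s (Gen (s 0 0)) = 0 \<odot>\<^bsub>free_lie s\<^esub> lie_class s (Gen 0)"
      by (rule lie_class_Gen_linear(2))
    also have "\<dots> = \<zero>\<^bsub>free_lie s\<^esub>"
      using L.smult_l_null[of "lie_class s (Gen 0)"] by (simp add: free_lie_simps class_ring_simps)
    finally show ?thesis by (simp add: free_lie_simps lie_class_eq_iff)
  qed
  ultimately show ?thesis by (auto simp: lie_class_eq_iff)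
qed

lemma galg_simps:
  assumes X: "Vector_Spaces.linear s s X"
  shows "(a, lie_class s y) \<in> carrier (galg s X)"
    "(a, lie_class s y) \<oplus>\<^bsub>galg s X\<^esub> (b, lie_class s z) = (a + b, lie_class s (Add y z))"
    "k \<odot>\<^bsub>galg s X\<^esub> (a, lie_class s y) = (k * a, lie_class s (Smul k y))"
    "bracket (galg s X) (a, lie_class s y) (b, lie_class s z) =
      (0, lie_class s (Add (Add (Smul a (term_derivation X z)) (Smul (- b) (term_derivation X y))) (Brk y z)))"
    "\<zero>\<^bsub>galg s X\<^esub> = (0, lie_class s Zero)"
  by (simp_all add: galg_def semidirect_def free_lie_simps free_derivation_class[OF X])

lemma galg_cases:
  assumes "y \<in> carrier (galg s X)"
  obtains a t where "y = (a, lie_class s t)"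
  using assms by (auto simp: galg_def semidirect_def free_lie_simps)

locale galg_rep = U: vector_space sU
  for sU :: "'k :: field_char_0 \<Rightarrow> 'u :: ab_group_add \<Rightarrow> 'u" +
  fixes sV :: "'k \<Rightarrow> 'v :: ab_group_add \<Rightarrow> 'v"
    and T :: "'k \<times> ('k, 'v) lie_term set \<Rightarrow> 'u \<Rightarrow> 'u"
    and v :: "nat \<Rightarrow> 'v" and n :: nat and lam :: 'k and X :: "'v \<Rightarrow> 'v"
  assumes n: "n \<ge> 2" and lam: "lam \<noteq> 0"
    and V: "vector_space sV"
    and span: "Modules.module.span sV (v ` {..<n}) = UNIV"
    and X: "Vector_Spaces.linear sV sV X"
      "\<And>j. j < n - 1 \<Longrightarrow> X (v j) = sV lam (v j) + v (j + 1)"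
      "X (v (n - 1)) = sV lam (v (n - 1))"
    and T: "T \<in> lie_hom (galg sV X) (gl_space sU)"
begin

abbreviation "A \<equiv> T (g_x sV)"

text \<open>T on the free Lie algebra, read on terms so that structural induction applies.\<close>

definition tau :: "('k, 'v) lie_term \<Rightarrow> 'u \<Rightarrow> 'u" where
  "tau t = T (0, lie_class sV t)"

text \<open>The cut-off value 0 agrees with the last line of the Jordan block:
  \<open>X - lam\<close> kills \<open>v (n - 1)\<close>.\<close>

definition Es :: "nat \<Rightarrow> 'u \<Rightarrow> 'u" where
  "Es j = (if j < n then T (g_V sV (v j)) else (\<lambda>u. 0))"

lemma T_linear:
  assumes "y \<in> carrier (galg sV X)"
  shows "T y (u + w) = T y u + T y w" "T y (sU k u) = sU k (T y u)"
proof -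
  have "Vector_Spaces.linear sU sU (T y)"
    using T assms by (auto simp: lie_hom_def gl_space_def Pi_iff)
  then interpret l: Vector_Spaces.linear sU sU "T y" .
  show "T y (u + w) = T y u + T y w" "T y (sU k u) = sU k (T y u)"
    by (rule l.add l.scale)+
qed

lemma T_hom:
  assumes "y \<in> carrier (galg sV X)" "z \<in> carrier (galg sV X)"
  shows "T (y \<oplus>\<^bsub>galg sV X\<^esub> z) u = T y u + T z u" "T (k \<odot>\<^bsub>galg sV X\<^esub> y) u = sU k (T y u)"
    "T (bracket (galg sV X) y z) u = T y (T z u) - T z (T y u)"
  using T assms by (simp_all add: lie_hom_def gl_space_def)

lemmas gs = galg_simps[OF X(1)]

lemma tau_simps:
  "tau (Add y z) u = tau y u + tau z u"
  "tau (Smul k y) u = sU k (tau y u)"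
  "tau Zero u = 0"
  "tau (Brk y z) u = tau y (tau z u) - tau z (tau y u)"
  "tau t (u + w) = tau t u + tau t w"
  "tau t (sU k u) = sU k (tau t u)"
proof -
  show add: "tau (Add y z) u = tau y u + tau z u" for y z u
    using T_hom(1)[OF gs(1,1), of 0 y 0 z u] by (simp add: gs tau_def)
  show smul: "tau (Smul k y) u = sU k (tau y u)" for k y u
    using T_hom(2)[OF gs(1) gs(1), of k 0 y u] by (simp add: gs tau_def)
  have "lie_class sV (Add Zero Zero) = lie_class sV Zero"
    by (simp add: lie_class_eq_iff lie_eq.Add_Zero)
  then have "tau (Add Zero Zero) u = tau Zero u" for u by (simp add: tau_def)
  then show "tau Zero u = 0" for u by (simp add: add)
  show "tau (Brk y z) u = tau y (tau z u) - tau z (tau y u)"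
  proof -
    have "tau (Add (Add (Smul 0 (term_derivation X z)) (Smul (- 0) (term_derivation X y))) (Brk y z)) u =
        tau y (tau z u) - tau z (tau y u)"
      using T_hom(3)[OF gs(1,1), of 0 y 0 z u] unfolding gs tau_def .
    then show ?thesis by (simp add: add smul)
  qed
  show "tau t (u + w) = tau t u + tau t w" "tau t (sU k u) = sU k (tau t u)"
    unfolding tau_def by (rule T_linear[OF gs(1)])+
qed

lemma g_x_eq: "g_x sV = (1, lie_class sV Zero)"
  by (simp add: g_x_def free_lie_simps)

lemma T_decompose: "T (a, lie_class sV t) u = sU a (A u) + tau t u"
proof -
  interpret L: lie_algebra "free_lie sV" by (rule lie_algebra_free_lie)
  have "lie_class sV (Add (Smul a Zero) t) = a \<odot>\<^bsub>free_lie sV\<^esub> \<zero>\<^bsub>free_lie sV\<^esub> \<oplus>\<^bsub>free_lie sV\<^esub> lie_class sV t"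
    by (simp add: free_lie_simps)
  also have "a \<odot>\<^bsub>free_lie sV\<^esub> \<zero>\<^bsub>free_lie sV\<^esub> = \<zero>\<^bsub>free_lie sV\<^esub>"
    using L.smult_r_null[of a] by (simp add: class_ring_simps)
  also have "\<zero>\<^bsub>free_lie sV\<^esub> \<oplus>\<^bsub>free_lie sV\<^esub> lie_class sV t = lie_class sV t"
    by (rule L.l_zero) (simp add: free_lie_simps)
  finally have "(a, lie_class sV t) = (a, lie_class sV (Smul a Zero)) \<oplus>\<^bsub>galg sV X\<^esub> (0, lie_class sV t)"
    by (simp add: gs)
  moreover have "(a, lie_class sV (Smul a Zero)) = a \<odot>\<^bsub>galg sV X\<^esub> g_x sV"
    by (simp add: g_x_eq gs)
  ultimately show ?thesis
    using T_hom(1)[OF gs(1) gs(1), of a "Smul a Zero" 0 t u]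
      T_hom(2)[OF gs(1) gs(1), of a 1 Zero u]
    by (simp add: g_x_eq tau_def)
qed

lemma A_linear: "A (u + w) = A u + A w" "A (sU k u) = sU k (A u)"
  unfolding g_x_eq by (rule T_linear[OF gs(1)])+

lemma A_tau: "A (tau t u) - tau t (A u) = tau (term_derivation X t) u"
proof -
  have "tau (Add (Add (Smul 1 (term_derivation X t)) (Smul (- 0) (term_derivation X Zero))) (Brk Zero t)) u =
      A (tau t u) - tau t (A u)"
    using T_hom(3)[OF gs(1,1), of 1 Zero 0 t u] unfolding gs tau_def g_x_eq .
  then show ?thesis
    by (simp add: tau_simps) (use tau_simps(6)[of t 0 0] in simp)
qed

lemma tau_Gen_add: "tau (Gen (w + w')) u = tau (Gen w) u + tau (Gen w') u"
  unfolding tau_simps(1)[symmetric] unfolding tau_def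
  by (simp add: lie_class_Gen_linear(1) free_lie_simps)

lemma tau_Gen_scale: "tau (Gen (sV k w)) u = sU k (tau (Gen w) u)"
  unfolding tau_simps(2)[symmetric] unfolding tau_def
  by (simp add: lie_class_Gen_linear(2) free_lie_simps)

lemma Es_eq: "Es j u = (if j < n then tau (Gen (v j)) u else 0)"
  by (simp add: Es_def tau_def g_V_def)

sublocale ad_chain sU A Es lam n
proof
  show "Es j (u + w) = Es j u + Es j w" for j u w by (simp add: Es_eq tau_simps)
  show "Es j (sU k u) = sU k (Es j u)" for j k u by (simp add: Es_eq tau_simps)
  show "Es j u = 0" if "n \<le> j" for j u using that by (simp add: Es_eq)
  show "Es (Suc j) u = A (Es j u) - Es j (A u) - sU lam (Es j u)" for j u
  proof -
    have A0: "A 0 = 0" using A_linear(2)[of 0 0] by simp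
    consider "j < n - 1" | "j = n - 1" | "n \<le> j" by linarith
    then show ?thesis
    proof cases
      case 1
      then have j: "j < n" "Suc j < n" by auto
      from 1 have "A (Es j u) - Es j (A u) = tau (Gen (sV lam (v j) + v (j + 1))) u"
        using A_tau[of "Gen (v j)" u] X(2)[OF 1] j by (simp add: Es_eq)
      then show ?thesis using j by (simp add: tau_Gen_add tau_Gen_scale Es_eq)
    next
      case 2
      then have "A (Es j u) - Es j (A u) = tau (Gen (sV lam (v j))) u"
        using A_tau[of "Gen (v j)" u] X(3) n by (simp add: Es_eq)
      then show ?thesis using 2 n by (simp add: tau_Gen_scale Es_eq)
    next
      case 3
      then show ?thesis by (simp add: Es_eq A0)
    qed
  qed
qed (rule lam)

text \<open>x and \<open>v 0\<close> generate: \<open>Es_Suc\<close> recovers every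
  \<open>v j\<close>, linearity all of V, and induction on terms the free Lie algebra. This reduces
  uniseriality to the two operators A and \<open>Es 0\<close>.\<close>

lemma invariant_subspace_iff:
  "invariant_subspace (galg sV X) sU T W \<longleftrightarrow> U.subspace W \<and> (\<forall>w\<in>W. A w \<in> W \<and> Es 0 w \<in> W)"
proof (intro iffI conjI)
  assume "invariant_subspace (galg sV X) sU T W"
  then show "U.subspace W" "\<forall>w\<in>W. A w \<in> W \<and> Es 0 w \<in> W"
    using n by (auto simp: invariant_subspace_def g_x_eq gs Es_def g_V_def)
next
  assume *: "U.subspace W \<and> (\<forall>w\<in>W. A w \<in> W \<and> Es 0 w \<in> W)"
  then have sub: "U.subspace W" and inv: "\<And>w. w \<in> W \<Longrightarrow> A w \<in> W" "\<And>w. w \<in> W \<Longrightarrow> Es 0 w \<in> W"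
    by auto
  have Es_W: "Es j w \<in> W" if "w \<in> W" for j w
    using that
  proof (induction j arbitrary: w)
    case (Suc j)
    then show ?case
      unfolding Es_Suc by (intro U.subspace_diff[OF sub] U.subspace_scale[OF sub] inv Suc.IH)
  qed (use inv in auto)
  have Gen_W: "tau (Gen z) w \<in> W" if w: "w \<in> W" for z w
  proof -
    interpret V: vector_space sV by (rule V)
    have z: "z \<in> V.span (v ` {..<n})" unfolding span by simp
    show ?thesis
      using z
    proof (induction rule: V.span_induct_alt)
      case base
      have "tau (Gen (sV 0 0)) w = 0" unfolding tau_Gen_scale by simp
      then show ?case using U.subspace_0[OF sub] by simp
    next
      case (step c x y)
      then obtain j where j: "j < n" "x = v j" by auto
      have "tau (Gen x) w \<in> W" using Es_W[OF w, of j] j by (simp add: Es_eq)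
      then show ?case unfolding tau_Gen_add tau_Gen_scale
        using step by (intro U.subspace_add[OF sub] U.subspace_scale[OF sub])
    qed
  qed
  have tau_W: "tau t w \<in> W" if "w \<in> W" for t w
    using that
    by (induction t arbitrary: w)
      (auto simp: tau_simps Gen_W intro: U.subspace_0[OF sub] U.subspace_add[OF sub]
        U.subspace_scale[OF sub] U.subspace_diff[OF sub])
  show "invariant_subspace (galg sV X) sU T W"
    unfolding invariant_subspace_def
  proof (intro conjI ballI sub)
    fix y w assume "y \<in> carrier (galg sV X)" "w \<in> W"
    then show "T y w \<in> W"
      by (elim galg_cases) (auto simp: T_decompose intro!: U.subspace_add[OF sub]
        U.subspace_scale[OF sub] inv tau_W)
  qed
qed

lemma uniserial_iff: "uniserial (galg sV X) sU T \<longleftrightarrow> uniserial_pair sU A (Es 0)"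
  unfolding uniserial_def uniserial_pair_def invariant_subspace_iff by blast

text \<open>\<open>v (n - 1)\<close> is nonzero in the free Lie algebra because V embeds there, so
  faithfulness on V makes it act nontrivially. This feeds the lower bound for the block
  sizes.\<close>

lemma Es_last_nonzero:
  assumes indep: "\<not> Modules.module.dependent sV (v ` {..<n})"
    and faithful: "rep_kernel (galg sV X) T \<inter> range (g_V sV) = {\<zero>\<^bsub>galg sV X\<^esub>}"
  obtains u where "Es (n - 1) u \<noteq> 0"
proof -
  interpret V: vector_space sV by (rule V)
  have "v (n - 1) \<in> v ` {..<n}" using n by simp
  then have "v (n - 1) \<noteq> 0" using indep V.dependent_zero[of "v ` {..<n}"] by metis
  then have "g_V sV (v (n - 1)) \<noteq> \<zero>\<^bsub>galg sV X\<^esub>"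
    using lie_class_Gen_eq_Zero_iff[OF V] by (simp add: g_V_def gs)
  then have "g_V sV (v (n - 1)) \<notin> rep_kernel (galg sV X) T" using faithful by blast
  then have "T (g_V sV (v (n - 1))) \<noteq> (\<lambda>u. 0)"
    by (simp add: rep_kernel_def g_V_def gs)
  then show ?thesis using that n by (auto simp: Es_def fun_eq_iff)
qed

text \<open>R is T transported along \<open>f\<close>; since an operator has only one matrix, each
  identity for R follows from the one for T. The values at \<open>v j\<close> come from those at x
  and \<open>v 0\<close> through \<open>Es_Suc\<close>.\<close>

lemma R_rep_exists:
  assumes f: "vec_iso sU (sum_list ds) f"
    and fA: "\<And>u. f (A u) = D_mat ds \<alpha> lam *\<^sub>v f u" and fE: "\<And>u. f (Es 0 u) = E_mat ds S *\<^sub>v f u"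
  shows "\<exists>R. is_R_rep sV X n v lam ds \<alpha> S R \<and>
    isomorphic_to_matrix_rep (galg sV X) sU T (sum_list ds) R"
proof -
  let ?d = "sum_list ds" and ?G = "galg sV X"
  note D = vec_isoD[OF f]
  have "\<exists>M. M \<in> carrier_mat ?d ?d \<and> (\<forall>u. f (T y u) = M *\<^sub>v f u)" if "y \<in> carrier ?G" for y
    using matrix_of_linear[OF f T_linear[OF that]] by metis
  then obtain R where R: "\<And>y. y \<in> carrier ?G \<Longrightarrow> R y \<in> carrier_mat ?d ?d"
      "\<And>y u. y \<in> carrier ?G \<Longrightarrow> f (T y u) = R y *\<^sub>v f u"
    by metis
  have R_eq: "R y = M" if "y \<in> carrier ?G" "M \<in> carrier_mat ?d ?d" "\<And>u. f (T y u) = M *\<^sub>v f u" for y M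
    by (rule matrix_on_vec_iso_unique[OF f R(1) that(2)]) (use that R(2) in auto)
  have closed: "y \<oplus>\<^bsub>?G\<^esub> z \<in> carrier ?G" "k \<odot>\<^bsub>?G\<^esub> y \<in> carrier ?G" "bracket ?G y z \<in> carrier ?G"
    if "y \<in> carrier ?G" "z \<in> carrier ?G" for y z k
    using that by (auto elim!: galg_cases simp: gs)
  have comm: "f (F (H u) - H (F u)) = (M * N - N * M) *\<^sub>v f u"
    if "M \<in> carrier_mat ?d ?d" "N \<in> carrier_mat ?d ?d" "\<And>u. f (F u) = M *\<^sub>v f u" "\<And>u. f (H u) = N *\<^sub>v f u"
    for F H M N u
    using that(1,2) D(1)[of u]
    by (simp add: vec_iso_diff[OF f] that(3,4) minus_mult_distrib_mat_vec[of _ ?d ?d]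
        assoc_mult_mat_vec[of _ ?d ?d _ ?d])
  have smult: "f (sU k (F u)) = (k \<cdot>\<^sub>m M) *\<^sub>v f u"
    if "M \<in> carrier_mat ?d ?d" "\<And>u. f (F u) = M *\<^sub>v f u" for k F M u
    using that D(1)[of u] by (auto simp: D(3))
  have hom: "R \<in> lie_hom ?G (gl_mat ?d)"
    unfolding lie_hom_def gl_mat_def
  proof (simp, intro conjI ballI allI)
    show "R \<in> carrier ?G \<rightarrow> carrier_mat ?d ?d" using R(1) by blast
  next
    fix y z assume yz: "y \<in> carrier ?G" "z \<in> carrier ?G"
    show "R (y \<oplus>\<^bsub>?G\<^esub> z) = R y + R z"
      using R(1)[OF yz(1)] R(1)[OF yz(2)] D(1)
      by (intro R_eq closed yz) (auto simp: T_hom[OF yz] D(2) R(2) yz add_mult_distrib_mat_vec[of _ ?d ?d])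
    show "R (bracket ?G y z) = R y * R z - R z * R y"
      using R(1)[OF yz(1)] R(1)[OF yz(2)]
      by (intro R_eq closed yz) (auto simp: T_hom[OF yz] R(2) yz intro!: comm)
  next
    fix k y assume y: "y \<in> carrier ?G"
    show "R (k \<odot>\<^bsub>?G\<^esub> y) = k \<cdot>\<^sub>m R y"
      using R(1)[OF y]
      by (intro R_eq closed(2)[OF y y]) (auto simp: T_hom(2)[OF y y] R(2) y intro!: smult)
  qed
  have Dc: "D_mat ds \<alpha> lam \<in> carrier_mat ?d ?d" by (rule D_mat_dims)
  have Rx: "R (g_x sV) = D_mat ds \<alpha> lam"
    by (rule R_eq) (simp_all add: g_x_eq gs Dc fA[unfolded g_x_eq])
  let ?ad = "\<lambda>M. D_mat ds \<alpha> lam * M - M * D_mat ds \<alpha> lam - lam \<cdot>\<^sub>m M"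
  have pow: "(?ad ^^ j) (E_mat ds S) \<in> carrier_mat ?d ?d \<and> (\<forall>u. f (Es j u) = (?ad ^^ j) (E_mat ds S) *\<^sub>v f u)" for j
  proof (induction j)
    case 0
    show ?case by (simp add: fE E_mat_def)
  next
    case (Suc j)
    define M where "M = (?ad ^^ j) (E_mat ds S)"
    have M: "M \<in> carrier_mat ?d ?d" "\<And>u. f (Es j u) = M *\<^sub>v f u" using Suc by (auto simp: M_def)
    have MM: "D_mat ds \<alpha> lam * M - M * D_mat ds \<alpha> lam \<in> carrier_mat ?d ?d" "lam \<cdot>\<^sub>m M \<in> carrier_mat ?d ?d"
      using M(1) Dc by auto
    have "f (Es (Suc j) u) = ?ad M *\<^sub>v f u" for u
    proof -
      have "f (Es (Suc j) u) = f (A (Es j u) - Es j (A u)) - f (sU lam (Es j u))"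
        unfolding Es_Suc by (rule vec_iso_diff[OF f])
      also have "f (A (Es j u) - Es j (A u)) = (D_mat ds \<alpha> lam * M - M * D_mat ds \<alpha> lam) *\<^sub>v f u"
        by (rule comm[OF Dc M(1) fA M(2)])
      also have "f (sU lam (Es j u)) = (lam \<cdot>\<^sub>m M) *\<^sub>v f u" by (rule smult[OF M])
      finally show ?thesis by (simp add: minus_mult_distrib_mat_vec[OF MM D(1)])
    qed
    then show ?case using minus_carrier_mat[OF MM(2)] by (simp add: M_def[symmetric])
  qed
  have "R (g_V sV (v j)) = (?ad ^^ j) (E_mat ds S)" if "j < n" for j
    by (rule R_eq) (use pow[of j] that in \<open>simp_all add: g_V_def gs Es_def\<close>)
  then have "is_R_rep sV X n v lam ds \<alpha> S R"
    using hom Rx by (simp add: is_R_rep_def)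
  moreover have "isomorphic_to_matrix_rep ?G sU T ?d R"
    unfolding isomorphic_to_matrix_rep_def using f R(2) by (intro exI[of _ f]) (auto simp: vec_iso_def)
  ultimately show ?thesis by blast
qed

lemma R_rep_block_coords:
  assumes S: "block_data ds S" and R: "is_R_rep sV X n v lam ds \<alpha> S R"
    and iso: "isomorphic_to_matrix_rep (galg sV X) sU T (sum_list ds) R"
  shows "\<exists>x. block_coords sU A (length ds) (block_size ds) \<alpha> lam x (Es 0) (\<lambda>i a c. S ! i $$ (a, c))"
proof -
  obtain f where f: "vec_iso sU (sum_list ds) f"
      "\<And>y u. y \<in> carrier (galg sV X) \<Longrightarrow> f (T y u) = R y *\<^sub>v f u"
    using iso unfolding isomorphic_to_matrix_rep_def vec_iso_def by blast
  have "f (A u) = D_mat ds \<alpha> lam *\<^sub>v f u" for u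
    using f(2)[of "g_x sV" u] R by (simp add: g_x_eq gs is_R_rep_def)
  moreover have "f (Es 0 u) = E_mat ds S *\<^sub>v f u" for u
  proof -
    have "R (g_V sV (v 0)) = E_mat ds S" using R n by (auto simp: is_R_rep_def dest: spec[of _ 0])
    then show ?thesis using f(2)[of "g_V sV (v 0)" u] n by (simp add: g_V_def gs Es_def)
  qed
  ultimately show ?thesis
    using block_coords_vec_coord[OF U.vector_space_axioms lam S f(1)] by blast
qed

text \<open>Both isomorphisms start from the same U, so they give two coordinate systems for one
  pair of operators, and the comparison of coordinates applies directly.\<close>

lemma normalized_R_rep_unique:
  assumes S: "block_data ds S" "normalized ds S"
    and S': "block_data ds' S'" "normalized ds' S'"
    and R: "is_R_rep sV X n v lam ds \<alpha> S R" "isomorphic_to_matrix_rep (galg sV X) sU T (sum_list ds) R"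
    and R': "is_R_rep sV X n v lam ds' \<alpha>' S' R'" "isomorphic_to_matrix_rep (galg sV X) sU T (sum_list ds') R'"
  shows "ds = ds' \<and> \<alpha> = \<alpha>' \<and> S = S'"
proof -
  have len: "length ds = Suc (length S)" "length ds' = Suc (length S')" "2 \<le> length ds"
    using S(1) S'(1) by (auto simp: block_data_def)
  obtain x where x: "block_coords sU A (length ds) (block_size ds) \<alpha> lam x (Es 0) (\<lambda>i a c. S ! i $$ (a, c))"
    using R_rep_block_coords[OF S(1) R] by blast
  obtain x' where x': "block_coords sU A (length ds') (block_size ds') \<alpha>' lam x' (Es 0) (\<lambda>i a c. S' ! i $$ (a, c))"
    using R_rep_block_coords[OF S'(1) R'] by blast
  interpret t: two_block_coords sU A "length ds" "block_size ds" \<alpha> lam x "Es 0" "\<lambda>i a c. S ! i $$ (a, c)"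
    "length ds'" "block_size ds'" \<alpha>' x' "\<lambda>i a c. S' ! i $$ (a, c)"
    by (rule two_block_coords.intro[OF x x'])
  have eq: "\<alpha> = \<alpha>'" "length ds = length ds'" "block_size ds = block_size ds'"
    using t.same_shape len by auto
  have ds: "ds = ds'"
  proof (rule nth_equalityI[OF eq(2)])
    fix i assume "i < length ds"
    then show "ds ! i = ds' ! i" using fun_cong[OF eq(3), of i] eq(2) by (simp add: block_size_def)
  qed
  interpret s: same_shape_coords sU A "length ds" "block_size ds" \<alpha> lam x "Es 0" "\<lambda>i a c. S ! i $$ (a, c)"
    x' "\<lambda>i a c. S' ! i $$ (a, c)"
    by (rule same_shape_coords.intro[OF x x'[folded eq] same_shape_coords_axioms.intro[OF len(3)]])
  have "S = S'"
  proof (rule nth_equalityI)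
    show "length S = length S'" using len ds by simp
  next
    fix i assume i: "i < length S"
    have car: "S ! i \<in> carrier_mat (ds ! i) (ds ! (i + 1))" "S' ! i \<in> carrier_mat (ds ! i) (ds ! (i + 1))"
      using S(1) S'(1) i len ds by (auto simp: block_data_def)
    show "S ! i = S' ! i"
    proof (rule eq_matI)
      fix a c assume "a < dim_row (S' ! i)" "c < dim_col (S' ! i)"
      then have ac: "a < ds ! i" "c < ds ! (i + 1)" using car by auto
      show "S ! i $$ (a, c) = S' ! i $$ (a, c)"
        by (rule s.S_unique)
          (use S(2) S'(2) S(1) S'(1) ds i len ac in
            \<open>auto simp: normalized_iff_normalized_blocks block_size_def\<close>)
    qed (use car in auto)
  qed
  then show ?thesis using ds eq by simp
qed

end

lemma block_coords_lists:
  fixes sU :: "'k :: field_char_0 \<Rightarrow> 'u :: ab_group_add \<Rightarrow> 'u"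
  assumes b: "block_coords sU A L d \<alpha> lam x E S" and N: "normalized_blocks L d S" and L: "2 \<le> L"
  obtains ds Ss where "block_data ds Ss" "normalized ds Ss" "length ds = L" "length Ss = L - 1"
    "\<And>i. i < L \<Longrightarrow> ds ! i = d i" "block_size ds = d"
    "block_coords sU A (length ds) (block_size ds) \<alpha> lam x E (\<lambda>i a c. Ss ! i $$ (a, c))"
proof -
  interpret block_coords sU A L d \<alpha> lam x E S by (rule b)
  define ds where "ds = map d [0..<L]"
  define Ss where "Ss = map (\<lambda>i. mat (d i) (d (Suc i)) (\<lambda>(a, c). S i a c)) [0..<L - 1]"
  have ds: "length ds = L" "\<And>i. i < L \<Longrightarrow> ds ! i = d i" by (simp_all add: ds_def)
  have bs: "block_size ds = d" using d_eq_0_iff by (auto simp: block_size_def ds)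
  have Ss: "length Ss = L - 1" "\<And>i. Suc i < L \<Longrightarrow> Ss ! i = mat (d i) (d (Suc i)) (\<lambda>(a, c). S i a c)"
    by (simp_all add: Ss_def less_diff_conv)
  have entry: "Ss ! i $$ (a, c) = S i a c" if "a < d i" "c < d (Suc i)" for i a c
    using that d_pos_iff[of "Suc i"] by (simp add: Ss)
  have pos: "0 < d i" if "i < L" for i using that d_pos_iff by simp
  \<comment> \<open>\<open>Ss\<close> is known to agree with \<open>S\<close> only inside the
    blocks; all entries that \<open>normalized_blocks\<close> reads lie there.\<close>
  have N': "normalized_blocks L d (\<lambda>i a c. Ss ! i $$ (a, c))"
  proof -
    have L': "Suc (L - 2) = L - 1" "L - 2 < L" using L by auto
    show ?thesis
      using N pos L L' unfolding normalized_blocks_def by (auto simp: entry)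
  qed
  have bd: "block_data ds Ss"
    unfolding block_data_def
  proof (intro conjI allI impI)
    fix i assume "i < length Ss"
    then have i: "Suc i < L" by (simp add: Ss)
    show "Ss ! i \<in> carrier_mat (ds ! i) (ds ! (i + 1))" using i by (simp add: Ss ds)
    show "Ss ! i $$ (ds ! i - 1, 0) \<noteq> 0"
      using N' i unfolding normalized_blocks_def by (simp add: ds)
  qed (use L pos in \<open>auto simp: Ss ds ds_def\<close>)
  moreover have "normalized ds Ss"
    using N' normalized_iff_normalized_blocks[OF bd] by (simp add: ds bs)
  moreover have "block_coords sU A L d \<alpha> lam x E (\<lambda>i a c. Ss ! i $$ (a, c))"
    by unfold_locales (simp_all add: lam_nonzero x_E entry)
  ultimately show ?thesis using that[of ds Ss] ds Ss bs by auto
qed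

section \<open>Classification of the uniserial representations that are faithful on V\<close>

theorem theorem4p4:
  fixes sV :: "'k :: {alg_closed_field, field_char_0} \<Rightarrow> 'v :: ab_group_add \<Rightarrow> 'v"
    and sU :: "'k \<Rightarrow> 'u :: ab_group_add \<Rightarrow> 'u"
    and T :: "'k \<times> ('k, 'v) lie_term set \<Rightarrow> 'u \<Rightarrow> 'u"
    and v :: "nat \<Rightarrow> 'v" and n :: nat and lam :: 'k and X :: "'v \<Rightarrow> 'v"
  assumes n: "n \<ge> 2" and lam: "lam \<noteq> 0"
    and V: "vector_space sV"
    and basis: "inj_on v {..<n}" "\<not> Modules.module.dependent sV (v ` {..<n})"
      "Modules.module.span sV (v ` {..<n}) = UNIV"
    and X: "Vector_Spaces.linear sV sV X"
      "\<And>j. j < n - 1 \<Longrightarrow> X (v j) = sV lam (v j) + v (j + 1)"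
      "X (v (n - 1)) = sV lam (v (n - 1))"
    and T: "lie_representation (galg sV X) sU T" "finite_dim sU" "uniserial (galg sV X) sU T"
    and faithful: "rep_kernel (galg sV X) T \<inter> range (g_V sV) = {\<zero>\<^bsub>galg sV X\<^esub>}"
  shows "\<exists>!(ds, \<alpha>, S).
    block_data ds S \<and> normalized ds S \<and>
    sum_list ds = vector_space.dim sU UNIV \<and>
    Max {ds ! i + ds ! (i + 1) | i. i < length S} = n + 1 \<and>
    (\<exists>R. is_R_rep sV X n v lam ds \<alpha> S R \<and>
      isomorphic_to_matrix_rep (galg sV X) sU T (sum_list ds) R)"
proof -
  note fin = T(2) and uni = T(3)
  have U: "vector_space sU" and hom: "T \<in> lie_hom (galg sV X) (gl_space sU)"
    using T(1) by (auto simp: lie_representation_def)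
  interpret galg_rep sU sV T v n lam X
    by (rule galg_rep.intro[OF U galg_rep_axioms.intro]) (fact n lam V basis X hom)+
  obtain n_as f where J: "0 \<notin> fst ` set n_as" "sum_list (map fst n_as) = vector_space.dim sU UNIV"
      "vec_iso sU (sum_list (map fst n_as)) f" "\<And>u. f (A u) = jordan_matrix n_as *\<^sub>v f u"
    using jordan_vec_iso_exists[OF U fin A_linear] by blast
  let ?bs = "map fst n_as" and ?x = "vec_coord (map fst n_as) f"
  interpret j: jordan_coords sU A "length ?bs" "block_size ?bs" "\<lambda>i. snd (n_as ! i)" ?x
  proof (rule jordan_coords_vec_coord[OF U _ J(3)])
    show "0 \<notin> set ?bs" using J(1) by simp
    show "f (A u) $ (block_offset ?bs i + a) = snd (n_as ! i) * f u $ (block_offset ?bs i + a) +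
        (if Suc a < ?bs ! i then f u $ (block_offset ?bs i + Suc a) else 0)"
      if "i < length ?bs" "a < ?bs ! i" for u i a
      using that mult_jordan_matrix_index[OF vec_isoD(1)[OF J(3), of u], of i a] by (simp add: J(4))
  qed
  interpret j: jordan_ad_chain sU A "length ?bs" "block_size ?bs" "\<lambda>i. snd (n_as ! i)" ?x Es lam n ..
  obtain u where "Es (n - 1) u \<noteq> 0" using Es_last_nonzero[OF basis(2) faithful] .
  with j.normalized_block_coords_exist uni[unfolded uniserial_iff]
  obtain d \<alpha> x S where x: "block_coords sU A (length ?bs) d \<alpha> lam x (Es 0) S"
      "normalized_blocks (length ?bs) d S" "2 \<le> length ?bs"
      "(\<Sum>i<length ?bs. d i) = (\<Sum>i<length ?bs. block_size ?bs i)"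
      "\<forall>i. Suc i < length ?bs \<longrightarrow> d i + d (Suc i) \<le> n + 1"
      "\<exists>i. Suc i < length ?bs \<and> d i + d (Suc i) = n + 1"
    by blast
  obtain ds Ss where S: "block_data ds Ss" "normalized ds Ss" "length ds = length ?bs"
      "length Ss = length ?bs - 1" "\<And>i. i < length ?bs \<Longrightarrow> ds ! i = d i" "block_size ds = d"
      "block_coords sU A (length ds) (block_size ds) \<alpha> lam x (Es 0) (\<lambda>i a c. Ss ! i $$ (a, c))"
    using block_coords_lists[OF x(1-3)] by blast
  have sum: "sum_list ds' = (\<Sum>i<length ds'. block_size ds' i)" for ds'
    by (simp add: sum_list_sum_nth atLeast0LessThan block_size_def)
  \<comment> \<open>Since the Jordan form the blocks have only been permuted, so their sizes still
    add up to the dimension.\<close>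
  have "sum_list ds = vector_space.dim sU UNIV"
    using x(4) J(2) unfolding sum[of ds] sum[of ?bs] S(3,6) by simp
  moreover have "Max {ds ! i + ds ! (i + 1) | i. i < length Ss} = n + 1"
  proof (rule Max_eqI)
    show "finite {ds ! i + ds ! (i + 1) | i. i < length Ss}" by simp
    show "y \<le> n + 1" if "y \<in> {ds ! i + ds ! (i + 1) | i. i < length Ss}" for y
      using that x(5) S(4,5) by auto
    show "n + 1 \<in> {ds ! i + ds ! (i + 1) | i. i < length Ss}"
    proof -
      obtain i where i: "Suc i < length ?bs" "d i + d (Suc i) = n + 1" using x(6) by blast
      then have "i < length Ss" "ds ! i = d i" "ds ! (i + 1) = d (Suc i)" using S(4,5) by auto
      then show ?thesis using i(2) by (intro CollectI exI[of _ i]) simp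
    qed
  qed
  moreover have "\<exists>R. is_R_rep sV X n v lam ds \<alpha> Ss R \<and>
      isomorphic_to_matrix_rep (galg sV X) sU T (sum_list ds) R"
    by (rule R_rep_exists) (rule vec_iso_block_vec[OF S(7,1)])+
  ultimately have exists: "block_data ds Ss \<and> normalized ds Ss \<and>
    sum_list ds = vector_space.dim sU UNIV \<and>
    Max {ds ! i + ds ! (i + 1) | i. i < length Ss} = n + 1 \<and>
    (\<exists>R. is_R_rep sV X n v lam ds \<alpha> Ss R \<and>
      isomorphic_to_matrix_rep (galg sV X) sU T (sum_list ds) R)"
    using S(1,2) by blast
  show ?thesis
  proof (rule ex1I[of _ "(ds, \<alpha>, Ss)"])
    show "case (ds, \<alpha>, Ss) of (ds, \<alpha>, S) \<Rightarrow> block_data ds S \<and> normalized ds S \<and>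
      sum_list ds = vector_space.dim sU UNIV \<and>
      Max {ds ! i + ds ! (i + 1) | i. i < length S} = n + 1 \<and>
      (\<exists>R. is_R_rep sV X n v lam ds \<alpha> S R \<and>
        isomorphic_to_matrix_rep (galg sV X) sU T (sum_list ds) R)"
      unfolding prod.case by (rule exists)
  next
    fix z :: "nat list \<times> 'k \<times> 'k mat list"
    obtain ds' \<alpha>' S' where z: "z = (ds', \<alpha>', S')" by (cases z)
    assume "case z of (ds, \<alpha>, S) \<Rightarrow> block_data ds S \<and> normalized ds S \<and>
      sum_list ds = vector_space.dim sU UNIV \<and>
      Max {ds ! i + ds ! (i + 1) | i. i < length S} = n + 1 \<and>
      (\<exists>R. is_R_rep sV X n v lam ds \<alpha> S R \<and>
        isomorphic_to_matrix_rep (galg sV X) sU T (sum_list ds) R)"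
    then obtain R' where R': "block_data ds' S'" "normalized ds' S'"
        "is_R_rep sV X n v lam ds' \<alpha>' S' R'"
        "isomorphic_to_matrix_rep (galg sV X) sU T (sum_list ds') R'"
      unfolding z prod.case by blast
    obtain R where R: "is_R_rep sV X n v lam ds \<alpha> Ss R"
        "isomorphic_to_matrix_rep (galg sV X) sU T (sum_list ds) R"
      using exists by blast
    show "z = (ds, \<alpha>, Ss)"
      using normalized_R_rep_unique[OF R'(1,2) S(1,2) R'(3,4) R] z by simp
  qed
qed

end
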